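(* Let $k\in\mathbb Z_{\ge0}$, $s\in\mathbb Z_{>0}$, $t\in\{0,1\}$, and let $\lambda=((k+1)^s,(k)^t)$ be the partition with $s$ parts equal to $k+1$ followed by $t$ parts equal to $k$. Then $$T\big(X_{-\lambda}\,e^{-(s+t)h/2}\big)=c(\alpha)\,Q_\lambda(\alpha^{-1}),$$ where $c(\alpha)$ is a rational function of $\alpha$, and $c(1)=(-1)^{s(s-1+2t)/2}\,s!$.
   Context: Here $\alpha$ is a positive integer. Partitions are finite nonincreasing sequences of nonnegative integers, also written $(1^{m_1}2^{m_2}\cdots)$ with $m_i$ the multiplicity of $i$; $l(\lambda)$ is the number of nonzero parts, $z_\lambda=\prod_{i\ge1}i^{m_i}m_i!$; $\lambda\ge\mu$ is the dominance order. Space: $V_0=\mathrm{Sym}(h_{-1},h_{-2},\dots)$ is the symmetric algebra over $\mathbb C$ generated by $h_{-1},h_{-2},\dots$; for $n>0$, $h_{-n}$ acts by multiplication and $h_n$ acts as $\alpha^{-1}n\,\partial/\partial h_{-n}$; $h_{-\lambda}=h_{-\lambda_1}h_{-\lambda_2}\cdots$ (product over nonzero parts). $V=V_0\otimes\mathbb C[\frac12\mathbb Z]$, where the group algebra $\mathbb C[\frac12\mathbb Z]$ has basis $\{e^{rh}:r\in\frac12\mathbb Z\}$; the operators $h_{\pm n}$ act on the first factor, and $e^{rh}$ denotes $1\otimes e^{rh}$. Vertex operator: $$X(z)=\exp\Big(\sum_{n\ge1}\frac{z^n}{n}\alpha h_{-n}\Big)\exp(2\alpha\ln z\,\partial_h+h)\exp\Big(\sum_{n\ge1}\frac{z^{-n}}{-n}2\alpha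 h_n\Big)=\sum_{n\in\mathbb Z}X_nz^{-n},$$ where the middle factor acts by $e^{rh}\mapsto z^{(r+\frac12)2\alpha}e^{(r+1)h}$. For $\lambda=((k+1)^s,(k)^t)$, $X_{-\lambda}=(X_{-(k+1)})^s(X_{-k})^t$ (including the factor $X_0$ when $k=0$, $t=1$). Map $T$: let $\Lambda_{\mathbb C}$ be the ring of symmetric functions over $\mathbb C$, and $p_\lambda$, $m_\lambda$ the power sum and monomial symmetric functions. $T:V\to\Lambda_{\mathbb C}$ is the linear map with $T(h_{-\lambda}\otimes e^{rh})=p_\lambda$. Jack functions: with respect to the scalar product $\langle p_\lambda,p_\mu\rangle=\delta_{\lambda\mu}\alpha^{-l(\lambda)}z_\lambda$, the Jack functions $P_\lambda(\alpha^{-1})$ are the unique pairwise orthogonal symmetric functions of the form $P_\lambda(\alpha^{-1})=\sum_{\mu\le\lambda}c_{\lambda\mu}(\alpha^{-1})m_\mu$ with $c_{\lambda\mu}(\alpha^{-1})\in\mathbb Q(\alpha)$ and $c_{\lambda\lambda}(\alpha^{-1})=1$; $Q_\lambda(\alpha^{-1})=b_\lambda(\alpha^{-1})P_\lambda(\alpha^{-1})$ is the dual Jack function, i.e. the scalar multiple of $P_\lambda(\alpha^{-1})$ with $\langle P_\lambda(\alpha^{-1}),Q_\lambda(\alpha^{-1})\rangle=1$.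
   Formalization: The claim that c(α) is a rational function of α is false (for λ=(1,1), c(α)=(-1)^α·binom(2α,α)); it is replaced by: c takes rational values at positive integers α and c(α+1)/c(α) is a rational function of α. *)

theory Defs
  imports
    Complex_Main
    "HOL-Library.Poly_Mapping"
    "HOL-Library.Multiset"
    "HOL-Computational_Algebra.Polynomial"
begin

subsection \<open>Partitions\<close>

text \<open>Partitions are kept without trailing zeros.\<close>

definition is_partition :: "nat list \<Rightarrow> bool" where
  "is_partition lam \<longleftrightarrow> sorted_wrt (\<ge>) lam \<and> 0 \<notin> set lam"

definition z_part :: "nat list \<Rightarrow> nat" where
  "z_part lam = (\<Prod>i\<in>set lam. i ^ count_list lam i * fact (count_list lam i))"

definition dominates :: "nat list \<Rightarrow> nat list \<Rightarrow> bool" where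
  "dominates lam mu \<longleftrightarrow> sum_list mu = sum_list lam \<and>
     (\<forall>i. sum_list (take i mu) \<le> sum_list (take i lam))"


subsection \<open>The space \<open>V\<close>\<close>

text \<open>
  \<open>V\<^sub>0\<close> is the polynomial ring over the complex numbers in countably many variables;
  the variable with index \<open>i\<close> is \<open>h\<^bsub>-(i+1)\<^esub>\<close>, so there is no variable
  \<open>h\<^sub>0\<close>.
  The space \<open>V\<close> is the free \<open>V\<^sub>0\<close>-module on the elements \<open>e\<^bsup>rh\<^esup>\<close> with
  \<open>2r\<close> an integer; the basis element \<open>e\<^bsup>rh\<^esup>\<close> is indexed by the integer \<open>m = 2r\<close>.
\<close>

type_synonym V0 = "(nat \<Rightarrow>\<^sub>0 nat) \<Rightarrow>\<^sub>0 complex"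
type_synonym V = "int \<Rightarrow>\<^sub>0 V0"

definition smult0 :: "complex \<Rightarrow> V0 \<Rightarrow> V0" where
  "smult0 a u = Poly_Mapping.map ((*) a) u"

definition deriv0 :: "nat \<Rightarrow> V0 \<Rightarrow> V0" where
  "deriv0 i u = (\<Sum>a\<in>Poly_Mapping.keys u.
     Poly_Mapping.single (a - Poly_Mapping.single i 1)
       (of_nat (Poly_Mapping.lookup a i) * Poly_Mapping.lookup u a))"

text \<open>
  For \<open>n \<ge> 1\<close>, \<open>h_neg n\<close> and \<open>h_pos \<alpha> n\<close> are the operators
  \<open>h\<^bsub>-n\<^esub>\<close> and \<open>h\<^bsub>n\<^esub>\<close>.
\<close>

definition h_neg :: "nat \<Rightarrow> V0 \<Rightarrow> V0" where
  "h_neg n u = Poly_Mapping.single (Poly_Mapping.single (n - 1) 1) 1 * u"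

definition h_pos :: "nat \<Rightarrow> nat \<Rightarrow> V0 \<Rightarrow> V0" where
  "h_pos \<alpha> n u = smult0 (of_nat n / of_nat \<alpha>) (deriv0 (n - 1) u)"

text \<open>\<open>e_half m\<close> is \<open>1 \<otimes> e\<^bsup>(m/2)h\<^esup>\<close>.\<close>

definition e_half :: "int \<Rightarrow> V" where
  "e_half m = Poly_Mapping.single m 1"


subsection \<open>The vertex operator\<close>

text \<open>
  A formal power series with operators on \<open>V\<^sub>0\<close> as coefficients is the sequence of its
  coefficients.
\<close>

type_synonym op_series = "nat \<Rightarrow> V0 \<Rightarrow> V0"

definition ops_mult :: "op_series \<Rightarrow> op_series \<Rightarrow> op_series" where
  "ops_mult F G n u = (\<Sum>i\<le>n. F i (G (n - i) u))"

primrec ops_power :: "op_series \<Rightarrow> nat \<Rightarrow> op_series" where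
  "ops_power F 0 = (\<lambda>n u. if n = 0 then u else 0)"
| "ops_power F (Suc j) = ops_mult F (ops_power F j)"

text \<open>
  The exponential of a series with zero constant coefficient: the \<open>j\<close>-th power then
  contributes to the coefficient \<open>n\<close> only for \<open>j \<le> n\<close>.
\<close>

definition ops_exp :: "op_series \<Rightarrow> op_series" where
  "ops_exp F n u = (\<Sum>j\<le>n. smult0 (1 / fact j) (ops_power F j n u))"

text \<open>
  \<open>X_creat \<alpha>\<close> is the left exponential factor of \<open>X(z)\<close> as a series in \<open>z\<close>, and
  \<open>X_annih \<alpha>\<close> is its right exponential factor as a series in \<open>1/z\<close>.
\<close>

definition X_creat :: "nat \<Rightarrow> op_series" where
  "X_creat \<alpha> = ops_exp (\<lambda>n u. if n = 0 then 0
      else smult0 (of_nat \<alpha> / of_nat n) (h_neg n u))"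

definition X_annih :: "nat \<Rightarrow> op_series" where
  "X_annih \<alpha> = ops_exp (\<lambda>n u. if n = 0 then 0
      else smult0 (- (2 * of_nat \<alpha>) / of_nat n) (h_pos \<alpha> n u))"

text \<open>
  On \<open>u \<otimes> e\<^bsup>(m/2)h\<^esup>\<close> the middle factor contributes
  \<open>z\<^bsup>(m/2 + 1/2) 2 \<alpha>\<^esup>\<close> \<open>= z\<^bsup>(m + 1) \<alpha>\<^esup>\<close> and raises \<open>m\<close> by \<open>2\<close>.
  Hence the coefficient of \<open>z\<^bsup>-n\<^esup>\<close> collects the terms \<open>z\<^bsup>i\<^esup>\<close> of the left and
  \<open>z\<^bsup>-j\<^esup>\<close> of the right factor with \<open>i + (m + 1) \<alpha> - j = -n\<close>.  The sum over \<open>j\<close>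
  has finite support because \<open>X_annih \<alpha> j u = 0\<close> for all large \<open>j\<close>.
\<close>

definition X_op :: "nat \<Rightarrow> int \<Rightarrow> V \<Rightarrow> V" where
  "X_op \<alpha> n v = (\<Sum>m\<in>Poly_Mapping.keys v. Poly_Mapping.single (m + 2)
     (Sum_any (\<lambda>j.
        let i = int j - n - (m + 1) * int \<alpha>
        in if i \<ge> 0
           then X_creat \<alpha> (nat i) (X_annih \<alpha> j (Poly_Mapping.lookup v m))
           else 0)))"


subsection \<open>Symmetric functions\<close>

text \<open>
  Symmetric functions in the variables \<open>x\<^sub>0, x\<^sub>1, \<dots>\<close> are represented as formal power
  series, given by the coefficient of each monomial.
\<close>

type_synonym symf = "(nat \<Rightarrow>\<^sub>0 nat) \<Rightarrow> complex"

definition sf_mult :: "symf \<Rightarrow> symf \<Rightarrow> symf" where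
  "sf_mult f g e = (\<Sum>(a, b) \<in> {(a, b). a + b = e}. f a * g b)"

definition sf_one :: symf where
  "sf_one e = (if e = 0 then 1 else 0)"

definition power_sum :: "nat \<Rightarrow> symf" where
  "power_sum n e = (if \<exists>i. e = Poly_Mapping.single i n then 1 else 0)"

definition p_sym :: "nat list \<Rightarrow> symf" where
  "p_sym lam = foldr (\<lambda>n. sf_mult (power_sum n)) lam sf_one"

definition m_sym :: "nat list \<Rightarrow> symf" where
  "m_sym lam e =
     (if image_mset (Poly_Mapping.lookup e) (mset_set (Poly_Mapping.keys e)) = mset lam
      then 1 else 0)"


subsection \<open>The map \<open>T\<close>\<close>

text \<open>\<open>h_exponent \<lambda>\<close> is the exponent of the monomial \<open>h\<^bsub>-\<lambda>\<^esub>\<close>.\<close>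

definition h_exponent :: "nat list \<Rightarrow> (nat \<Rightarrow>\<^sub>0 nat)" where
  "h_exponent lam = (\<Sum>n\<leftarrow>lam. Poly_Mapping.single (n - 1) 1)"

definition T_map :: "V \<Rightarrow> symf" where
  "T_map v = (\<lambda>e. \<Sum>m\<in>Poly_Mapping.keys v.
     \<Sum>lam \<in> {lam. is_partition lam \<and>
               h_exponent lam \<in> Poly_Mapping.keys (Poly_Mapping.lookup v m)}.
       Poly_Mapping.lookup (Poly_Mapping.lookup v m) (h_exponent lam) * p_sym lam e)"


subsection \<open>Jack functions\<close>

text \<open>
  The coordinates of a symmetric function in the basis of the \<open>p_sym \<lambda>\<close>; they are
  unspecified for power series that are not finite combinations of these.
\<close>

definition p_coords :: "symf \<Rightarrow> (nat list \<Rightarrow>\<^sub>0 complex)" where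
  "p_coords f = (THE a. (\<forall>lam\<in>Poly_Mapping.keys a. is_partition lam) \<and>
     f = (\<lambda>e. \<Sum>lam\<in>Poly_Mapping.keys a. Poly_Mapping.lookup a lam * p_sym lam e))"

text \<open>
  The (complex bilinear) scalar product with
  \<open>\<langle>p\<^bsub>\<lambda>\<^esub>, p\<^bsub>\<mu>\<^esub>\<rangle> = \<delta>\<^bsub>\<lambda>\<mu>\<^esub> \<alpha>\<^bsup>-l(\<lambda>)\<^esup> z\<^bsub>\<lambda>\<^esub>\<close>.
\<close>

definition jack_inner :: "nat \<Rightarrow> symf \<Rightarrow> symf \<Rightarrow> complex" where
  "jack_inner \<alpha> f g = (\<Sum>lam\<in>Poly_Mapping.keys (p_coords f).
     Poly_Mapping.lookup (p_coords f) lam * Poly_Mapping.lookup (p_coords g) lam *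
     (of_nat (z_part lam) / of_nat \<alpha> ^ length lam))"

text \<open>
  The characterization of the family of the \<open>P\<^bsub>\<lambda>\<^esub>(\<alpha>\<^bsup>-1\<^esup>)\<close>.
  As \<open>\<alpha>\<close> is a positive integer here, the field generated by \<open>\<alpha>\<close> over the rationals
  is the field of rationals.
\<close>

definition is_jack_family :: "nat \<Rightarrow> (nat list \<Rightarrow> symf) \<Rightarrow> bool" where
  "is_jack_family \<alpha> P \<longleftrightarrow>
     (\<forall>lam. is_partition lam \<longrightarrow>
        (\<exists>c. c lam = 1 \<and> (\<forall>mu. c mu \<in> \<rat>) \<and>
             P lam = (\<lambda>e. \<Sum>mu \<in> {mu. is_partition mu \<and> dominates lam mu}. c mu * m_sym mu e))) \<and>
     (\<forall>lam mu. is_partition lam \<longrightarrow> is_partition mu \<longrightarrow> lam \<noteq> mu \<longrightarrow>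
        jack_inner \<alpha> (P lam) (P mu) = 0)"

text \<open>The scalar multiple of \<open>P \<lambda>\<close> whose scalar product with \<open>P \<lambda>\<close> is \<open>1\<close>.\<close>

definition jack_Q :: "nat \<Rightarrow> (nat list \<Rightarrow> symf) \<Rightarrow> nat list \<Rightarrow> symf" where
  "jack_Q \<alpha> P lam = (\<lambda>e. (1 / jack_inner \<alpha> (P lam) (P lam)) * P lam e)"


subsection \<open>Rational dependence on \<open>\<alpha>\<close>\<close>

text \<open>
  The quotient of consecutive values of \<open>c\<close> is a rational function of \<open>\<alpha>\<close>
  (\<open>c\<close> is a hypergeometric term).  Every nonzero rational function without poles at the
  positive integers has this property.  It is used instead of rationality itself because the
  scalar in question is in general not a rational function: for \<open>\<lambda> = (1,1)\<close> it is
  \<open>(-1)\<^bsup>\<alpha>\<^esup> (2\<alpha> choose \<alpha>)\<close>.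
\<close>

definition rational_ratio :: "(nat \<Rightarrow> rat) \<Rightarrow> bool" where
  "rational_ratio c \<longleftrightarrow> (\<exists>p q :: rat poly. p \<noteq> 0 \<and> q \<noteq> 0 \<and>
     (\<forall>\<alpha>\<ge>1. poly q (of_nat \<alpha>) * c (\<alpha> + 1) = poly p (of_nat \<alpha>) * c \<alpha>))"

end

theory Submission
  imports Defs "HOL-Computational_Algebra.Formal_Power_Series"
begin

text \<open>
  Put \<open>n = s + t\<close>.  Normal ordering turns \<open>X\<^bsub>-\<lambda>\<^esub> e\<^bsup>-nh/2\<^esup>\<close> into the coefficient of
  \<open>w\<^bsup>\<lambda>\<^esup>\<close> in \<open>D(w) \<Prod>\<^sub>j g(w\<^sub>j)\<close>, where \<open>D = \<plusminus> \<Prod>\<^bsub>i\<noteq>j\<^esub> (1 - w\<^sub>i/w\<^sub>j)\<^bsup>\<alpha>\<^esup>\<close> and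
  \<open>g(w) = exp (\<Sum>\<^sub>m \<alpha> h\<^bsub>-m\<^esub> w\<^bsup>m\<^esup>/m)\<close>.  Let \<open>F\<close> be its image under \<open>T\<close>.

  The product \<open>\<Prod>\<^sub>j g(w\<^sub>j)\<close> is the reproducing kernel of the scalar product, so \<open>\<langle>F, f\<rangle>\<close> is the
  coefficient of \<open>w\<^bsup>\<lambda>\<^esup>\<close> in \<open>D(w) f(w\<^sub>1, \<dots>, w\<^sub>n)\<close>.  Hence \<open>\<langle>F, P\<^sub>\<nu>\<rangle> = 0\<close> unless \<open>\<nu>\<close> has at most
  \<open>n\<close> parts.  On the other hand every variable occurs in \<open>F\<close> with degree at most \<open>k + 1\<close>, so
  that \<open>\<langle>F, P\<^sub>\<nu>\<rangle> = 0\<close> unless the parts of \<open>\<nu>\<close> are at most \<open>k + 1\<close>.  The only partition of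
  \<open>|\<lambda>|\<close> with both properties is \<open>\<lambda>\<close>, so \<open>F\<close> is a multiple of \<open>Q\<^sub>\<lambda>\<close>, and the factor
  \<open>\<langle>F, P\<^sub>\<lambda>\<rangle>\<close> is Dyson's constant term for \<open>t = 0\<close> and a sum of neighbouring coefficients for
  \<open>t = 1\<close>.

  The degree bound amounts to the vanishing of coefficients of \<open>D(w) \<Prod>\<^sub>j (1 - x w\<^sub>j)\<^bsup>-\<alpha>\<^esup>\<close>.
  The coefficients of \<open>(1 - x)\<^bsup>-\<alpha>\<^esup>\<close> are the values of a polynomial \<open>q\<close> of degree \<open>\<alpha> - 1\<close> at
  the nonnegative integers, and \<open>q\<close> also vanishes at \<open>-1, \<dots>, 1 - \<alpha>\<close>.  Replacing the truncated
  function by \<open>q\<close> plus a remainder supported on \<open>r \<le> -\<alpha>\<close> and expanding the product, the terms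
  with at least two factors \<open>q\<close> vanish because \<open>(w\<^sub>i - w\<^sub>j)\<^bsup>2\<alpha>\<^esup>\<close> divides \<open>D\<close>, and the
  remaining ones vanish for degree reasons.
\<close>

abbreviation "lookup \<equiv> Poly_Mapping.lookup"
abbreviation "keys \<equiv> Poly_Mapping.keys"
abbreviation "single \<equiv> Poly_Mapping.single"

declare One_nat_def [simp del]

type_synonym mono = "nat \<Rightarrow>\<^sub>0 nat"

section \<open>Multivariate polynomials: coefficients, linear functionals and partial
  derivatives\<close>

section \<open>Polynomials\<close>

abbreviation var :: "nat \<Rightarrow> mono \<Rightarrow>\<^sub>0 'a::comm_ring_1" where
  "var i \<equiv> single (single i 1) 1"

text \<open>A finitely supported map is a finite sum of single terms, so additive statements need
  checking only on these. It serves for polynomials and for exponents alike.\<close>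

lemma mpoly_induct [case_names single add]:
  fixes p :: "'k \<Rightarrow>\<^sub>0 'a::comm_monoid_add"
  assumes "\<And>a c. Q (single a c)" and "\<And>p q. Q p \<Longrightarrow> Q q \<Longrightarrow> Q (p + q)"
  shows "Q p"
proof (induction p rule: update_induct)
  case const
  have "Q (single a 0)" for a by (rule assms)
  then show ?case by simp
next
  case (update f a b)
  have "Poly_Mapping.update a b f = single a b + f"
    using update(1)
    by (intro poly_mapping_eqI)
       (auto simp: lookup_add lookup_update lookup_single when_def not_in_keys_iff_lookup_eq_zero)
  then show ?case using assms update by simp
qed

lemma lookup_single_mult:
  fixes p :: "mono \<Rightarrow>\<^sub>0 'a::comm_ring_1"
  shows "lookup (single a c * p) (a + e) = c * lookup p e"
  by (induction p rule: mpoly_induct)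
     (auto simp: mult_single lookup_single when_def lookup_add distrib_left)

lemma lookup_single_mult_0:
  fixes p :: "mono \<Rightarrow>\<^sub>0 'a::comm_ring_1"
  shows "(\<And>f. e \<noteq> a + f) \<Longrightarrow> lookup (single a c * p) e = 0"
  by (induction p rule: mpoly_induct)
     (auto simp: mult_single lookup_single when_def lookup_add distrib_left)

lemma lookup_const_mult:
  fixes p :: "mono \<Rightarrow>\<^sub>0 'a::comm_ring_1"
  shows "lookup (single 0 c * p) e = c * lookup p e"
  using lookup_single_mult[of 0 c p e] by simp

lemma prod_single:
  "(\<Prod>i\<in>A. single (a i) (c i)) = (single (\<Sum>i\<in>A. a i) (\<Prod>i\<in>A. c i) :: mono \<Rightarrow>\<^sub>0 'a::comm_ring_1)"
  by (induction A rule: infinite_finite_induct) (auto simp: mult_single)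

lemma single_power:
  "single a c ^ n = (single (of_nat n * a) (c ^ n) :: mono \<Rightarrow>\<^sub>0 'a::comm_ring_1)"
  for a :: mono
  by (induction n) (auto simp: mult_single algebra_simps)

lemma of_nat_mult_single_mono: "of_nat n * single i m = (single i (n * m) :: mono)"
  by (induction n) (auto simp: distrib_right simp flip: single_add)

text \<open>The linear extension of \<open>\<phi>\<close> from monomials to integer polynomials.
  Coefficient extraction against a kernel and sums over truncated products are both of this
  form.\<close>

definition lin :: "(mono \<Rightarrow> 'b::comm_ring_1) \<Rightarrow> (mono \<Rightarrow>\<^sub>0 int) \<Rightarrow> 'b" where
  "lin \<phi> P = (\<Sum>e\<in>keys P. of_int (lookup P e) * \<phi> e)"

lemma lin_superset:
  "finite A \<Longrightarrow> keys P \<subseteq> A \<Longrightarrow> lin \<phi> P = (\<Sum>e\<in>A. of_int (lookup P e) * \<phi> e)"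
  unfolding lin_def by (rule sum.mono_neutral_left) (auto simp: in_keys_iff)

lemma lin_0 [simp]: "lin \<phi> 0 = 0"
  by (simp add: lin_def)

lemma lin_single [simp]: "lin \<phi> (single a c) = of_int c * \<phi> a"
  by (simp add: lin_def)

lemma lin_add: "lin \<phi> (P + Q) = lin \<phi> P + lin \<phi> Q"
  using keys_add[of P Q]
  by (simp add: lin_superset[of "keys P \<union> keys Q"] lookup_add distrib_right sum.distrib)

lemma lin_uminus: "lin \<phi> (- P) = - lin \<phi> P"
  using lin_add[of \<phi> P "-P"] by (simp add: add_eq_0_iff)

lemma lin_diff: "lin \<phi> (P - Q) = lin \<phi> P - lin \<phi> Q"
  using lin_add[of \<phi> P "-Q"] by (simp add: lin_uminus)

lemma lin_sum: "lin \<phi> (sum f A) = (\<Sum>x\<in>A. lin \<phi> (f x))"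
  by (induction A rule: infinite_finite_induct) (auto simp: lin_add)

lemma lin_single_mult:
  "lin \<phi> (single a c * P) = of_int c * lin (\<lambda>e. \<phi> (a + e)) P"
  by (induction P rule: mpoly_induct)
     (auto simp: mult_single lin_add distrib_left algebra_simps)

lemma lin_const_mult: "lin \<phi> (single 0 n * P) = of_int n * lin \<phi> P"
  using lin_single_mult[of \<phi> 0 n P] by simp

lemma lin_cong: "(\<And>e. e \<in> keys P \<Longrightarrow> \<phi> e = \<psi> e) \<Longrightarrow> lin \<phi> P = lin \<psi> P"
  by (simp add: lin_def)

lemma lin_fun_diff: "lin (\<lambda>e. \<phi> e - \<psi> e) P = lin \<phi> P - lin \<psi> P"
  by (simp add: lin_def right_diff_distrib sum_subtractf)

lemma lin_fun_sum: "lin (\<lambda>e. \<Sum>x\<in>A. \<phi> x e) P = (\<Sum>x\<in>A. lin (\<phi> x) P)"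
  by (simp add: lin_def sum_distrib_left sum.swap[of _ A])

text \<open>The formula of \<open>deriv0\<close> over any commutative ring: derivatives are taken
  both on \<open>V0\<close> and on integer polynomials.\<close>

definition pdiff :: "nat \<Rightarrow> (mono \<Rightarrow>\<^sub>0 'a::comm_ring_1) \<Rightarrow> mono \<Rightarrow>\<^sub>0 'a" where
  "pdiff i u = (\<Sum>a\<in>keys u. single (a - single i 1) (of_nat (lookup a i) * lookup u a))"

lemma lookup_pdiff:
  "lookup (pdiff i u) e = of_nat (lookup e i + 1) * lookup u (e + single i 1)"
proof -
  \<comment> \<open>Truncated subtraction is not injective on exponents: if variable
    \<open>i\<close> is absent from \<open>a\<close>, then \<open>a - single i 1 = a\<close>. In
    that case the factor \<open>lookup a i\<close> is 0.\<close>
  have *: "(of_nat (lookup a i) * lookup u a when a - single i 1 = e) =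
      (if a = e + single i 1 then of_nat (lookup e i + 1) * lookup u a else 0)" for a
  proof (cases "lookup a i = 0")
    case True
    then show ?thesis by (auto simp: lookup_add)
  next
    case False
    then have "a - single i 1 + single i 1 = a"
      by (intro poly_mapping_eqI) (auto simp: lookup_add lookup_minus lookup_single when_def)
    then have "a - single i 1 = e \<longleftrightarrow> a = e + single i 1" by auto
    then show ?thesis by (auto simp: lookup_add)
  qed
  show ?thesis
    unfolding pdiff_def lookup_sum lookup_single *
    by (auto simp: in_keys_iff sum.delta)
qed

lemma pdiff_add: "pdiff i (u + v) = pdiff i u + pdiff i v"
  by (intro poly_mapping_eqI) (simp add: lookup_pdiff lookup_add algebra_simps)

lemma pdiff_0 [simp]: "pdiff i 0 = 0"
  by (simp add: pdiff_def)

lemma pdiff_sum: "pdiff i (sum f A) = (\<Sum>x\<in>A. pdiff i (f x))"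
  by (induction A rule: infinite_finite_induct) (auto simp: pdiff_add)

lemma pdiff_single: "pdiff i (single a c) = single (a - single i 1) (of_nat (lookup a i) * c)"
  by (cases "c = 0") (auto simp: pdiff_def)

lemma pdiff_mult: "pdiff i (u * v) = pdiff i u * v + u * pdiff i v"
proof (induction u rule: mpoly_induct)
  case (single a c)
  show ?case
  proof (induction v rule: mpoly_induct)
    case (single b d)
    have "single (a + b - single i 1) (of_nat (lookup a i) * c * d) =
        single (a - single i 1 + b) (of_nat (lookup a i) * c * d)"
    proof (cases "lookup a i = 0")
      case False
      then have "a + b - single i 1 = a - single i 1 + b"
        by (intro poly_mapping_eqI) (auto simp: lookup_add lookup_minus lookup_single when_def)
      then show ?thesis by simp
    qed simp
    moreover have "single (a + b - single i 1) (of_nat (lookup b i) * c * d) =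
        single (a + (b - single i 1)) (of_nat (lookup b i) * c * d)"
    proof (cases "lookup b i = 0")
      case False
      then have "a + b - single i 1 = a + (b - single i 1)"
        by (intro poly_mapping_eqI) (auto simp: lookup_add lookup_minus lookup_single when_def)
      then show ?thesis by simp
    qed simp
    moreover have "pdiff i (single a c * single b d) =
        single (a + b - single i 1) (of_nat (lookup a i) * c * d) +
        single (a + b - single i 1) (of_nat (lookup b i) * c * d)"
      by (simp add: mult_single pdiff_single lookup_add algebra_simps flip: single_add)
    ultimately show ?case
      by (simp add: mult_single pdiff_single mult_ac add_ac)
  next
    case (add p q)
    then show ?case by (simp add: pdiff_add distrib_left algebra_simps)
  qed
next
  case (add p q)
  then show ?case by (simp add: pdiff_add algebra_simps)
qed

lemma pdiff_one [simp]: "pdiff i 1 = 0"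
  by (simp add: pdiff_single flip: single_one)

lemma pdiff_prod:
  "finite A \<Longrightarrow> pdiff i (prod f A) = (\<Sum>x\<in>A. pdiff i (f x) * prod f (A - {x}))"
proof (induction A rule: finite_induct)
  case (insert x A)
  have "(\<Sum>y\<in>A. pdiff i (f y) * prod f (insert x A - {y})) =
      (\<Sum>y\<in>A. f x * (pdiff i (f y) * prod f (A - {y})))"
  proof (intro sum.cong refl)
    fix y assume "y \<in> A"
    with insert have "insert x A - {y} = insert x (A - {y})" by auto
    with insert show "pdiff i (f y) * prod f (insert x A - {y}) = f x * (pdiff i (f y) * prod f (A - {y}))"
      by (simp add: mult_ac)
  qed
  with insert show ?case by (simp add: pdiff_mult sum_distrib_left)
qed simp

lemma deriv0_eq_pdiff: "deriv0 = pdiff"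
  by (intro ext) (simp add: deriv0_def pdiff_def)

lemma smult0_eq: "smult0 a u = single 0 a * u"
  by (simp add: smult0_def mult_map_scale_conv_mult)

section \<open>Recursions for powers and exponentials of series of commuting operators\<close>

section \<open>Exponentials of operator series\<close>

lemma sum_triangle_swap:
  fixes f :: "nat \<Rightarrow> nat \<Rightarrow> 'a::comm_monoid_add"
  shows "(\<Sum>i\<le>n. \<Sum>l\<le>n - i. f i l) = (\<Sum>l\<le>n. \<Sum>i\<le>n - l. f i l)"
  by (simp add: sum.Sigma)
     (rule sum.reindex_bij_witness[of _ "\<lambda>(a, b). (b, a)" "\<lambda>(a, b). (b, a)"]; auto)

text \<open>The coefficients of \<open>z (F^(j+1))' = (j+1) z F' F^j\<close>, which holds because
  the coefficients of \<open>F\<close> commute. The induction splits the weight \<open>n\<close> as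
  \<open>i + (n - i)\<close>.\<close>

lemma ops_power_rec:
  fixes F :: op_series
  assumes add: "\<And>i u v. F i (u + v) = F i u + F i v"
    and comm: "\<And>i j u. F i (F j u) = F j (F i u)"
  shows "of_nat n * ops_power F (Suc j) n u =
    of_nat (Suc j) * (\<Sum>i\<le>n. of_nat i * F i (ops_power F j (n - i) u))"
proof (induction j arbitrary: n)
  have F0: "F i 0 = 0" for i using add[of i 0 0] by simp
  case 0
  have "of_nat n * ops_power F (Suc 0) n u = of_nat n * F n u"
    by (simp add: ops_mult_def if_distrib[of "F _"] F0 sum.delta' cong: if_cong)
  also have "\<dots> = (\<Sum>i\<le>n. of_nat i * F i (ops_power F 0 (n - i) u))"
    by (subst sum.remove[of _ n]) (auto simp: F0 intro!: sum.neutral)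
  finally show ?case by simp
next
  have F0: "F i 0 = 0" for i using add[of i 0 0] by simp
  have Fsum: "F i (sum f A) = (\<Sum>x\<in>A. F i (f x))" for i A and f :: "nat \<Rightarrow> V0"
    by (induction A rule: infinite_finite_induct) (auto simp: add F0)
  have Fnat: "F i (of_nat m * v) = of_nat m * F i v" for i m v
    by (induction m) (auto simp: add F0 distrib_right)
  case (Suc j)
  let ?p = "ops_power F"
  have p_Suc: "?p (Suc k) m u = (\<Sum>i\<le>m. F i (?p k (m - i) u))" for k m
    by (simp add: ops_mult_def)
  have "of_nat n * ?p (Suc (Suc j)) n u = (\<Sum>i\<le>n. of_nat n * F i (?p (Suc j) (n - i) u))"
    by (simp only: p_Suc[of "Suc j"] sum_distrib_left)
  also have "\<dots> = (\<Sum>i\<le>n. of_nat i * F i (?p (Suc j) (n - i) u)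
      + F i (of_nat (n - i) * ?p (Suc j) (n - i) u))"
  proof (intro sum.cong refl)
    fix i assume "i \<in> {..n}"
    then have "of_nat n = (of_nat i + of_nat (n - i) :: V0)" by (simp flip: of_nat_add)
    then show "of_nat n * F i (?p (Suc j) (n - i) u) = of_nat i * F i (?p (Suc j) (n - i) u)
      + F i (of_nat (n - i) * ?p (Suc j) (n - i) u)"
      by (simp only: Fnat distrib_right)
  qed
  also have "\<dots> = (\<Sum>i\<le>n. of_nat i * F i (?p (Suc j) (n - i) u))
      + (\<Sum>i\<le>n. F i (of_nat (Suc j) * (\<Sum>l\<le>n - i. of_nat l * F l (?p j (n - i - l) u))))"
    by (simp only: sum.distrib Suc.IH)
  also have "(\<Sum>i\<le>n. F i (of_nat (Suc j) * (\<Sum>l\<le>n - i. of_nat l * F l (?p j (n - i - l) u)))) =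
      of_nat (Suc j) * (\<Sum>i\<le>n. \<Sum>l\<le>n - i. of_nat l * F l (F i (?p j (n - i - l) u)))"
    by (simp only: Fnat Fsum sum_distrib_left comm[of _ _ "?p j _ u"])
  also have "(\<Sum>i\<le>n. \<Sum>l\<le>n - i. of_nat l * F l (F i (?p j (n - i - l) u))) =
      (\<Sum>l\<le>n. \<Sum>i\<le>n - l. of_nat l * F l (F i (?p j (n - l - i) u)))"
    by (subst sum_triangle_swap) (simp add: add.commute)
  also have "\<dots> = (\<Sum>l\<le>n. of_nat l * F l (?p (Suc j) (n - l) u))"
    by (simp only: p_Suc Fsum sum_distrib_left)
  finally show ?case by (simp add: algebra_simps)
qed


lemma ops_power_eq_0:
  fixes F :: op_series
  assumes add: "\<And>i u v. F i (u + v) = F i u + F i v"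
    and zero: "\<And>u. F 0 u = 0"
  shows "n < j \<Longrightarrow> ops_power F j n u = 0"
proof (induction j arbitrary: n)
  case (Suc j)
  have F0: "F i 0 = 0" for i using add[of i 0 0] by simp
  have "F i (ops_power F j (n - i) u) = 0" if "i \<le> n" for i
    using Suc that by (cases "i = 0") (auto simp: zero F0)
  then show ?case by (simp add: ops_mult_def)
qed simp

lemma ops_exp_0:
  assumes "\<And>u. F 0 u = 0"
  shows "ops_exp F 0 u = u"
  using assms by (simp add: ops_exp_def smult0_eq)

text \<open>The coefficients of \<open>z E' = z F' E\<close> for \<open>E = exp F\<close>. Together
  with \<open>ops_exp_0\<close> this determines the exponential, and both exponential factors of the
  vertex operator are handled through it.\<close>

lemma ops_exp_rec:
  fixes F :: op_series
  assumes add: "\<And>i u v. F i (u + v) = F i u + F i v"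
    and scale: "\<And>i a u. F i (smult0 a u) = smult0 a (F i u)"
    and comm: "\<And>i j u. F i (F j u) = F j (F i u)"
    and zero: "\<And>u. F 0 u = 0"
  shows "of_nat n * ops_exp F n u = (\<Sum>i=1..n. of_nat i * F i (ops_exp F (n - i) u))"
proof (cases n)
  case (Suc n')
  have F0: "F i 0 = 0" for i using add[of i 0 0] by simp
  have Fsum: "F i (sum f A) = (\<Sum>x\<in>A. F i (f x))" for i A and f :: "nat \<Rightarrow> V0"
    by (induction A rule: infinite_finite_induct) (auto simp: add F0)
  have "of_nat n * ops_exp F n u =
      (\<Sum>j\<le>n. smult0 (1 / fact j) (of_nat n * ops_power F j n u))"
    by (simp add: ops_exp_def sum_distrib_left smult0_eq algebra_simps)
  also have "\<dots> = (\<Sum>j\<le>n'. smult0 (1 / fact (Suc j)) (of_nat n * ops_power F (Suc j) n u))"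
    unfolding Suc by (subst sum.atMost_Suc_shift) (simp add: smult0_eq)
  also have "\<dots> = (\<Sum>j\<le>n'. \<Sum>i\<le>n. smult0 (1 / fact j) (of_nat i * F i (ops_power F j (n - i) u)))"
  proof (intro sum.cong refl)
    fix j
    have "smult0 (1 / fact (Suc j)) (of_nat (Suc j) * v) = smult0 (1 / fact j) v" for v
    proof -
      have "single 0 (1 / fact (Suc j)) * of_nat (Suc j) = (single 0 (1 / fact j) :: V0)"
      proof -
        have "1 / fact (Suc j) * of_nat (Suc j) = (1 / fact j :: complex)"
          by (simp add: fact_Suc del: of_nat_Suc)
        then show ?thesis by (simp only: of_nat_single o_apply mult_single add_0_left)
      qed
      then show ?thesis by (simp only: smult0_eq mult.assoc[symmetric])
    qed
    then show "smult0 (1 / fact (Suc j)) (of_nat n * ops_power F (Suc j) n u) =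
        (\<Sum>i\<le>n. smult0 (1 / fact j) (of_nat i * F i (ops_power F j (n - i) u)))"
      by (simp only: ops_power_rec[OF add comm]) (simp only: smult0_eq sum_distrib_left)
  qed
  also have "\<dots> = (\<Sum>i\<le>n. \<Sum>j\<le>n'. smult0 (1 / fact j) (of_nat i * F i (ops_power F j (n - i) u)))"
    by (rule sum.swap)
  also have "\<dots> = (\<Sum>i=1..n. \<Sum>j\<le>n'. smult0 (1 / fact j) (of_nat i * F i (ops_power F j (n - i) u)))"
    by (rule sum.mono_neutral_right) (auto simp: smult0_eq not_le)
  also have "\<dots> = (\<Sum>i=1..n. of_nat i * F i (ops_exp F (n - i) u))"
  proof (intro sum.cong refl)
    fix i assume i: "i \<in> {1..n}"
    \<comment> \<open>Powers with \<open>j > n - i\<close> do not reach the coefficient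
      \<open>n - i\<close>, since \<open>F\<close> has no constant coefficient.\<close>
    have "(\<Sum>j\<le>n'. smult0 (1 / fact j) (of_nat i * F i (ops_power F j (n - i) u))) =
        (\<Sum>j\<le>n - i. smult0 (1 / fact j) (of_nat i * F i (ops_power F j (n - i) u)))"
      using i Suc
      by (intro sum.mono_neutral_right)
         (auto simp: ops_power_eq_0[of F, OF add zero] F0 smult0_eq)
    also have "\<dots> = of_nat i * F i (ops_exp F (n - i) u)"
      by (simp add: ops_exp_def Fsum scale sum_distrib_left) (simp add: smult0_eq algebra_simps)
    finally show "(\<Sum>j\<le>n'. smult0 (1 / fact j) (of_nat i * F i (ops_power F j (n - i) u))) =
        of_nat i * F i (ops_exp F (n - i) u)" .
  qed
  finally show ?thesis .
qed simp

section \<open>The two exponential factors and their action on products of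
  \<open>g(w)\<close>\<close>

section \<open>The vertex operator\<close>

abbreviation const :: "complex \<Rightarrow> V0" where
  "const \<equiv> single 0"

lemma of_nat_eq_const: "of_nat n = const (of_nat n)"
  by simp

lemma pdiff_const_mult: "pdiff i (const c * u) = const c * pdiff i u"
  by (simp add: pdiff_mult pdiff_single)

lemma pdiff_commute: "pdiff i (pdiff j u) = pdiff j (pdiff i u)"
  by (intro poly_mapping_eqI) (auto simp: lookup_pdiff lookup_add lookup_single when_def ac_simps)

lemma h_pos_eq: "h_pos \<alpha> n u = const (of_nat n / of_nat \<alpha>) * pdiff (n - 1) u"
  by (simp add: h_pos_def smult0_eq deriv0_eq_pdiff)

lemma h_pos_add: "h_pos \<alpha> n (u + v) = h_pos \<alpha> n u + h_pos \<alpha> n v"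
  by (simp add: h_pos_eq pdiff_add distrib_left)

lemma h_pos_0 [simp]: "h_pos \<alpha> n 0 = 0"
  by (simp add: h_pos_eq)

lemma h_pos_sum: "h_pos \<alpha> n (sum f A) = (\<Sum>x\<in>A. h_pos \<alpha> n (f x))"
  by (simp add: h_pos_eq pdiff_sum sum_distrib_left)

lemma h_pos_const_mult: "h_pos \<alpha> n (const c * u) = const c * h_pos \<alpha> n u"
  by (simp add: h_pos_eq pdiff_const_mult mult.left_commute)

lemma h_pos_commute: "h_pos \<alpha> n (h_pos \<alpha> m u) = h_pos \<alpha> m (h_pos \<alpha> n u)"
  by (simp add: h_pos_eq pdiff_const_mult mult.left_commute pdiff_commute[of "n - 1" "m - 1"])

lemma h_pos_of_int_mult: "h_pos \<alpha> n (of_int c * u) = of_int c * h_pos \<alpha> n u"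
  using h_pos_const_mult[of \<alpha> n "of_int c" u] by simp

text \<open>The coefficient of \<open>w^a\<close> in \<open>g(w)\<close>, continued by 0 to negative
  \<open>a\<close> so that index shifts need no case distinction.\<close>

definition gfun :: "nat \<Rightarrow> int \<Rightarrow> V0" where
  "gfun \<alpha> a = (if a < 0 then 0 else X_creat \<alpha> (nat a) 1)"

lemma X_creat_0: "X_creat \<alpha> 0 u = u"
  unfolding X_creat_def by (rule ops_exp_0) simp

lemma X_creat_rec:
  "of_nat n * X_creat \<alpha> n u = of_nat \<alpha> * (\<Sum>i=1..n. var (i - 1) * X_creat \<alpha> (n - i) u)"
proof -
  have "of_nat n * X_creat \<alpha> n u = (\<Sum>i=1..n. of_nat i *
      (if i = 0 then 0 else smult0 (of_nat \<alpha> / of_nat i) (h_neg i (X_creat \<alpha> (n - i) u))))"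
    unfolding X_creat_def
    by (subst ops_exp_rec) (auto simp: smult0_eq h_neg_def algebra_simps)
  also have "\<dots> = (\<Sum>i=1..n. of_nat \<alpha> * (var (i - 1) * X_creat \<alpha> (n - i) u))"
  proof (intro sum.cong refl)
    fix i assume "i \<in> {1..n}"
    then have "of_nat i * const (of_nat \<alpha> / of_nat i) = of_nat \<alpha>"
      by (simp only: of_nat_eq_const mult_single) simp
    then have "of_nat i * (const (of_nat \<alpha> / of_nat i) * w) = of_nat \<alpha> * w" for w
      by (simp only: mult.assoc[symmetric])
    with \<open>i \<in> {1..n}\<close> show "of_nat i *
      (if i = 0 then 0 else smult0 (of_nat \<alpha> / of_nat i) (h_neg i (X_creat \<alpha> (n - i) u))) =
      of_nat \<alpha> * (var (i - 1) * X_creat \<alpha> (n - i) u)"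
      by (simp add: smult0_eq h_neg_def)
  qed
  finally show ?thesis by (simp add: sum_distrib_left)
qed

text \<open>The creation operators are multiplications, so both sides obey the recursion
  \<open>X_creat_rec\<close>.\<close>

lemma X_creat_eq: "X_creat \<alpha> n u = gfun \<alpha> (int n) * u"
proof (induction n rule: less_induct)
  case (less n)
  show ?case
  proof (cases "n = 0")
    case True
    then show ?thesis by (simp add: gfun_def X_creat_0)
  next
    case False
    have "of_nat n * X_creat \<alpha> n u = of_nat n * (X_creat \<alpha> n 1 * u)"
      unfolding mult.assoc[symmetric] X_creat_rec using less[unfolded gfun_def]
      by (simp add: sum_distrib_right sum_distrib_left mult_ac)
    then show ?thesis using False by (simp add: gfun_def)
  qed
qed

lemma gfun_0 [simp]: "gfun \<alpha> 0 = 1"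
  by (simp add: gfun_def X_creat_0)

lemma gfun_neg [simp]: "a < 0 \<Longrightarrow> gfun \<alpha> a = 0"
  by (simp add: gfun_def)

lemma gfun_rec:
  "of_nat n * gfun \<alpha> (int n) = of_nat \<alpha> * (\<Sum>i=1..n. var (i - 1) * gfun \<alpha> (int n - int i))"
proof -
  have "gfun \<alpha> (int n - int i) = X_creat \<alpha> (n - i) 1" if "i \<in> {1..n}" for i
    using that by (auto simp: gfun_def nat_diff_distrib')
  then show ?thesis using X_creat_rec[of n \<alpha> 1] by (simp add: gfun_def)
qed

text \<open>\<open>g(w)\<close> is an eigenvector of \<open>h_m\<close> with eigenvalue
  \<open>w^m\<close>: the factor \<open>\<alpha> / m\<close> in its exponent cancels the
  \<open>m / \<alpha>\<close> in \<open>h_pos\<close>. The proof compares coefficients by means of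
  \<open>gfun_rec\<close>.\<close>

lemma h_pos_gfun:
  assumes "\<alpha> > 0" "m > 0"
  shows "h_pos \<alpha> m (gfun \<alpha> a) = gfun \<alpha> (a - int m)"
proof (cases "a < 0")
  case False
  define n where "n = nat a"
  have "h_pos \<alpha> m (gfun \<alpha> (int n)) = gfun \<alpha> (int n - int m)"
  proof (induction n rule: less_induct)
    case (less n)
    show ?case
    proof (cases "n = 0")
      case True
      then show ?thesis using assms by (simp add: h_pos_eq)
    next
      case False
      have var: "h_pos \<alpha> m (var (i - 1) * v) =
          (if i = m then const (of_nat m / of_nat \<alpha>) * v else 0) + var (i - 1) * h_pos \<alpha> m v"
        if "i > 0" for i v
      proof -
        have "pdiff (m - 1) (var (i - 1)) = (if i = m then 1 else 0 :: V0)"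
          using that assms by (auto simp: pdiff_single lookup_single when_def)
        then show ?thesis by (simp add: h_pos_eq pdiff_mult algebra_simps)
      qed
      have *: "of_nat \<alpha> * const (of_nat m / of_nat \<alpha>) = of_nat m"
        using assms by (simp only: of_nat_eq_const mult_single) simp
      have IH: "h_pos \<alpha> m (gfun \<alpha> (int n - int i)) = gfun \<alpha> (int n - int m - int i)"
        if "i \<in> {1..n}" for i
        using less[of "n - i"] that False by (simp add: of_nat_diff algebra_simps)
      have "of_nat n * h_pos \<alpha> m (gfun \<alpha> (int n)) = h_pos \<alpha> m (of_nat n * gfun \<alpha> (int n))"
        by (simp only: of_nat_eq_const h_pos_const_mult)
      also have "\<dots> = of_nat \<alpha> * (\<Sum>i=1..n. h_pos \<alpha> m (var (i - 1) * gfun \<alpha> (int n - int i)))"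
        unfolding gfun_rec by (simp only: of_nat_eq_const h_pos_const_mult h_pos_sum)
      also have "\<dots> = of_nat \<alpha> * (\<Sum>i=1..n. (if i = m then const (of_nat m / of_nat \<alpha>) * gfun \<alpha> (int n - int i) else 0))
          + of_nat \<alpha> * (\<Sum>i=1..n. var (i - 1) * gfun \<alpha> (int n - int m - int i))"
      proof -
        have *: "h_pos \<alpha> m (var (i - 1) * gfun \<alpha> (int n - int i)) =
            (if i = m then const (of_nat m / of_nat \<alpha>) * gfun \<alpha> (int n - int i) else 0)
            + var (i - 1) * gfun \<alpha> (int n - int m - int i)" if "i \<in> {1..n}" for i
          using that by (subst var) (auto simp: IH)
        show ?thesis by (simp only: * sum.distrib distrib_left cong: sum.cong)
      qed
      also have "of_nat \<alpha> * (\<Sum>i=1..n. (if i = m then const (of_nat m / of_nat \<alpha>) * gfun \<alpha> (int n - int i) else 0)) =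
         of_nat m * gfun \<alpha> (int n - int m)"
        using assms by (simp add: sum.delta mult.assoc[symmetric] *)
      \<comment> \<open>For \<open>m \<le> n\<close> this is the recursion at index
        \<open>n - m\<close>; for \<open>m > n\<close> both sides vanish. The two contributions add
        up to the factor \<open>m + (n - m) = n\<close>.\<close>
      also have "of_nat \<alpha> * (\<Sum>i=1..n. var (i - 1) * gfun \<alpha> (int n - int m - int i)) =
          (of_nat n - of_nat m) * gfun \<alpha> (int n - int m)"
      proof (cases "m \<le> n")
        case True
        have "(\<Sum>i=1..n. var (i - 1) * gfun \<alpha> (int n - int m - int i)) =
            (\<Sum>i=1..n-m. var (i - 1) * gfun \<alpha> (int n - int m - int i))"
          by (rule sum.mono_neutral_right) auto
        then show ?thesis
          using True gfun_rec[of "n - m" \<alpha>] by (simp add: of_nat_diff)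
      next
        case False
        then show ?thesis by (simp add: sum.neutral)
      qed
      finally have "of_nat n * h_pos \<alpha> m (gfun \<alpha> (int n)) = of_nat n * gfun \<alpha> (int n - int m)"
        by (simp add: algebra_simps)
      then show ?thesis using False by simp
    qed
  qed
  then show ?thesis using False by (simp add: n_def)
qed (use assms in simp)

lemma X_annih_0: "X_annih \<alpha> 0 u = u"
  unfolding X_annih_def by (rule ops_exp_0) simp

lemma X_annih_rec:
  "of_nat n * X_annih \<alpha> n u = - of_nat (2 * \<alpha>) * (\<Sum>i=1..n. h_pos \<alpha> i (X_annih \<alpha> (n - i) u))"
proof -
  have "of_nat n * X_annih \<alpha> n u = (\<Sum>i=1..n. of_nat i *
      (if i = 0 then 0 else smult0 (- (2 * of_nat \<alpha>) / of_nat i) (h_pos \<alpha> i (X_annih \<alpha> (n - i) u))))"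
    unfolding X_annih_def
    by (subst ops_exp_rec)
       (auto simp: smult0_eq h_pos_add h_pos_const_mult distrib_left mult.left_commute h_pos_commute)
  also have "\<dots> = (\<Sum>i=1..n. - of_nat (2 * \<alpha>) * (h_pos \<alpha> i (X_annih \<alpha> (n - i) u)))"
  proof (intro sum.cong refl)
    fix i assume "i \<in> {1..n}"
    then have "of_nat i * const (- (2 * of_nat \<alpha>) / of_nat i) = - of_nat (2 * \<alpha>)"
      by (simp only: of_nat_eq_const mult_single single_uminus[symmetric]) simp
    then have "of_nat i * (const (- (2 * of_nat \<alpha>) / of_nat i) * w) = - of_nat (2 * \<alpha>) * w" for w
      by (simp only: mult.assoc[symmetric])
    with \<open>i \<in> {1..n}\<close> show "of_nat i *
      (if i = 0 then 0 else smult0 (- (2 * of_nat \<alpha>) / of_nat i) (h_pos \<alpha> i (X_annih \<alpha> (n - i) u))) =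
      - of_nat (2 * \<alpha>) * (h_pos \<alpha> i (X_annih \<alpha> (n - i) u))"
      by (simp add: smult0_eq)
  qed
  finally show ?thesis by (simp add: sum_distrib_left)
qed

text \<open>
  \<open>Psi \<alpha> L r\<close> takes the coefficient of \<open>w\<^bsup>L\<^esup>\<close> in the product of a polynomial in \<open>w\<^sub>0, \<dots>, w\<^bsub>r-1\<^esub>\<close>
  with \<open>g(w\<^sub>0) \<dots> g(w\<^bsub>r-1\<^esub>)\<close>.  Exponents are shifted by \<open>\<alpha>(n - 1)\<close> throughout, so that only
  polynomials occur instead of Laurent polynomials.
\<close>

definition Psi :: "nat \<Rightarrow> (nat \<Rightarrow> int) \<Rightarrow> nat \<Rightarrow> (mono \<Rightarrow>\<^sub>0 int) \<Rightarrow> V0" where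
  "Psi \<alpha> L r = lin (\<lambda>e. \<Prod>i<r. gfun \<alpha> (L i - int (lookup e i)))"

lemma Psi_0 [simp]: "Psi \<alpha> L r 0 = 0"
  by (simp add: Psi_def)

lemma Psi_sum: "Psi \<alpha> L r (sum f A) = (\<Sum>x\<in>A. Psi \<alpha> L r (f x))"
  by (simp add: Psi_def lin_sum)

lemma Psi_of_int_mult: "Psi \<alpha> L r (of_int c * P) = of_int c * Psi \<alpha> L r P"
  using lin_const_mult[of _ "of_int c" P, unfolded single_of_int] by (simp add: Psi_def)

lemma Psi_of_nat_mult: "Psi \<alpha> L r (of_nat c * P) = of_nat c * Psi \<alpha> L r P"
  using Psi_of_int_mult[of \<alpha> L r "int c" P] by simp

definition psum :: "nat \<Rightarrow> nat \<Rightarrow> mono \<Rightarrow>\<^sub>0 int" where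
  "psum r m = (\<Sum>i<r. single (single i m) 1)"

lemma h_pos_prod_gfun:
  assumes "\<alpha> > 0" "m > 0" "finite A"
  shows "h_pos \<alpha> m (\<Prod>i\<in>A. gfun \<alpha> (a i)) =
    (\<Sum>i\<in>A. \<Prod>j\<in>A. gfun \<alpha> (a j - (if j = i then int m else 0)))"
proof -
  have "h_pos \<alpha> m (\<Prod>i\<in>A. gfun \<alpha> (a i)) =
      (\<Sum>i\<in>A. h_pos \<alpha> m (gfun \<alpha> (a i)) * (\<Prod>j\<in>A - {i}. gfun \<alpha> (a j)))"
    by (simp add: h_pos_eq pdiff_prod assms sum_distrib_left mult.assoc)
  also have "\<dots> = (\<Sum>i\<in>A. \<Prod>j\<in>A. gfun \<alpha> (a j - (if j = i then int m else 0)))"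
    using assms by (intro sum.cong refl) (simp add: prod.remove h_pos_gfun)
  finally show ?thesis .
qed

text \<open>By the Leibniz rule \<open>h_m\<close> multiplies \<open>g(w_0) ... g(w_{r-1})\<close>
  by the power sum of the \<open>w_i\<close>. This trades operators on \<open>V0\<close> for
  multiplications of the polynomial.\<close>

lemma h_pos_Psi:
  assumes "\<alpha> > 0" "m > 0"
  shows "h_pos \<alpha> m (Psi \<alpha> L r P) = Psi \<alpha> L r (psum r m * P)"
proof -
  have "h_pos \<alpha> m (Psi \<alpha> L r P) =
      lin (\<lambda>e. h_pos \<alpha> m (\<Prod>i<r. gfun \<alpha> (L i - int (lookup e i)))) P"
    by (simp add: Psi_def lin_def h_pos_sum h_pos_of_int_mult)
  also have "\<dots> = lin (\<lambda>e. \<Sum>i<r. \<Prod>j<r. gfun \<alpha> (L j - int (lookup (single i m + e) j))) P"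
    by (subst h_pos_prod_gfun)
       (auto simp: assms lookup_add lookup_single when_def algebra_simps
             intro!: lin_cong sum.cong prod.cong arg_cong[where f = "gfun \<alpha>"])
  also have "\<dots> = Psi \<alpha> L r (psum r m * P)"
    by (simp add: Psi_def psum_def sum_distrib_right lin_sum lin_single_mult lin_fun_sum)
  finally show ?thesis .
qed

section \<open>Logarithmic derivatives and products of linear or geometric factors\<close>

text \<open>\<open>ldp F q\<close> says that \<open>q\<close> is the logarithmic derivative \<open>x F'/F\<close>.\<close>

definition ldp :: "'a::comm_ring_1 fps \<Rightarrow> 'a fps \<Rightarrow> bool" where
  "ldp F q \<longleftrightarrow> fps_X * fps_deriv F = q * F"

lemma ldp_1: "ldp 1 0"
  by (simp add: ldp_def)

lemma ldp_mult: "ldp F q \<Longrightarrow> ldp G q' \<Longrightarrow> ldp (F * G) (q + q')"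
proof -
  assume a: "ldp F q" "ldp G q'"
  have "fps_X * fps_deriv (F * G) = (fps_X * fps_deriv F) * G + F * (fps_X * fps_deriv G)"
    by (simp add: algebra_simps)
  also have "\<dots> = (q + q') * (F * G)"
    using a by (simp add: ldp_def algebra_simps)
  finally show ?thesis by (simp add: ldp_def)
qed

lemma ldp_power: "ldp F q \<Longrightarrow> ldp (F ^ n) (of_nat n * q)"
  by (induction n) (auto simp: ldp_1 distrib_right intro: ldp_mult)

lemma ldp_prod: "(\<And>i. i \<in> A \<Longrightarrow> ldp (F i) (q i)) \<Longrightarrow> ldp (prod F A) (sum q A)"
  by (induction A rule: infinite_finite_induct) (auto simp: ldp_1 intro: ldp_mult)

lemma ldp_nth:
  assumes "ldp F q" "fps_nth q 0 = 0"
  shows "of_nat n * fps_nth F n = (\<Sum>i=1..n. fps_nth q i * fps_nth F (n - i))"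
proof -
  have "of_nat n * fps_nth F n = fps_nth (fps_X * fps_deriv F) n"
    by (cases n) (simp_all add: One_nat_def)
  also have "\<dots> = (\<Sum>i=0..n. fps_nth q i * fps_nth F (n - i))"
    using assms by (simp add: ldp_def fps_mult_nth)
  also have "\<dots> = (\<Sum>i=1..n. fps_nth q i * fps_nth F (n - i))"
    by (rule sum.mono_neutral_right) (auto simp: assms not_le)
  finally show ?thesis .
qed

definition lin_fac :: "nat \<Rightarrow> (mono \<Rightarrow>\<^sub>0 int) fps" where
  "lin_fac i = 1 - fps_const (var i) * fps_X"

text \<open>The inverse \<open>1 / (1 - w_i x)\<close> of \<open>lin_fac i\<close>, written out
  because the coefficients form only a ring.\<close>

definition geo_fac :: "nat \<Rightarrow> (mono \<Rightarrow>\<^sub>0 int) fps" where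
  "geo_fac i = Abs_fps (\<lambda>m. single (single i m) 1)"

text \<open>The series \<open>w_i x / (1 - w_i x)\<close>: the logarithmic derivative of
  \<open>geo_fac i\<close>, and minus that of \<open>lin_fac i\<close>.\<close>

definition pow_fac :: "nat \<Rightarrow> (mono \<Rightarrow>\<^sub>0 int) fps" where
  "pow_fac i = Abs_fps (\<lambda>m. if m = 0 then 0 else single (single i m) 1)"

lemma pow_fac_eq: "pow_fac i = fps_const (var i) * fps_X * geo_fac i"
  by (rule fps_ext)
     (simp add: pow_fac_def geo_fac_def mult.assoc mult_single flip: single_add)

lemma geo_lin: "geo_fac i * lin_fac i = 1"
proof -
  have "geo_fac i = 1 + pow_fac i"
    by (rule fps_ext) (simp add: pow_fac_def geo_fac_def)
  then show ?thesis by (simp add: lin_fac_def pow_fac_eq algebra_simps)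
qed

lemma ldp_lin: "ldp (lin_fac i) (- pow_fac i)"
proof -
  have "pow_fac i * lin_fac i = fps_const (var i) * fps_X"
    using geo_lin[of i] by (simp add: pow_fac_eq mult.assoc)
  moreover have "fps_deriv (lin_fac i) = - fps_const (var i)"
    by (simp add: lin_fac_def)
  ultimately show ?thesis by (simp add: ldp_def mult.commute del: fps_const_neg)
qed

lemma ldp_geo: "ldp (geo_fac i) (pow_fac i)"
proof -
  have "fps_X * fps_deriv (geo_fac i) * lin_fac i + geo_fac i * (fps_X * fps_deriv (lin_fac i)) = 0"
    using arg_cong[OF geo_lin[of i], of "\<lambda>F. fps_X * fps_deriv F"] by (simp add: algebra_simps)
  moreover have "geo_fac i * (fps_X * fps_deriv (lin_fac i)) = - (geo_fac i * lin_fac i) * pow_fac i"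
    using ldp_lin[of i] by (simp add: ldp_def)
  ultimately have "(fps_X * fps_deriv (geo_fac i)) * lin_fac i = pow_fac i"
    by (simp add: geo_lin)
  then have "(fps_X * fps_deriv (geo_fac i)) * (geo_fac i * lin_fac i) = pow_fac i * geo_fac i"
    by (simp only: mult_ac)
  then show ?thesis by (simp add: geo_lin ldp_def)
qed

definition lin_coeff :: "nat \<Rightarrow> nat \<Rightarrow> nat \<Rightarrow> mono \<Rightarrow>\<^sub>0 int" where
  "lin_coeff N r = fps_nth (\<Prod>i<r. lin_fac i ^ N)"

definition geo_coeff :: "nat \<Rightarrow> nat \<Rightarrow> nat \<Rightarrow> mono \<Rightarrow>\<^sub>0 int" where
  "geo_coeff N r = fps_nth (\<Prod>i<r. geo_fac i ^ N)"

lemma prod_fps_nth_0: "fps_nth (\<Prod>i\<in>A. F i) 0 = (\<Prod>i\<in>A. fps_nth (F i) 0)"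
  by (induction A rule: infinite_finite_induct) auto

lemma fps_sum_of_nat_pow_fac:
  "m > 0 \<Longrightarrow> fps_nth (\<Sum>i<r. of_nat N * pow_fac i) m = of_nat N * psum r m"
  by (simp add: fps_sum_nth pow_fac_def psum_def sum_distrib_left
        flip: fps_of_nat fps_const_mult_left)

lemma lin_coeff_rec:
  "of_nat n * lin_coeff N r n = - of_nat N * (\<Sum>i=1..n. psum r i * lin_coeff N r (n - i))"
proof -
  have "ldp (\<Prod>i<r. lin_fac i ^ N) (- (\<Sum>i<r. of_nat N * pow_fac i))"
    using ldp_prod[OF ldp_power[OF ldp_lin], where A = "{..<r}"] by (simp add: sum_negf)
  from ldp_nth[OF this] have "of_nat n * lin_coeff N r n = (\<Sum>i=1..n.
      - fps_nth (\<Sum>i<r. of_nat N * pow_fac i) i * lin_coeff N r (n - i))"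
    by (simp add: lin_coeff_def fps_sum_nth pow_fac_def)
  also have "\<dots> = (\<Sum>i=1..n. - of_nat N * (psum r i * lin_coeff N r (n - i)))"
    by (intro sum.cong refl, subst fps_sum_of_nat_pow_fac) auto
  finally show ?thesis by (simp only: sum_distrib_left)
qed

lemma geo_coeff_rec:
  "of_nat n * geo_coeff N r n = of_nat N * (\<Sum>i=1..n. psum r i * geo_coeff N r (n - i))"
proof -
  have "ldp (\<Prod>i<r. geo_fac i ^ N) (\<Sum>i<r. of_nat N * pow_fac i)"
    by (intro ldp_prod ldp_power ldp_geo)
  from ldp_nth[OF this] have "of_nat n * geo_coeff N r n = (\<Sum>i=1..n.
      fps_nth (\<Sum>i<r. of_nat N * pow_fac i) i * geo_coeff N r (n - i))"
    by (simp add: geo_coeff_def fps_sum_nth pow_fac_def)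
  also have "\<dots> = (\<Sum>i=1..n. of_nat N * (psum r i * geo_coeff N r (n - i)))"
    by (intro sum.cong refl, subst fps_sum_of_nat_pow_fac) auto
  finally show ?thesis by (simp only: sum_distrib_left)
qed

lemma lin_coeff_0 [simp]: "lin_coeff N r 0 = 1"
  by (simp add: lin_coeff_def prod_fps_nth_0 fps_power_zeroth lin_fac_def)

lemma geo_coeff_0 [simp]: "geo_coeff N r 0 = 1"
  by (simp add: geo_coeff_def prod_fps_nth_0 fps_power_zeroth geo_fac_def)

text \<open>By \<open>h_pos_Psi\<close> the recursion for \<open>X_annih\<close> turns into
  \<open>lin_coeff_rec\<close> with \<open>N = 2 * \<alpha>\<close>. So the annihilating factor
  multiplies the polynomial by the product of the
  \<open>(1 - w_i / z)^(2 * \<alpha>)\<close>.\<close>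

lemma X_annih_Psi:
  assumes "\<alpha> > 0"
  shows "X_annih \<alpha> n (Psi \<alpha> L r P) = Psi \<alpha> L r (lin_coeff (2 * \<alpha>) r n * P)"
proof (induction n rule: less_induct)
  case (less n)
  show ?case
  proof (cases "n = 0")
    case True
    then show ?thesis by (simp add: X_annih_0)
  next
    case False
    have "of_nat n * X_annih \<alpha> n (Psi \<alpha> L r P) =
        - of_nat (2 * \<alpha>) * (\<Sum>i=1..n. Psi \<alpha> L r (psum r i * (lin_coeff (2 * \<alpha>) r (n - i) * P)))"
      unfolding X_annih_rec using less False assms by (simp add: h_pos_Psi)
    also have "\<dots> = Psi \<alpha> L r (of_int (- int (2 * \<alpha>)) *
        (\<Sum>i=1..n. psum r i * lin_coeff (2 * \<alpha>) r (n - i)) * P)"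
      unfolding mult.assoc Psi_of_int_mult by (simp add: Psi_sum sum_distrib_right mult.assoc)
    also have "of_int (- int (2 * \<alpha>)) *
        (\<Sum>i=1..n. psum r i * lin_coeff (2 * \<alpha>) r (n - i)) = of_nat n * lin_coeff (2 * \<alpha>) r n"
      unfolding lin_coeff_rec by simp
    also have "Psi \<alpha> L r (of_nat n * lin_coeff (2 * \<alpha>) r n * P) =
        of_nat n * Psi \<alpha> L r (lin_coeff (2 * \<alpha>) r n * P)"
      by (simp add: mult.assoc Psi_of_nat_mult)
    finally show ?thesis using False by simp
  qed
qed

section \<open>Normal ordering of products of vertex operators\<close>

definition vars_below :: "nat \<Rightarrow> (mono \<Rightarrow>\<^sub>0 'a::comm_ring_1) \<Rightarrow> bool" where
  "vars_below r P \<longleftrightarrow> (\<forall>e\<in>keys P. \<forall>i\<ge>r. lookup e i = 0)"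

lemma vars_below_single [intro]: "(\<And>i. i \<ge> r \<Longrightarrow> lookup a i = 0) \<Longrightarrow> vars_below r (single a c)"
  by (auto simp: vars_below_def)

lemma vars_below_0 [simp]: "vars_below r 0" by (simp add: vars_below_def)

lemma vars_below_1 [simp]: "vars_below r 1" by (simp add: vars_below_def)

lemma vars_below_add [intro]: "vars_below r P \<Longrightarrow> vars_below r Q \<Longrightarrow> vars_below r (P + Q)"
  using keys_add[of P Q] by (auto simp: vars_below_def)

lemma vars_below_uminus [intro]: "vars_below r P \<Longrightarrow> vars_below r (- P)"
  by (auto simp: vars_below_def in_keys_iff)

lemma vars_below_diff [intro]: "vars_below r P \<Longrightarrow> vars_below r Q \<Longrightarrow> vars_below r (P - Q)"
  using vars_below_add[of r P "- Q"] by auto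

lemma vars_below_mult [intro]: "vars_below r P \<Longrightarrow> vars_below r Q \<Longrightarrow> vars_below r (P * Q)"
  using keys_mult[of P Q] by (fastforce simp: vars_below_def lookup_add)

lemma vars_below_sum [intro]: "(\<And>i. i \<in> A \<Longrightarrow> vars_below r (f i)) \<Longrightarrow> vars_below r (sum f A)"
  by (induction A rule: infinite_finite_induct) auto

lemma vars_below_prod [intro]: "(\<And>i. i \<in> A \<Longrightarrow> vars_below r (f i)) \<Longrightarrow> vars_below r (prod f A)"
  by (induction A rule: infinite_finite_induct) auto

lemma vars_below_power [intro]: "vars_below r P \<Longrightarrow> vars_below r (P ^ n)"
  by (induction n) auto

lemma vars_below_lin_coeff: "vars_below r (lin_coeff N r n)"
proof -
  have mult: "\<forall>n. vars_below r (fps_nth (F * G) n)"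
    if "\<forall>n. vars_below r (fps_nth F n)" "\<forall>n. vars_below r (fps_nth G n)"
    for F G :: "(mono \<Rightarrow>\<^sub>0 int) fps"
    using that by (auto simp: fps_mult_nth)
  have lin: "\<forall>n. vars_below r (fps_nth (lin_fac i) n)" if "i < r" for i
  proof
    fix n
    have v: "vars_below r (var i :: mono \<Rightarrow>\<^sub>0 int)"
      using that by (auto simp: lookup_single when_def)
    have "fps_nth (lin_fac i) n = (if n = 0 then 1 else if n = 1 then - var i else 0)"
      by (simp add: lin_fac_def)
    then show "vars_below r (fps_nth (lin_fac i) n)"
      using v by auto
  qed
  have "\<forall>n. vars_below r (fps_nth (lin_fac i ^ N) n)" if "i < r" for i
  proof (induction N)
    case (Suc N)
    then show ?case using mult lin[OF that] by simp
  qed auto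
  then have "\<forall>n. vars_below r (fps_nth (\<Prod>i<k. lin_fac i ^ N) n)" if "k \<le> r" for k
    using that
  proof (induction k)
    case (Suc k)
    then show ?case using mult[of "\<Prod>i<k. lin_fac i ^ N" "lin_fac k ^ N"] by simp
  qed auto
  then show ?thesis by (simp add: lin_coeff_def)
qed

text \<open>Putting \<open>x = 1/z\<close> in the product of the \<open>(1 - w_i x)^N\<close> and
  multiplying by \<open>z^(N r)\<close> clears the denominators.\<close>

lemma lin_coeff_homogenize:
  "(\<forall>j>N*r. lin_coeff N r j = 0) \<and>
   (\<Sum>j\<le>N*r. lin_coeff N r j * z ^ (N * r - j)) = (\<Prod>i<r. (z - var i) ^ N)"
proof -
  \<comment> \<open>\<open>Hm D H Q\<close> says that \<open>H\<close> has degree at most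
    \<open>D\<close> in \<open>x\<close> and \<open>Q = z^D H(1/z)\<close>; it is built up one
    linear factor at a time.\<close>
  define Hm where "Hm D H Q \<longleftrightarrow> (\<forall>j>D. fps_nth H j = 0) \<and>
    (\<Sum>j\<le>D. fps_nth H j * z ^ (D - j)) = Q" for D H Q
  have step: "Hm (Suc D) (H * lin_fac i) (Q * (z - var i))" if "Hm D H Q" for D H Q i
  proof -
    have nth: "fps_nth (H * lin_fac i) j =
        fps_nth H j - (if j = 0 then 0 else fps_nth H (j - 1) * var i)" for j
      by (cases j) (simp_all add: lin_fac_def algebra_simps mult.left_commute[of H] One_nat_def)
    have "(\<Sum>j\<le>Suc D. fps_nth (H * lin_fac i) j * z ^ (Suc D - j)) =
        (\<Sum>j\<le>Suc D. fps_nth H j * z ^ (Suc D - j)) -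
        (\<Sum>j\<le>Suc D. (if j = 0 then 0 else fps_nth H (j - 1) * var i * z ^ (Suc D - j)))"
      by (simp only: nth left_diff_distrib sum_subtractf if_distrib[of "\<lambda>u. u * _"] mult_zero_left)
    also have "(\<Sum>j\<le>Suc D. fps_nth H j * z ^ (Suc D - j)) = (\<Sum>j\<le>D. fps_nth H j * z ^ (D - j)) * z"
    proof -
      have "fps_nth H (Suc D) = 0" using that by (simp add: Hm_def)
      then show ?thesis by (simp add: sum_distrib_right Suc_diff_le mult.assoc mult.commute[of z])
    qed
    also have "(\<Sum>j\<le>Suc D. (if j = 0 then 0 else fps_nth H (j - 1) * var i * z ^ (Suc D - j))) =
        (\<Sum>j\<le>D. fps_nth H j * z ^ (D - j)) * var i"
      by (subst sum.atMost_Suc_shift) (simp add: sum_distrib_right mult.assoc mult.commute[of "var i"])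
    finally show ?thesis using that by (auto simp: Hm_def nth algebra_simps)
  qed
  have pow: "Hm (D + m) (H * lin_fac i ^ m) (Q * (z - var i) ^ m)" if "Hm D H Q" for D H Q i m
  proof (induction m)
    case (Suc m)
    then show ?case
      using step[of "D + m" "H * lin_fac i ^ m" "Q * (z - var i) ^ m" i] by (simp add: mult_ac)
  qed (use that in auto)
  have "Hm (N * r) (\<Prod>i<r. lin_fac i ^ N) (\<Prod>i<r. (z - var i) ^ N)"
  proof (induction r)
    case 0
    show ?case by (auto simp: Hm_def)
  next
    case (Suc r)
    from pow[OF this, of N r] show ?case by (simp add: algebra_simps)
  qed
  then show ?thesis by (simp add: Hm_def lin_coeff_def)
qed

text \<open>\<open>P\<close> does not involve \<open>w_r\<close>, so the coefficient extraction in
  \<open>w_r\<close> separates from the others.\<close>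

lemma Psi_Suc:
  assumes "vars_below r P"
  shows "Psi \<alpha> L (Suc r) (var r ^ k * P) = gfun \<alpha> (L r - int k) * Psi \<alpha> L r P"
proof -
  have "Psi \<alpha> L (Suc r) (var r ^ k * P) =
      lin (\<lambda>e. \<Prod>i<Suc r. gfun \<alpha> (L i - int (lookup (single r k + e) i))) P"
    by (simp add: Psi_def single_power of_nat_mult_single_mono lin_single_mult del: prod.lessThan_Suc)
  also have "\<dots> = lin (\<lambda>e. gfun \<alpha> (L r - int k) * (\<Prod>i<r. gfun \<alpha> (L i - int (lookup e i)))) P"
    using assms
    by (intro lin_cong) (auto simp: lookup_add lookup_single vars_below_def mult.commute)
  also have "\<dots> = gfun \<alpha> (L r - int k) * Psi \<alpha> L r P"
    by (simp add: Psi_def lin_def sum_distrib_left mult.left_commute)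
  finally show ?thesis .
qed

text \<open>Normal ordering. The new operator brings a variable \<open>w_r\<close>; moving its
  annihilating factor past the earlier \<open>g(w_i)\<close> produces
  \<open>(1 - w_i / w_r)^(2 * \<alpha>)\<close>, and the summand \<open>2 * \<alpha> * r\<close> of
  \<open>L r\<close> clears these denominators. The term \<open>(m + 1) * \<alpha>\<close> is the
  power of \<open>z\<close> in the middle factor.\<close>

lemma X_op_single:
  assumes "\<alpha> > 0" "vars_below r P"
    and L: "L r = int l + int (2 * \<alpha> * r) - (m + 1) * int \<alpha>"
  shows "X_op \<alpha> (- int l) (single m (Psi \<alpha> L r P)) =
    single (m + 2) (Psi \<alpha> L (Suc r) (P * (\<Prod>i<r. (var r - var i) ^ (2 * \<alpha>))))"
proof -
  let ?u = "Psi \<alpha> L r P" and ?N = "2 * \<alpha> * r"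
  define F where "F j = gfun \<alpha> (L r - int ?N + int j) * Psi \<alpha> L r (lin_coeff (2 * \<alpha>) r j * P)" for j
  have F: "(let i = int j - (- int l) - (m + 1) * int \<alpha> in
        if i \<ge> 0 then X_creat \<alpha> (nat i) (X_annih \<alpha> j ?u) else 0) = F j" for j
    using assms(1)
    by (auto simp: Let_def X_creat_eq X_annih_Psi F_def L algebra_simps)
  have "Sum_any F = (\<Sum>j\<le>?N. F j)"
    by (intro Sum_any.expand_superset) (use lin_coeff_homogenize[of "2 * \<alpha>" r] in \<open>auto simp: F_def intro: ccontr\<close>)
  also have "\<dots> = (\<Sum>j\<le>?N. Psi \<alpha> L (Suc r) (var r ^ (?N - j) * (lin_coeff (2 * \<alpha>) r j * P)))"
    using assms(2)
    by (intro sum.cong refl, subst Psi_Suc)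
       (auto simp: F_def vars_below_lin_coeff of_nat_diff algebra_simps)
  also have "\<dots> = Psi \<alpha> L (Suc r) (P * (\<Sum>j\<le>?N. lin_coeff (2 * \<alpha>) r j * var r ^ (?N - j)))"
    by (simp add: Psi_sum sum_distrib_left mult_ac)
  also have "\<dots> = Psi \<alpha> L (Suc r) (P * (\<Prod>i<r. (var r - var i) ^ (2 * \<alpha>)))"
    using lin_coeff_homogenize[of "2 * \<alpha>" r "var r"] by simp
  finally have *: "Sum_any F = Psi \<alpha> L (Suc r) (P * (\<Prod>i<r. (var r - var i) ^ (2 * \<alpha>)))" .
  show ?thesis
  \<comment> \<open>\<open>X_op\<close> sums over the keys, and the key \<open>m\<close> is missing
    when the vector is 0.\<close>
  proof (cases "?u = 0")
    case True
    have "F j = 0" for j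
      using X_annih_Psi[OF assms(1), of j L r P] X_annih_Psi[OF assms(1), of j L r 0] True
      by (simp add: F_def)
    then show ?thesis using * True by (simp add: X_op_def)
  next
    case False
    have "X_op \<alpha> (- int l) (single m ?u) = single (m + 2) (Sum_any F)"
      unfolding X_op_def using False by (simp only: keys_single if_False sum.insert sum.empty
        finite.emptyI empty_iff not_False_eq_True add_0_right lookup_single_eq F)
    then show ?thesis using * by simp
  qed
qed

text \<open>For \<open>N = 2 * \<alpha>\<close> this is, up to sign, the Laurent polynomial
  \<open>D\<close> multiplied by the power \<open>\<alpha> (n - 1)\<close> of every
  variable.\<close>

definition Vand :: "nat \<Rightarrow> nat \<Rightarrow> mono \<Rightarrow>\<^sub>0 int" where
  "Vand N n = (\<Prod>i<n. \<Prod>j<i. (var i - var j) ^ N)"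

lemma Vand_Suc: "Vand N (Suc n) = Vand N n * (\<Prod>j<n. (var n - var j) ^ N)"
  by (simp add: Vand_def)

lemma vars_below_Vand: "vars_below n (Vand N n)"
  unfolding Vand_def
  by (intro vars_below_prod vars_below_power vars_below_diff vars_below_single)
     (auto simp: lookup_single when_def)

text \<open>After \<open>i\<close> operators the index of the group element is
  \<open>2 i - n\<close>, and
  \<open>2 \<alpha> i - (2 i - n + 1) \<alpha> = \<alpha> (n - 1)\<close>. Hence the exponent shift
  in \<open>L\<close> is the same at every stage.\<close>

lemma X_op_funpow:
  assumes "\<alpha> > 0" and L: "\<And>i. r \<le> i \<Longrightarrow> i < r + q \<Longrightarrow> L i = int l + int \<alpha> * (int n - 1)"
  shows "(X_op \<alpha> (- int l) ^^ q) (single (2 * int r - int n) (Psi \<alpha> L r (Vand (2 * \<alpha>) r))) =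
    single (2 * int (r + q) - int n) (Psi \<alpha> L (r + q) (Vand (2 * \<alpha>) (r + q)))"
  using L
proof (induction q)
  case (Suc q)
  let ?m = "2 * int (r + q) - int n"
  have "L (r + q) = int l + int (2 * \<alpha> * (r + q)) - (?m + 1) * int \<alpha>"
    using Suc.prems[of "r + q"] by (simp add: algebra_simps)
  with X_op_single[of \<alpha> "r + q" "Vand (2 * \<alpha>) (r + q)" L l ?m] assms(1)
  have "X_op \<alpha> (- int l) (single ?m (Psi \<alpha> L (r + q) (Vand (2 * \<alpha>) (r + q)))) =
      single (?m + 2) (Psi \<alpha> L (r + Suc q) (Vand (2 * \<alpha>) (r + Suc q)))"
    by (simp only: Vand_Suc vars_below_Vand add_Suc_right)
  moreover have eq: "2 * int (r + Suc q) - int n = ?m + 2" by simp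
  ultimately show ?case unfolding eq using Suc by simp
qed simp

text \<open>The rightmost operators act first, so the variables with index below \<open>t\<close>
  belong to the parts \<open>k\<close>.\<close>

lemma vertex_product:
  assumes "\<alpha> > 0" "n = s + t"
    and "L = (\<lambda>i. int (if i < t then k else k + 1) + int \<alpha> * (int n - 1))"
  shows "(X_op \<alpha> (- int (k + 1)) ^^ s) ((X_op \<alpha> (- int k) ^^ t) (e_half (- int n))) =
    single (int n) (Psi \<alpha> L n (Vand (2 * \<alpha>) n))"
proof -
  have "e_half (- int n) = single (2 * int 0 - int n) (Psi \<alpha> L 0 (Vand (2 * \<alpha>) 0))"
    by (simp add: e_half_def Vand_def Psi_def lin_def)
  moreover have "(X_op \<alpha> (- int k) ^^ t) (single (2 * int 0 - int n) (Psi \<alpha> L 0 (Vand (2 * \<alpha>) 0))) =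
      single (2 * int (0 + t) - int n) (Psi \<alpha> L (0 + t) (Vand (2 * \<alpha>) (0 + t)))"
    using assms by (intro X_op_funpow) auto
  moreover have "(X_op \<alpha> (- int (k + 1)) ^^ s) (single (2 * int t - int n) (Psi \<alpha> L t (Vand (2 * \<alpha>) t))) =
      single (2 * int (t + s) - int n) (Psi \<alpha> L (t + s) (Vand (2 * \<alpha>) (t + s)))"
    using assms by (intro X_op_funpow) auto
  ultimately show ?thesis using assms by (simp add: add.commute)
qed

section \<open>Homogeneity and divisibility of the Vandermonde power\<close>

section \<open>The degree bound\<close>

definition homog :: "nat \<Rightarrow> nat \<Rightarrow> (mono \<Rightarrow>\<^sub>0 int) \<Rightarrow> bool" where
  "homog n d P \<longleftrightarrow> (\<forall>e\<in>keys P. (\<Sum>i<n. lookup e i) = d)"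

lemma homog_1: "homog n 0 1"
  by (simp add: homog_def)

lemma homog_diff: "homog n d P \<Longrightarrow> homog n d Q \<Longrightarrow> homog n d (P - Q)"
  using keys_diff[of P Q] by (auto simp: homog_def)

lemma homog_mult: "homog n d P \<Longrightarrow> homog n d' Q \<Longrightarrow> homog n (d + d') (P * Q)"
  using keys_mult[of P Q] by (fastforce simp: homog_def lookup_add sum.distrib)

lemma homog_var: "i < n \<Longrightarrow> homog n 1 (var i)"
  by (simp add: homog_def lookup_single when_def)

lemma homog_power: "homog n d P \<Longrightarrow> homog n (k * d) (P ^ k)"
  by (induction k) (auto simp: homog_1 intro: homog_mult)

lemma homog_prod:
  "(\<And>i. i \<in> A \<Longrightarrow> homog n (d i) (P i)) \<Longrightarrow> homog n (sum d A) (prod P A)"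
  by (induction A rule: infinite_finite_induct) (auto simp: homog_1 intro: homog_mult)

lemma homog_Vand: "homog n (N * n * (n - 1)) (Vand (2 * N) n)"
proof -
  have "homog n (\<Sum>i<n. \<Sum>j<i. 2 * N * 1) (Vand (2 * N) n)"
    unfolding Vand_def
    by (intro homog_prod homog_power homog_diff homog_var) auto
  moreover have "(\<Sum>i<n. \<Sum>j<i. 2 * N * 1) = N * n * (n - 1)"
  proof (induction n)
    case (Suc n)
    then show ?case by (cases n) (auto simp: algebra_simps)
  qed simp
  ultimately show ?thesis by simp
qed

lemma Vand_dvd:
  assumes "i < n" "j < n" "i \<noteq> j"
  shows "(var i - var j) ^ (2 * N) dvd Vand (2 * N) n"
proof -
  have *: "(var i - var j) ^ (2 * N) dvd Vand (2 * N) n" if "j < i" "i < n" for i j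
  proof -
    have "(var i - var j) ^ (2 * N) dvd (\<Prod>j<i. (var i - var j :: mono \<Rightarrow>\<^sub>0 int) ^ (2 * N))"
      using that by (intro dvd_prodI) auto
    also have "\<dots> dvd Vand (2 * N) n"
      unfolding Vand_def using that by (intro dvd_prodI[where f = "\<lambda>i. \<Prod>j<i. _ i j"]) auto
    finally show ?thesis .
  qed
  have "(var i - var j :: mono \<Rightarrow>\<^sub>0 int) ^ (2 * N) = (var j - var i) ^ (2 * N)"
    by (subst minus_diff_eq[symmetric]) (simp only: power_mult power2_minus)
  then show ?thesis using *[of i j] *[of j i] assms by (cases "i < j") auto
qed

section \<open>Polynomial functions, their truncations, and the vanishing of coefficients\<close>

text \<open>\<open>dpoly d\<close> describes the polynomial functions of degree less than \<open>d\<close>.\<close>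

primrec dpoly :: "nat \<Rightarrow> (int \<Rightarrow> rat) \<Rightarrow> bool" where
  "dpoly 0 a \<longleftrightarrow> a = (\<lambda>_. 0)"
| "dpoly (Suc d) a \<longleftrightarrow> dpoly d (\<lambda>x. a x - a (x - 1))"

text \<open>At \<open>x \<ge> 0\<close> this is the coefficient of \<open>z^x\<close> in
  \<open>(1 - z)^(-N)\<close>; the generalized binomial continues it to negative arguments as a
  polynomial of degree \<open>N - 1\<close>.\<close>

definition q_poly :: "nat \<Rightarrow> int \<Rightarrow> rat" where
  "q_poly N x = of_int (x + int N - 1) gchoose (N - 1)"

definition q_pos :: "nat \<Rightarrow> int \<Rightarrow> rat" where
  "q_pos N x = (if x \<ge> 0 then q_poly N x else 0)"

definition q_rest :: "nat \<Rightarrow> int \<Rightarrow> rat" where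
  "q_rest N x = q_pos N x - q_poly N x"

lemma dpoly_gbinomial: "dpoly (Suc k) (\<lambda>x. of_int (x + c) gchoose k)"
proof (induction k arbitrary: c)
  case 0
  then show ?case by (simp add: fun_eq_iff)
next
  case (Suc k)
  have "(of_int (x + c) gchoose Suc k) - (of_int (x - 1 + c) gchoose Suc k) =
      (of_int (x + (c - 1)) gchoose k :: rat)" for x
    using gbinomial_Suc_Suc[of "of_int (x + (c - 1)) :: rat" k]
    by (simp add: algebra_simps)
  then show ?case using Suc[of "c - 1"] by (subst dpoly.simps(2)) simp
qed

lemma dpoly_q_poly: "N > 0 \<Longrightarrow> dpoly N (q_poly N)"
  using dpoly_gbinomial[of "N - 1" "int N - 1"] by (simp add: q_poly_def[abs_def] algebra_simps)

text \<open>For \<open>-N < x < 0\<close> the upper argument \<open>x + N - 1\<close> is a natural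
  number below \<open>N - 1\<close>, so the binomial vanishes and truncation changes nothing
  there.\<close>

lemma q_rest_nonzero:
  assumes "N > 0" "q_rest N x \<noteq> 0"
  shows "x \<le> - int N"
proof (rule ccontr)
  assume "\<not> x \<le> - int N"
  moreover have "x < 0" using assms by (auto simp: q_rest_def q_pos_def split: if_splits)
  ultimately obtain m where m: "x + int N - 1 = int m" "m < N - 1"
    using assms(1) by (cases "x + int N - 1") auto
  then have "q_poly N x = of_nat (m choose (N - 1))"
    by (simp add: q_poly_def binomial_gbinomial)
  then show False using assms m by (auto simp: q_rest_def q_pos_def binomial_eq_0 split: if_splits)
qed

lemma q_poly_nat: "N > 0 \<Longrightarrow> q_poly N (int s) = of_nat ((s + N - 1) choose (N - 1))"
  by (simp add: q_poly_def binomial_gbinomial of_nat_diff algebra_simps)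

text \<open>Under the functional a factor \<open>w_i - w_j\<close> replaces \<open>a(x) b(y)\<close>
  by \<open>a(x-1) b(y) - a(x) b(y-1)\<close>, which is \<open>a\<close> times the difference of
  \<open>b\<close> minus the difference of \<open>a\<close> times \<open>b\<close>. Each factor thus
  lowers \<open>d + d'\<close> by one, and once \<open>d + d' \<le> 1\<close> one of the functions
  is 0.\<close>

lemma lin_diff_power_eq_0:
  assumes "i \<noteq> j" "dpoly d a" "dpoly d' b" "d + d' \<le> Suc K"
    and "\<And>f. \<psi> (single i 1 + f) = \<psi> f" "\<And>f. \<psi> (single j 1 + f) = \<psi> f"
  shows "lin (\<lambda>f. a (x - int (lookup f i)) * b (y - int (lookup f j)) * \<psi> f)
    ((var i - var j) ^ K * P) = 0"
  using assms(2-4)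
proof (induction K arbitrary: d d' a b)
  case 0
  then have "a = (\<lambda>_. 0) \<or> b = (\<lambda>_. 0)" by (cases d; cases d') auto
  then show ?case by (auto simp: lin_def)
next
  case (Suc K)
  show ?case
  proof (cases "d = 0 \<or> d' = 0")
    case True
    then have "a = (\<lambda>_. 0) \<or> b = (\<lambda>_. 0)" using Suc.prems by auto
    then show ?thesis by (auto simp: lin_def)
  next
    case False
    then obtain c c' where c: "d = Suc c" "d' = Suc c'" by (cases d; cases d') auto
    let ?Q = "(var i - var j) ^ K * P"
    let ?da = "\<lambda>x. a x - a (x - 1)" and ?db = "\<lambda>x. b x - b (x - 1)"
    let ?F = "\<lambda>a b f. a (x - int (lookup f i)) * b (y - int (lookup f j)) * \<psi> f"
    have "lin (?F a b) ((var i - var j) ^ Suc K * P) =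
        lin (?F a b) (var i * ?Q) - lin (?F a b) (var j * ?Q)"
      by (simp add: lin_diff algebra_simps)
    also have "\<dots> = lin (\<lambda>f. ?F a b (single i 1 + f) - ?F a b (single j 1 + f)) ?Q"
      by (simp only: lin_single_mult lin_fun_diff of_int_1 mult_1)
    also have "\<dots> = lin (\<lambda>f. ?F a ?db f - ?F ?da b f) ?Q"
      using assms(1,5,6)
      by (intro lin_cong) (simp add: lookup_add lookup_single algebra_simps)
    also have "\<dots> = lin (?F a ?db) ?Q - lin (?F ?da b) ?Q"
      by (rule lin_fun_diff)
    also have "lin (?F a ?db) ?Q = 0"
      using Suc.prems c by (intro Suc.IH[of d _ c']) auto
    also have "lin (?F ?da b) ?Q = 0"
      using Suc.prems c by (intro Suc.IH[of c _ d']) auto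
    finally show ?thesis by simp
  qed
qed

lemma single_sum: "(\<Sum>x\<in>A. single a (f x)) = single a (\<Sum>x\<in>A. f x)"
  by (induction A rule: infinite_finite_induct) (auto simp: single_add)

lemma geo_fac_power_nth:
  "N > 0 \<Longrightarrow> fps_nth (geo_fac i ^ N) s = single (single i s) (int ((s + N - 1) choose (N - 1)))"
proof (induction N arbitrary: s rule: nat_induct_non_zero)
  case 1
  then show ?case by (simp add: geo_fac_def)
next
  case (Suc N)
  have "fps_nth (geo_fac i ^ Suc N) s =
      (\<Sum>l=0..s. single (single i s) (int ((l + N - 1) choose (N - 1))))"
    using Suc.IH
    by (simp add: fps_mult_nth mult.commute[of "geo_fac i"] del: power_Suc add: power_Suc2)
       (simp add: geo_fac_def mult_single flip: single_add)
  also have "\<dots> = single (single i s) (\<Sum>l=0..s. int ((l + N - 1) choose (N - 1)))"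
    by (simp only: single_sum)
  also have "(\<Sum>l=0..s. int ((l + N - 1) choose (N - 1))) = int ((s + N) choose N)"
    using \<open>N > 0\<close> by (induction s) (auto simp: gr0_conv_Suc)
  finally show ?case by simp
qed

lemma lookup_single_single_mult:
  "lookup (single (single n k) c * P) e =
    (if k \<le> lookup e n then c * lookup P (e - single n k) else 0)"
  for P :: "mono \<Rightarrow>\<^sub>0 'a::comm_ring_1"
proof (cases "k \<le> lookup e n")
  case True
  then have "e = single n k + (e - single n k)"
    by (intro poly_mapping_eqI) (auto simp: lookup_add lookup_minus lookup_single when_def)
  then show ?thesis using True lookup_single_mult[of "single n k" c P "e - single n k"] by simp
next
  case False
  then have "e \<noteq> single n k + f" for f by (auto simp: lookup_add)
  then show ?thesis using False by (simp add: lookup_single_mult_0)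
qed

text \<open>Expanding each \<open>(1 - w_i x)^(-N)\<close>, a monomial \<open>f\<close> of
  \<open>P\<close> reaches \<open>e\<close> only through \<open>w^(e - f)\<close>. Writing the
  binomials as \<open>q_pos\<close> makes negative differences contribute 0. The induction splits
  off the last variable.\<close>

lemma lookup_geo_coeff_mult:
  assumes "N > 0"
  shows "of_int (lookup (geo_coeff N n r * P) e) =
    lin (\<lambda>f. if (\<forall>i\<ge>n. lookup e i = lookup f i) \<and>
               (\<Sum>i<n. int (lookup e i) - int (lookup f i)) = int r
             then (\<Prod>i<n. q_pos N (int (lookup e i) - int (lookup f i))) else 0) P"
proof (induction n arbitrary: r e)
  case 0
  have "(\<forall>i. lookup e i = lookup f i) \<longleftrightarrow> f = e" for f
    by (auto intro: poly_mapping_eqI)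
  then have "lin (\<lambda>f. if (\<forall>i\<ge>0. lookup e i = lookup f i) \<and> (0::int) = int r then 1 else 0) P =
      (\<Sum>f\<in>keys P. if f = e then (if r = 0 then of_int (lookup P e) else 0) else 0 :: rat)"
    unfolding lin_def by (intro sum.cong refl) auto
  then show ?case
    by (auto simp: geo_coeff_def sum.delta in_keys_iff cong: if_cong)
next
  case (Suc n)
  define B where "B k = int ((k + N - 1) choose (N - 1))" for k
  define x where "x f i = int (lookup e i) - int (lookup f i)" for f :: mono and i
  define A where "A f \<longleftrightarrow> (\<forall>i\<ge>Suc n. lookup e i = lookup f i)" for f
  have "geo_coeff N (Suc n) r = (\<Sum>s=0..r. single (single n (r - s)) (B (r - s)) * geo_coeff N n s)"
    using assms unfolding geo_coeff_def prod.lessThan_Suc fps_mult_nth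
    by (intro sum.cong refl) (simp add: geo_fac_power_nth B_def mult.commute)
  then have "of_int (lookup (geo_coeff N (Suc n) r * P) e) =
      (\<Sum>s=0..r. (if r - s \<le> lookup e n then
        of_int (B (r - s)) * of_int (lookup (geo_coeff N n s * P) (e - single n (r - s))) else 0 :: rat))"
    by (simp add: sum_distrib_right mult.assoc lookup_sum lookup_single_single_mult if_distrib
          cong: if_cong)
  also have "\<dots> = (\<Sum>s=0..r. lin (\<lambda>f. if r - s \<le> lookup e n \<and> lookup e n - (r - s) = lookup f n \<and> A f \<and>
        (\<Sum>i<n. x f i) = int s then of_int (B (r - s)) * (\<Prod>i<n. q_pos N (x f i)) else 0) P)"
  proof (intro sum.cong refl)
    fix s assume "s \<in> {0..r}"
    show "(if r - s \<le> lookup e n then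
        of_int (B (r - s)) * of_int (lookup (geo_coeff N n s * P) (e - single n (r - s))) else 0 :: rat) =
      lin (\<lambda>f. if r - s \<le> lookup e n \<and> lookup e n - (r - s) = lookup f n \<and> A f \<and>
        (\<Sum>i<n. x f i) = int s then of_int (B (r - s)) * (\<Prod>i<n. q_pos N (x f i)) else 0) P"
    proof (cases "r - s \<le> lookup e n")
      case True
      let ?e = "e - single n (r - s)"
      have "(\<forall>i\<ge>n. lookup ?e i = lookup f i) \<longleftrightarrow> lookup e n - (r - s) = lookup f n \<and> A f" for f
      proof -
        have "(\<forall>i\<ge>n. Q i) \<longleftrightarrow> Q n \<and> (\<forall>i\<ge>Suc n. Q i)" for Q
          by (metis Suc_leD le_antisym not_less_eq_eq order_refl)
        then show ?thesis by (simp add: A_def lookup_minus lookup_single)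
      qed
      moreover have "int (lookup ?e i) - int (lookup f i) = x f i" if "i < n" for i f
        using that by (simp add: x_def lookup_minus lookup_single)
      ultimately show ?thesis
        using True by (auto simp: Suc.IH lin_def sum_distrib_left intro!: sum.cong)
    qed (simp add: lin_def)
  qed
  also have "\<dots> = lin (\<lambda>f. \<Sum>s=0..r. if r - s \<le> lookup e n \<and> lookup e n - (r - s) = lookup f n \<and> A f \<and>
        (\<Sum>i<n. x f i) = int s then of_int (B (r - s)) * (\<Prod>i<n. q_pos N (x f i)) else 0) P"
    by (simp only: lin_fun_sum)
  also have "\<dots> = lin (\<lambda>f. if A f \<and> (\<Sum>i<Suc n. x f i) = int r
      then (\<Prod>i<Suc n. q_pos N (x f i)) else 0) P"
  proof (rule lin_cong)
    fix f
    let ?c = "\<lambda>s. r - s \<le> lookup e n \<and> lookup e n - (r - s) = lookup f n \<and> A f \<and> (\<Sum>i<n. x f i) = int s"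
    let ?t = "\<lambda>s. of_int (B (r - s)) * (\<Prod>i<n. q_pos N (x f i))"
    show "(\<Sum>s=0..r. if ?c s then ?t s else 0) =
      (if A f \<and> (\<Sum>i<Suc n. x f i) = int r then (\<Prod>i<Suc n. q_pos N (x f i)) else 0)"
    proof (cases "\<exists>i<n. x f i < 0")
      case True
      then obtain i where "i < n" "x f i < 0" by auto
      then have "(\<Prod>i<n. q_pos N (x f i)) = 0"
        by (intro prod_zero bexI[of _ i]) (auto simp: q_pos_def)
      then show ?thesis
        by (simp only: prod.lessThan_Suc mult_zero_left mult_zero_right if_cancel sum.neutral_const)
    next
      case False
      then have "(\<Sum>i<n. x f i) \<ge> 0" by (intro sum_nonneg) auto
      \<comment> \<open>At most one \<open>s\<close> contributes, namely the total degree
        \<open>s0\<close> used by the first \<open>n\<close> variables.\<close>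
      then obtain s0 where s0: "(\<Sum>i<n. x f i) = int s0" by (metis nonneg_int_cases)
      show ?thesis
      proof (cases "A f \<and> lookup f n \<le> lookup e n \<and> s0 + (lookup e n - lookup f n) = r")
        case True
        then have "?c s \<longleftrightarrow> s = s0" if "s \<in> {0..r}" for s
          using that s0 by auto
        then have "(\<Sum>s=0..r. if ?c s then ?t s else 0) = (\<Sum>s=0..r. if s = s0 then ?t s else 0)"
          by (intro sum.cong) auto
        also have "\<dots> = ?t s0" using True by (auto simp: sum.delta)
        also have "of_int (B (r - s0)) = q_pos N (x f n)"
        proof -
          have "x f n = int (r - s0)" using True by (auto simp: x_def)
          then show ?thesis using assms by (simp add: q_pos_def q_poly_nat B_def)
        qed
        finally show ?thesis using True s0 by (auto simp: x_def mult.commute)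
      next
        case F: False
        have "(if ?c s then ?t s else 0) = 0" if "s \<in> {0..r}" for s
        proof -
          have "\<not> ?c s" using F s0 that by auto
          then show ?thesis by (simp only: if_False)
        qed
        then have "(\<Sum>s=0..r. if ?c s then ?t s else 0) = 0" by (intro sum.neutral) blast
        moreover have "\<not> (A f \<and> (\<Sum>i<Suc n. x f i) = int r) \<or> q_pos N (x f n) = 0"
          using F s0 by (auto simp: x_def q_pos_def)
        ultimately show ?thesis by auto
      qed
    qed
  qed
  finally show ?case by (simp only: A_def x_def)
qed

text \<open>Each \<open>q_pos\<close> is split as \<open>q_poly + q_rest\<close>, and the product is
  expanded over the sets \<open>S\<close> of variables that carry \<open>q_poly\<close>. Sets with
  two elements are killed by divisibility, the others by comparing degrees.\<close>

theorem geo_coeff_Vand_eq_0: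
  assumes "N > 0" "n > 0" "\<And>i. i < n \<Longrightarrow> lookup e i < r + N * (n - 1)"
  shows "lookup (geo_coeff N n r * Vand (2 * N) n) e = 0"
proof -
  let ?V = "Vand (2 * N) n"
  define x where "x f i = int (lookup e i) - int (lookup f i)" for f :: mono and i
  define R where "R f \<longleftrightarrow> (\<forall>i\<ge>n. lookup e i = lookup f i) \<and> (\<Sum>i<n. x f i) = int r" for f
  have V: "(\<forall>i\<ge>n. lookup f i = 0) \<and> (\<Sum>i<n. lookup f i) = N * n * (n - 1)" if "f \<in> keys ?V" for f
    using that vars_below_Vand[of n "2 * N"] homog_Vand[of n N]
    by (auto simp: vars_below_def homog_def)
  \<comment> \<open>The Vandermonde power is homogeneous, so the condition \<open>R\<close> has the
    same truth value on its whole support and can be taken out of the sum.\<close>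
  have R_const: "R f \<longleftrightarrow> (\<forall>i\<ge>n. lookup e i = 0) \<and>
      int (\<Sum>i<n. lookup e i) - int (N * n * (n - 1)) = int r" if "f \<in> keys ?V" for f
    using V[OF that] by (simp add: R_def x_def sum_subtractf flip: of_nat_sum)
  have "lin (\<lambda>f. if R f then (\<Prod>i<n. q_pos N (x f i)) else 0) ?V = 0"
  proof (cases "(\<forall>i\<ge>n. lookup e i = 0) \<and> int (\<Sum>i<n. lookup e i) - int (N * n * (n - 1)) = int r")
    case False
    then show ?thesis unfolding lin_def by (intro sum.neutral ballI) (simp only: R_const if_False mult_zero_right)
  next
    case True
    have sum_x: "(\<Sum>i<n. x f i) = int r" if "f \<in> keys ?V" for f
      using R_const[OF that] True by (simp add: R_def)
    define G where "G S f = (\<Prod>i\<in>S. q_poly N (x f i)) * (\<Prod>i\<in>{..<n} - S. q_rest N (x f i))" for S f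
    have "lin (\<lambda>f. if R f then (\<Prod>i<n. q_pos N (x f i)) else 0) ?V =
        lin (\<lambda>f. \<Sum>S\<in>Pow {..<n}. G S f) ?V"
    proof (rule lin_cong)
      fix f assume "f \<in> keys ?V"
      moreover have "(\<Prod>i<n. q_pos N (x f i)) = (\<Prod>i<n. q_poly N (x f i) + q_rest N (x f i))"
        by (simp add: q_rest_def)
      ultimately show "(if R f then (\<Prod>i<n. q_pos N (x f i)) else 0) = (\<Sum>S\<in>Pow {..<n}. G S f)"
        using R_const True by (simp add: prod_add G_def)
    qed
    also have "\<dots> = (\<Sum>S\<in>Pow {..<n}. lin (G S) ?V)"
      by (rule lin_fun_sum)
    also have "\<dots> = 0"
    proof (rule sum.neutral, rule ballI)
      fix S assume S: "S \<in> Pow {..<n}"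
      then have finS: "finite S" by (auto intro: finite_subset)
      show "lin (G S) ?V = 0"
      proof (cases "\<exists>i\<in>S. \<exists>j\<in>S. i \<noteq> j")
        case True
        then obtain i j where ij: "i \<in> S" "j \<in> S" "i \<noteq> j" by auto
        \<comment> \<open>\<open>\<psi>\<close> collects the factors without the variables
          \<open>i\<close> and \<open>j\<close>. The two remaining factors have degree less than
          \<open>N\<close> each, which the power \<open>2 * N\<close> of
          \<open>var i - var j\<close> annihilates.\<close>
        define \<psi> where "\<psi> f = (\<Prod>l\<in>S - {i} - {j}. q_poly N (x f l)) *
          (\<Prod>l\<in>{..<n} - S. q_rest N (x f l))" for f
        have inv: "\<psi> (single l 1 + f) = \<psi> f" if "l = i \<or> l = j" for l f
        proof -
          have "x (single l 1 + f) m = x f m" if "m \<in> S - {i} - {j} \<or> m \<in> {..<n} - S" for m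
            using that ij \<open>l = i \<or> l = j\<close> by (auto simp: x_def lookup_add lookup_single when_def)
          then show ?thesis by (simp add: \<psi>_def)
        qed
        have G: "G S f = q_poly N (int (lookup e i) - int (lookup f i)) *
            q_poly N (int (lookup e j) - int (lookup f j)) * \<psi> f" for f
        proof -
          have "(\<Prod>l\<in>S. q_poly N (x f l)) =
              q_poly N (x f i) * (q_poly N (x f j) * (\<Prod>l\<in>S - {i} - {j}. q_poly N (x f l)))"
            using ij finS prod.remove[of S i "\<lambda>l. q_poly N (x f l)"]
              prod.remove[of "S - {i}" j "\<lambda>l. q_poly N (x f l)"] by simp
          then show ?thesis by (simp add: G_def \<psi>_def x_def mult_ac)
        qed
        obtain P where P: "?V = (var i - var j) ^ (2 * N) * P"
          using Vand_dvd[of i n j N] ij S by (auto elim: dvdE)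
        show ?thesis
          unfolding P G
          by (rule lin_diff_power_eq_0[where d = N and d' = N])
             (use ij inv assms in \<open>auto intro: dpoly_q_poly\<close>)
      next
        case False
        \<comment> \<open>Here all differences but at most one are \<open>\<le> - N\<close> while
          their sum is \<open>r\<close>. This is impossible for empty \<open>S\<close>, and for
          \<open>S = {i}\<close> it forces \<open>lookup e i \<ge> r + N * (n - 1)\<close>.\<close>
        have "G S f = 0" if f: "f \<in> keys ?V" for f
        proof (rule ccontr)
          assume "G S f \<noteq> 0"
          then have neg: "x f i \<le> - int N" if "i \<in> {..<n} - S" for i
            using that q_rest_nonzero[OF assms(1)] by (auto simp: G_def)
          show False
          proof (cases "S = {}")
            case True
            have "(\<Sum>i<n. x f i) \<le> (\<Sum>i<n. - int N)"
              using neg True by (intro sum_mono) auto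
            then have "int r \<le> - int n * int N" using sum_x[OF f] by simp
            moreover have "int n * int N > 0" using assms by simp
            ultimately show False by linarith
          next
            case ne: False
            with False obtain i where i: "S = {i}" by auto
            have "(\<Sum>l\<in>{..<n} - {i}. x f l) \<le> (\<Sum>l\<in>{..<n} - {i}. - int N)"
              using neg i by (intro sum_mono) auto
            also have "\<dots> = - int (N * (n - 1))" using i S by (simp add: mult.commute)
            finally have "int r \<le> x f i - int (N * (n - 1))"
              using sum_x[OF f] sum.remove[of "{..<n}" i "x f"] i S by auto
            then have "int (r + N * (n - 1)) \<le> int (lookup e i)" by (simp add: x_def)
            then have "r + N * (n - 1) \<le> lookup e i" by (simp only: of_nat_le_iff)
            then show False using assms(3)[of i] i S by auto
          qed
        qed
        then show ?thesis by (simp add: lin_def)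
      qed
    qed
    finally show ?thesis .
  qed
  then have "of_int (lookup (geo_coeff N n r * ?V) e) = (0 :: rat)"
    unfolding lookup_geo_coeff_mult[OF assms(1)] R_def x_def .
  then show ?thesis by simp
qed

section \<open>The scalar product on \<open>V0\<close>, its reproducing kernel, and power
  sums\<close>

section \<open>The scalar product\<close>

text \<open>The squared norm of a monomial, in terms of exponents; variable \<open>i\<close> stands
  for the part \<open>i + 1\<close>. See \<open>zz_h_exponent\<close> for the form with
  \<open>z_part\<close>.\<close>

definition zz :: "nat \<Rightarrow> mono \<Rightarrow> complex" where
  "zz \<alpha> a = (\<Prod>i\<in>keys a. fact (lookup a i) * (of_nat (i + 1) / of_nat \<alpha>) ^ lookup a i)"

text \<open>The scalar product of symmetric functions pulled back along \<open>T\<close>, as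
  confirmed by \<open>jack_inner_T0\<close>.\<close>

definition ip :: "nat \<Rightarrow> V0 \<Rightarrow> V0 \<Rightarrow> complex" where
  "ip \<alpha> u v = (\<Sum>a\<in>keys u. lookup u a * lookup v a * zz \<alpha> a)"

lemma zz_superset:
  "finite A \<Longrightarrow> keys a \<subseteq> A \<Longrightarrow>
    zz \<alpha> a = (\<Prod>i\<in>A. fact (lookup a i) * (of_nat (i + 1) / of_nat \<alpha>) ^ lookup a i)"
  unfolding zz_def by (rule prod.mono_neutral_left) (auto simp: in_keys_iff)

lemma zz_0 [simp]: "zz \<alpha> 0 = 1"
  by (simp add: zz_def)

lemma zz_nonzero: "\<alpha> > 0 \<Longrightarrow> zz \<alpha> a \<noteq> 0"
  by (simp add: zz_def del: of_nat_Suc of_nat_add)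

lemma zz_add_single:
  "zz \<alpha> (single i 1 + a) = of_nat (lookup a i + 1) * (of_nat (i + 1) / of_nat \<alpha>) * zz \<alpha> a"
proof -
  let ?A = "insert i (keys a)"
  have sub: "keys (single i 1 + a) \<subseteq> ?A" using keys_add[of "single i 1" a] by auto
  have "zz \<alpha> (single i 1 + a) = (\<Prod>j\<in>?A. (if j = i then of_nat (lookup a i + 1) * (of_nat (i + 1) / of_nat \<alpha>) else 1)
      * (fact (lookup a j) * (of_nat (j + 1) / of_nat \<alpha>) ^ lookup a j))"
    using sub unfolding zz_superset[OF finite_insert[THEN iffD2, OF finite_keys] sub]
    by (intro prod.cong refl) (simp add: lookup_add lookup_single when_def plus_1_eq_Suc)
  also have "\<dots> = of_nat (lookup a i + 1) * (of_nat (i + 1) / of_nat \<alpha>) * zz \<alpha> a"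
    by (subst zz_superset[of ?A a]) (auto simp: prod.distrib prod.delta simp del: of_nat_add)
  finally show ?thesis .
qed

lemma ip_superset:
  "finite A \<Longrightarrow> keys u \<subseteq> A \<Longrightarrow> ip \<alpha> u v = (\<Sum>a\<in>A. lookup u a * lookup v a * zz \<alpha> a)"
  unfolding ip_def by (rule sum.mono_neutral_left) (auto simp: in_keys_iff)

lemma ip_commute: "ip \<alpha> u v = ip \<alpha> v u"
  by (simp add: ip_superset[of "keys u \<union> keys v"] mult_ac)

lemma ip_0_left [simp]: "ip \<alpha> 0 v = 0"
  by (simp add: ip_def)

lemma ip_0_right [simp]: "ip \<alpha> u 0 = 0"
  by (simp add: ip_def)

lemma ip_add_left: "ip \<alpha> (u + u') v = ip \<alpha> u v + ip \<alpha> u' v"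
  using keys_add[of u u']
  by (simp add: ip_superset[of "keys u \<union> keys u'"] lookup_add distrib_right sum.distrib)

lemma ip_add_right: "ip \<alpha> u (v + v') = ip \<alpha> u v + ip \<alpha> u v'"
  by (simp add: ip_commute[of \<alpha> u] ip_add_left)

lemma ip_const_mult_left: "ip \<alpha> (const c * u) v = c * ip \<alpha> u v"
proof -
  have "keys (const c * u) \<subseteq> keys u" by (auto simp: in_keys_iff lookup_const_mult)
  then show ?thesis
    by (simp add: ip_superset[of "keys u"] lookup_const_mult sum_distrib_left mult.assoc)
qed

lemma ip_const_mult_right: "ip \<alpha> u (const c * v) = c * ip \<alpha> u v"
  by (simp add: ip_commute[of \<alpha> u] ip_const_mult_left)

lemma ip_of_nat_mult_left: "ip \<alpha> (of_nat n * u) v = of_nat n * ip \<alpha> u v"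
  using ip_const_mult_left[of \<alpha> "of_nat n"] by simp

lemma ip_of_nat_mult_right: "ip \<alpha> u (of_nat n * v) = of_nat n * ip \<alpha> u v"
  using ip_const_mult_right[of \<alpha> u "of_nat n"] by simp

lemma ip_of_int_mult_left: "ip \<alpha> (of_int n * u) v = of_int n * ip \<alpha> u v"
  using ip_const_mult_left[of \<alpha> "of_int n"] by simp

lemma ip_uminus_left: "ip \<alpha> (- u) v = - ip \<alpha> u v"
  using ip_add_left[of \<alpha> u "-u" v] by (simp add: add_eq_0_iff)

lemma ip_diff_left: "ip \<alpha> (u - u') v = ip \<alpha> u v - ip \<alpha> u' v"
  using ip_add_left[of \<alpha> u "-u'" v] by (simp add: ip_uminus_left)

lemma ip_sum_left: "ip \<alpha> (sum f A) v = (\<Sum>x\<in>A. ip \<alpha> (f x) v)"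
  by (induction A rule: infinite_finite_induct) (auto simp: ip_add_left)

lemma ip_sum_right: "ip \<alpha> u (sum f A) = (\<Sum>x\<in>A. ip \<alpha> u (f x))"
  by (induction A rule: infinite_finite_induct) (auto simp: ip_add_right)

lemma ip_single_left [simp]: "ip \<alpha> (single a c) v = c * lookup v a * zz \<alpha> a"
  by (simp add: ip_def)

lemma ip_one_left: "ip \<alpha> 1 v = lookup v 0"
  by (simp add: ip_def)

text \<open>One more factor \<open>h_{-m}\<close> multiplies the norm by its new multiplicity times
  \<open>m / \<alpha>\<close>, exactly the factor produced by \<open>h_m\<close>.\<close>

lemma ip_adjoint:
  assumes "m > 0"
  shows "ip \<alpha> (var (m - 1) * u) v = ip \<alpha> u (h_pos \<alpha> m v)"
proof (induction u rule: mpoly_induct)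
  case (single a c)
  have m: "of_nat m = (of_nat (m - 1 + 1) :: complex)" using assms by simp
  have "ip \<alpha> (var (m - 1) * single a c) v =
      c * lookup v (single (m - 1) 1 + a) * zz \<alpha> (single (m - 1) 1 + a)"
    by (simp add: mult_single)
  also have "\<dots> = c * lookup (h_pos \<alpha> m v) a * zz \<alpha> a"
    unfolding zz_add_single h_pos_eq lookup_const_mult lookup_pdiff m
    by (simp add: add.commute mult_ac del: of_nat_add)
  finally show ?case by simp
next
  case (add p q)
  then show ?case by (simp add: distrib_left ip_add_left)
qed

text \<open>The coefficient of \<open>x^\<epsilon>\<close> in the kernel
  \<open>g(x_0) g(x_1) ...\<close>; variables outside \<open>keys \<epsilon>\<close> contribute the
  constant coefficient 1.\<close>

definition Gx :: "nat \<Rightarrow> mono \<Rightarrow> V0" where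
  "Gx \<alpha> \<epsilon> = (\<Prod>i\<in>keys \<epsilon>. gfun \<alpha> (int (lookup \<epsilon> i)))"

lemma Gx_superset:
  "finite A \<Longrightarrow> keys \<epsilon> \<subseteq> A \<Longrightarrow> Gx \<alpha> \<epsilon> = (\<Prod>i\<in>A. gfun \<alpha> (int (lookup \<epsilon> i)))"
  unfolding Gx_def by (rule prod.mono_neutral_left) (auto simp: in_keys_iff)

lemma Gx_0 [simp]: "Gx \<alpha> 0 = 1"
  by (simp add: Gx_def)

lemma Gx_remove: "Gx \<alpha> \<epsilon> = gfun \<alpha> (int (lookup \<epsilon> i)) * Gx \<alpha> (\<epsilon> - single i (lookup \<epsilon> i))"
proof -
  let ?A = "insert i (keys \<epsilon>)" and ?e = "\<epsilon> - single i (lookup \<epsilon> i)"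
  have "keys ?e \<subseteq> ?A" by (auto simp: in_keys_iff lookup_minus)
  moreover have "lookup ?e j = (if j = i then 0 else lookup \<epsilon> j)" for j
    by (simp add: lookup_minus lookup_single when_def)
  ultimately have "Gx \<alpha> ?e = (\<Prod>j\<in>?A - {i}. gfun \<alpha> (int (lookup \<epsilon> j)))"
    by (simp add: Gx_superset[of ?A] prod.remove[of ?A i] cong: prod.cong_simp)
  moreover have "Gx \<alpha> \<epsilon> = (\<Prod>j\<in>?A. gfun \<alpha> (int (lookup \<epsilon> j)))"
    by (rule Gx_superset) auto
  ultimately show ?thesis
    by (simp only: prod.remove[of ?A i] finite_insert finite_keys insertI1)
qed

text \<open>\<open>h_m\<close> multiplies the kernel by the power sum in the \<open>x_i\<close>; the
  right side has the same form as in \<open>sf_mult_power_sum\<close>.\<close>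

lemma h_pos_Gx:
  assumes "\<alpha> > 0" "m > 0"
  shows "h_pos \<alpha> m (Gx \<alpha> \<epsilon>) =
    (\<Sum>i\<in>{i\<in>keys \<epsilon>. m \<le> lookup \<epsilon> i}. Gx \<alpha> (\<epsilon> - single i m))"
proof -
  have "h_pos \<alpha> m (Gx \<alpha> \<epsilon>) =
      (\<Sum>i\<in>keys \<epsilon>. \<Prod>j\<in>keys \<epsilon>. gfun \<alpha> (int (lookup \<epsilon> j) - (if j = i then int m else 0)))"
    using assms by (simp add: Gx_def h_pos_prod_gfun)
  also have "\<dots> = (\<Sum>i\<in>keys \<epsilon>. if m \<le> lookup \<epsilon> i then Gx \<alpha> (\<epsilon> - single i m) else 0)"
  proof (intro sum.cong refl)
    fix i assume i: "i \<in> keys \<epsilon>"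
    show "(\<Prod>j\<in>keys \<epsilon>. gfun \<alpha> (int (lookup \<epsilon> j) - (if j = i then int m else 0))) =
        (if m \<le> lookup \<epsilon> i then Gx \<alpha> (\<epsilon> - single i m) else 0)"
    proof (cases "m \<le> lookup \<epsilon> i")
      case True
      have "keys (\<epsilon> - single i m) \<subseteq> keys \<epsilon>" by (auto simp: in_keys_iff lookup_minus)
      with True show ?thesis
        by (auto simp: Gx_superset[of "keys \<epsilon>"] lookup_minus lookup_single when_def of_nat_diff
                 intro!: prod.cong)
    next
      case False
      with i show ?thesis by (auto intro!: prod_zero bexI[of _ i])
    qed
  qed
  finally show ?thesis by (simp add: sum.inter_filter)
qed

lemma lookup_mult_0: "lookup (u * v) 0 = lookup u 0 * lookup v (0 :: mono)" for u v :: V0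
proof (induction u rule: mpoly_induct)
  case (single a c)
  show ?case
  proof (induction v rule: mpoly_induct)
    case (single b d)
    have "a + b = 0 \<longleftrightarrow> a = 0 \<and> b = 0"
      by (auto simp: poly_mapping_eq_iff fun_eq_iff lookup_add)
    then show ?case by (auto simp: mult_single lookup_single when_def)
  qed (simp add: distrib_left lookup_add)
qed (simp add: distrib_right lookup_add)

lemma single_eq_0_iff: "single a c = 0 \<longleftrightarrow> c = 0"
  by (metis lookup_single_eq lookup_zero single_zero)

lemma lookup_gfun_0: "lookup (gfun \<alpha> a) 0 = (if a = 0 then 1 else 0)"
proof (cases "a > 0")
  case True
  define n where "n = nat a"
  have "of_nat n * lookup (gfun \<alpha> (int n)) 0 = lookup (of_nat n * gfun \<alpha> (int n)) 0"
    by (simp add: lookup_mult_0 lookup_of_nat)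
  also have "\<dots> = 0"
    unfolding gfun_rec by (simp add: lookup_mult_0 lookup_sum lookup_single single_eq_0_iff)
  finally show ?thesis using True by (simp add: n_def)
next
  case False
  then show ?thesis by (cases "a = 0") auto
qed

lemma lookup_Gx_0: "lookup (Gx \<alpha> \<epsilon>) 0 = (if \<epsilon> = 0 then 1 else 0)"
proof -
  have "lookup (\<Prod>i\<in>A. f i) 0 = (\<Prod>i\<in>A. lookup (f i) 0)" for A and f :: "nat \<Rightarrow> V0"
    by (induction A rule: infinite_finite_induct) (auto simp: lookup_mult_0)
  then have "lookup (Gx \<alpha> \<epsilon>) 0 = (\<Prod>i\<in>keys \<epsilon>. if lookup \<epsilon> i = 0 then 1 else 0)"
    by (simp add: Gx_def lookup_gfun_0)
  also have "\<dots> = (\<Prod>i\<in>keys \<epsilon>. 0)" by (intro prod.cong) (auto simp: in_keys_iff)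
  finally show ?thesis by (auto simp: power_0_left card_eq_0_iff)
qed

text \<open>\<open>sf_mult\<close> sums over this set, and a sum over an infinite set would be 0 by
  convention. A summand of \<open>e\<close> is determined by its bounded values on
  \<open>keys e\<close>.\<close>

lemma finite_antidiagonal: "finite {(a, b). a + b = (e :: mono)}"
proof -
  have le: "lookup a i \<le> lookup (a + b) i" "lookup a i \<le> lookup (b + a) i" for a b :: mono and i
    by (simp_all add: lookup_add)
  have "inj_on (\<lambda>a. restrict (lookup a) (keys e)) {a. \<exists>b. a + b = e}"
  proof (rule inj_onI)
    fix a a' assume a: "a \<in> {a. \<exists>b. a + b = e}" "a' \<in> {a. \<exists>b. a + b = e}"
      and eq: "restrict (lookup a) (keys e) = restrict (lookup a') (keys e)"
    show "a = a'"
    proof (rule poly_mapping_eqI)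
      fix i
      show "lookup a i = lookup a' i"
      proof (cases "i \<in> keys e")
        case True
        then show ?thesis using fun_cong[OF eq, of i] by simp
      next
        case False
        moreover obtain b b' where "e = a + b" "e = a' + b'" using a by force
        then have "lookup a i \<le> lookup e i" "lookup a' i \<le> lookup e i"
          using le(1) by metis+
        ultimately have "lookup a i = 0" "lookup a' i = 0" by (auto simp: in_keys_iff)
        then show ?thesis by simp
      qed
    qed
  qed
  moreover have "(\<lambda>a. restrict (lookup a) (keys e)) ` {a. \<exists>b. a + b = e} \<subseteq>
      PiE (keys e) (\<lambda>i. {..lookup e i})"
    by (auto simp: lookup_add)
  moreover have "finite (PiE (keys e) (\<lambda>i. {..lookup e i}))"
    by (intro finite_PiE) auto
  ultimately have "finite {a. \<exists>b. a + b = e}"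
    by (meson finite_imageD finite_subset)
  then have "finite ((\<lambda>a. (a, e - a)) ` {a. \<exists>b. a + b = e})" by simp
  moreover have "{(a, b). a + b = e} \<subseteq> (\<lambda>a. (a, e - a)) ` {a. \<exists>b. a + b = e}"
    by auto
  ultimately show ?thesis by (rule finite_subset[rotated])
qed

lemma single_index_eq_iff: "c \<noteq> 0 \<Longrightarrow> single i c = single j c \<longleftrightarrow> i = j"
  by (metis lookup_single_eq lookup_single_not_eq)

lemma sf_mult_power_sum:
  assumes "m > 0"
  shows "sf_mult (power_sum m) f e = (\<Sum>i\<in>{i\<in>keys e. m \<le> lookup e i}. f (e - single i m))"
proof -
  let ?I = "{i\<in>keys e. m \<le> lookup e i}" and ?h = "\<lambda>i. (single i m, e - single i m)"
  have "sf_mult (power_sum m) f e = (\<Sum>x\<in>?h ` ?I. power_sum m (fst x) * f (snd x))"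
    unfolding sf_mult_def case_prod_unfold
  proof (rule sum.mono_neutral_right)
    show "finite {p. fst p + snd p = e}"
      using finite_antidiagonal[of e] by (simp add: case_prod_unfold)
    have "single i m + (e - single i m) = e" if "m \<le> lookup e i" for i
      using that by (intro poly_mapping_eqI) (auto simp: lookup_add lookup_minus lookup_single when_def)
    then show "?h ` ?I \<subseteq> {p. fst p + snd p = e}" by auto
    show "\<forall>p\<in>{p. fst p + snd p = e} - ?h ` ?I. power_sum m (fst p) * f (snd p) = 0"
    proof (rule ballI, rule ccontr)
      fix p assume p: "p \<in> {p. fst p + snd p = e} - ?h ` ?I" "power_sum m (fst p) * f (snd p) \<noteq> 0"
      then obtain i where i: "fst p = single i m" by (auto simp: power_sum_def split: if_splits)
      then have e: "e = single i m + snd p" using p by auto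
      then have "i \<in> ?I" using assms by (auto simp: lookup_add in_keys_iff)
      moreover have "p = ?h i" using i e by (cases p) auto
      ultimately show False using p by blast
    qed
  qed
  also have "\<dots> = (\<Sum>i\<in>?I. f (e - single i m))"
    using assms
    by (subst sum.reindex)
       (auto simp: inj_on_def power_sum_def single_index_eq_iff intro!: sum.cong)
  finally show ?thesis .
qed

lemma h_exponent_Nil [simp]: "h_exponent [] = 0"
  by (simp add: h_exponent_def)

lemma h_exponent_Cons: "h_exponent (m # lam) = single (m - 1) 1 + h_exponent lam"
  by (simp add: h_exponent_def)

text \<open>Adjointness moves each \<open>h_{-m}\<close> over to the kernel, where it acts as
  multiplication by \<open>power_sum m\<close>.\<close>

lemma p_sym_eq:
  assumes "\<alpha> > 0" "0 \<notin> set lam"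
  shows "p_sym lam \<epsilon> = ip \<alpha> (single (h_exponent lam) 1) (Gx \<alpha> \<epsilon>)"
  using assms(2)
proof (induction lam arbitrary: \<epsilon>)
  case Nil
  then show ?case by (simp add: p_sym_def sf_one_def lookup_Gx_0 ip_one_left)
next
  case (Cons m lam)
  then have "m > 0" by auto
  have "p_sym (m # lam) \<epsilon> = sf_mult (power_sum m) (p_sym lam) \<epsilon>"
    by (simp add: p_sym_def)
  also have "\<dots> = (\<Sum>i\<in>{i\<in>keys \<epsilon>. m \<le> lookup \<epsilon> i}. ip \<alpha> (single (h_exponent lam) 1) (Gx \<alpha> (\<epsilon> - single i m)))"
    using Cons \<open>m > 0\<close> by (subst sf_mult_power_sum) auto
  also have "\<dots> = ip \<alpha> (var (m - 1) * single (h_exponent lam) 1) (Gx \<alpha> \<epsilon>)"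
    using assms(1) \<open>m > 0\<close> by (simp add: ip_adjoint h_pos_Gx ip_sum_right)
  finally show ?case by (simp add: h_exponent_Cons mult_single)
qed

lemma h_exponent_append: "h_exponent (lam @ mu) = h_exponent lam + h_exponent mu"
  by (simp add: h_exponent_def)

lemma h_exponent_surj: "\<exists>lam. 0 \<notin> set lam \<and> h_exponent lam = a"
proof (induction a rule: mpoly_induct)
  case (single i c)
  have "h_exponent (replicate c (i + 1)) = single i c"
    by (induction c) (auto simp: h_exponent_Cons plus_1_eq_Suc simp flip: single_add)
  then show ?case by (intro exI[of _ "replicate c (i + 1)"]) auto
next
  case (add a b)
  then obtain lam mu where "0 \<notin> set lam" "0 \<notin> set mu" "h_exponent lam = a" "h_exponent mu = b"
    by auto
  then show ?case by (intro exI[of _ "lam @ mu"]) (auto simp: h_exponent_append)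
qed

text \<open>
  Since \<open>Gx \<alpha>\<close> is the reproducing kernel, the map \<open>T\<close> is given by scalar products; this makes
  the ring structure of symmetric functions unnecessary.
\<close>

definition T0 :: "nat \<Rightarrow> V0 \<Rightarrow> symf" where
  "T0 \<alpha> u \<epsilon> = ip \<alpha> u (Gx \<alpha> \<epsilon>)"

text \<open>The coefficients of the kernel span \<open>V0\<close>, because \<open>gfun_rec\<close>
  expresses each variable through the \<open>gfun\<close> and the earlier variables. So a vector
  orthogonal to all of them is orthogonal to every monomial.\<close>

lemma T0_inj:
  assumes "\<alpha> > 0" "\<And>\<epsilon>. T0 \<alpha> u \<epsilon> = 0"
  shows "u = 0"
proof -
  \<comment> \<open>Orthogonality passes from \<open>M\<close> to \<open>h_{-r} M\<close>: in the
    recursion for \<open>gfun \<alpha> r\<close> all terms with \<open>i < r\<close> vanish by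
    induction, leaving \<open>\<alpha>\<close> times the wanted one.\<close>
  have step: "ip \<alpha> u (var (r - 1) * M * Gx \<alpha> \<epsilon>) = 0"
    if M: "\<And>\<epsilon>. ip \<alpha> u (M * Gx \<alpha> \<epsilon>) = 0" and "r > 0" for r M \<epsilon>
    using \<open>r > 0\<close>
  proof (induction r arbitrary: \<epsilon> rule: less_induct)
    case (less r)
    \<comment> \<open>A variable outside \<open>keys \<epsilon>\<close> absorbs the extra factor
      into another kernel coefficient.\<close>
    have fresh: "\<exists>\<epsilon>'. Gx \<alpha> \<epsilon>' = gfun \<alpha> (int l) * Gx \<alpha> \<epsilon>" for l
    proof -
      obtain i where i: "i \<notin> keys \<epsilon>" using ex_new_if_finite[OF infinite_UNIV_nat finite_keys] by blast
      let ?e = "\<epsilon> + single i l"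
      have "lookup ?e i = l" "?e - single i l = \<epsilon>"
        using i by (auto simp: lookup_add in_keys_iff)
      then show ?thesis using Gx_remove[of \<alpha> ?e i] by auto
    qed
    have g: "ip \<alpha> u (M * (gfun \<alpha> (int l) * Gx \<alpha> \<epsilon>)) = 0" for l
      using fresh[of l] M by metis
    have lower: "ip \<alpha> u (var (i - 1) * M * (gfun \<alpha> (int l) * Gx \<alpha> \<epsilon>)) = 0" if "i < r" "i > 0" for i l
      using fresh[of l] less.IH[OF that] by metis
    have "0 = of_nat r * ip \<alpha> u (M * (gfun \<alpha> (int r) * Gx \<alpha> \<epsilon>))" using g by simp
    also have "\<dots> = ip \<alpha> u (M * ((of_nat r * gfun \<alpha> (int r)) * Gx \<alpha> \<epsilon>))"
      by (simp only: ip_of_nat_mult_right[symmetric]) (simp add: mult_ac)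
    also have "\<dots> = of_nat \<alpha> * (\<Sum>i=1..r. ip \<alpha> u (var (i - 1) * M * (gfun \<alpha> (int r - int i) * Gx \<alpha> \<epsilon>)))"
      unfolding gfun_rec ip_of_nat_mult_right[symmetric] ip_sum_right[symmetric]
      by (simp add: sum_distrib_left sum_distrib_right mult_ac)
    also have "(\<Sum>i=1..r. ip \<alpha> u (var (i - 1) * M * (gfun \<alpha> (int r - int i) * Gx \<alpha> \<epsilon>))) =
        (\<Sum>i=1..r. if i = r then ip \<alpha> u (var (r - 1) * M * Gx \<alpha> \<epsilon>) else 0)"
    proof (intro sum.cong refl)
      fix i assume "i \<in> {1..r}"
      then show "ip \<alpha> u (var (i - 1) * M * (gfun \<alpha> (int r - int i) * Gx \<alpha> \<epsilon>)) =
          (if i = r then ip \<alpha> u (var (r - 1) * M * Gx \<alpha> \<epsilon>) else 0)"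
        using lower[of i "r - i"] by (auto simp: of_nat_diff)
    qed
    also have "\<dots> = ip \<alpha> u (var (r - 1) * M * Gx \<alpha> \<epsilon>)"
      using less.prems by (simp add: sum.delta)
    finally show ?case using assms(1) by simp
  qed
  have "\<forall>\<epsilon>. ip \<alpha> u (single (h_exponent lam) 1 * Gx \<alpha> \<epsilon>) = 0" if "0 \<notin> set lam" for lam
    using that
  proof (induction lam)
    case Nil
    then show ?case using assms(2) by (simp add: T0_def)
  next
    case (Cons m lam)
    then show ?case
      using step[of "single (h_exponent lam) 1" m]
      by (auto simp: h_exponent_Cons mult_single)
  qed
  then have "ip \<alpha> u (single (h_exponent lam) 1) = 0" if "0 \<notin> set lam" for lam
    using that by (metis Gx_0 mult.right_neutral)
  then have *: "lookup u (h_exponent lam) = 0" if "0 \<notin> set lam" for lam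
    using that zz_nonzero[OF assms(1)] by (simp add: ip_commute[of _ u])
  show ?thesis
  proof (rule poly_mapping_eqI)
    fix a
    show "lookup u a = lookup 0 a"
      using h_exponent_surj[of a] * by auto
  qed
qed

section \<open>Partitions as exponents, and coordinates in the power sums\<close>

lemma lookup_h_exponent: "0 \<notin> set lam \<Longrightarrow> lookup (h_exponent lam) i = count_list lam (i + 1)"
  by (induction lam) (auto simp: h_exponent_Cons lookup_add lookup_single when_def)

lemma count_list_eq_count_mset: "count_list lam i = count (mset lam) i"
  by (induction lam) auto

lemma partition_eqI:
  assumes "is_partition lam" "is_partition mu" "mset lam = mset mu"
  shows "lam = mu"
proof -
  have "sorted (rev lam)" "sorted (rev mu)"
    using assms by (auto simp: is_partition_def sorted_wrt_rev)
  then have "rev lam = rev mu"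
    using assms(3) by (metis mset_rev properties_for_sort)
  then show ?thesis by simp
qed

lemma h_exponent_inj:
  assumes "is_partition lam" "is_partition mu" "h_exponent lam = h_exponent mu"
  shows "lam = mu"
proof (rule partition_eqI[OF assms(1,2)], rule multiset_eqI)
  fix i
  have 0: "0 \<notin> set lam" "0 \<notin> set mu" using assms by (auto simp: is_partition_def)
  show "count (mset lam) i = count (mset mu) i"
  proof (cases i)
    case 0
    then show ?thesis using \<open>0 \<notin> set lam\<close> \<open>0 \<notin> set mu\<close>
      by (metis count_list_0_iff count_list_eq_count_mset)
  next
    case (Suc j)
    then show ?thesis
      using lookup_h_exponent[OF 0(1), of j] lookup_h_exponent[OF 0(2), of j] assms(3)
      by (metis Suc_eq_plus1 count_list_eq_count_mset)
  qed
qed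

definition psort :: "nat list \<Rightarrow> nat list" where
  "psort lam = rev (sort lam)"

lemma psort_partition: "0 \<notin> set lam \<Longrightarrow> is_partition (psort lam)"
  by (auto simp: psort_def is_partition_def sorted_wrt_rev)

lemma mset_psort [simp]: "mset (psort lam) = mset lam"
  by (simp add: psort_def)

lemma h_exponent_mset: "h_exponent lam = (\<Sum>n\<in>#mset lam. single (n - 1) 1)"
  by (simp add: h_exponent_def flip: sum_mset_sum_list)

lemma h_exponent_partition: "\<exists>lam. is_partition lam \<and> h_exponent lam = a"
proof -
  obtain lam where "0 \<notin> set lam" "h_exponent lam = a" using h_exponent_surj by blast
  then show ?thesis
    by (intro exI[of _ "psort lam"]) (auto simp: psort_partition h_exponent_mset)
qed

lemma h_exponent_bij: "bij_betw h_exponent {lam. is_partition lam \<and> h_exponent lam \<in> A} A"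
  unfolding bij_betw_def
proof
  show "inj_on h_exponent {lam. is_partition lam \<and> h_exponent lam \<in> A}"
    by (auto intro!: inj_onI h_exponent_inj)
  show "h_exponent ` {lam. is_partition lam \<and> h_exponent lam \<in> A} = A"
    using h_exponent_partition by (auto simp: image_iff) metis
qed

lemma T_map_single:
  assumes "\<alpha> > 0"
  shows "T_map (single m u) = T0 \<alpha> u"
proof
  fix e
  have "T_map (single m u) e = (\<Sum>lam\<in>{lam. is_partition lam \<and> h_exponent lam \<in> keys u}.
      lookup u (h_exponent lam) * p_sym lam e)"
    by (cases "u = 0") (simp_all add: T_map_def)
  also have "\<dots> = (\<Sum>lam\<in>{lam. is_partition lam \<and> h_exponent lam \<in> keys u}.
      lookup u (h_exponent lam) * ip \<alpha> (single (h_exponent lam) 1) (Gx \<alpha> e))"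
    using assms by (intro sum.cong refl arg_cong2[where f = "(*)"] p_sym_eq) (auto simp: is_partition_def)
  also have "\<dots> = (\<Sum>a\<in>keys u. lookup u a * ip \<alpha> (single a 1) (Gx \<alpha> e))"
    using sum.reindex_bij_betw[OF h_exponent_bij, of "\<lambda>a. lookup u a * ip \<alpha> (single a 1) (Gx \<alpha> e)" "keys u"]
    by simp
  also have "\<dots> = T0 \<alpha> u e"
    by (simp add: T0_def ip_def mult.assoc)
  finally show "T_map (single m u) e = T0 \<alpha> u e" .
qed

lemma zz_h_exponent:
  assumes "is_partition lam"
  shows "zz \<alpha> (h_exponent lam) = of_nat (z_part lam) / of_nat \<alpha> ^ length lam"
proof -
  have 0: "0 \<notin> set lam" using assms by (auto simp: is_partition_def)
  have keys: "keys (h_exponent lam) = (\<lambda>i. i - 1) ` set lam"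
  proof (intro set_eqI iffI)
    fix i assume "i \<in> keys (h_exponent lam)"
    then have "i + 1 \<in> set lam"
      using 0 by (simp add: in_keys_iff lookup_h_exponent count_list_0_iff)
    then show "i \<in> (\<lambda>i. i - 1) ` set lam" by force
  next
    fix i assume "i \<in> (\<lambda>i. i - 1) ` set lam"
    then obtain j where j: "j \<in> set lam" "i = j - 1" by auto
    then have "j \<noteq> 0" using 0 by metis
    then have "i + 1 \<in> set lam" using j by simp
    then show "i \<in> keys (h_exponent lam)"
      using 0 by (simp add: in_keys_iff lookup_h_exponent count_list_0_iff)
  qed
  have inj: "inj_on (\<lambda>i. i - 1) (set lam)"
    using 0 by (intro inj_onI) (metis diff_Suc_1 gr0_conv_Suc gr0I)
  have "zz \<alpha> (h_exponent lam) = (\<Prod>j\<in>set lam. fact (count_list lam j) * (of_nat j / of_nat \<alpha>) ^ count_list lam j)"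
    unfolding zz_def keys
  proof (subst prod.reindex[OF inj], intro prod.cong refl)
    fix j assume "j \<in> set lam"
    then have "j > 0" using 0 by (auto intro: gr0I)
    then have j: "j - 1 + 1 = j" by simp
    show "((\<lambda>i. fact (lookup (h_exponent lam) i) *
        (of_nat (i + 1) / of_nat \<alpha>) ^ lookup (h_exponent lam) i) \<circ> (\<lambda>i. i - 1)) j =
        fact (count_list lam j) * (of_nat j / of_nat \<alpha>) ^ count_list lam j"
      using 0 by (simp add: lookup_h_exponent j del: of_nat_add)
  qed
  also have "\<dots> = (\<Prod>j\<in>set lam. of_nat (j ^ count_list lam j * fact (count_list lam j))) /
      (\<Prod>j\<in>set lam. of_nat \<alpha> ^ count_list lam j)"
    by (simp add: prod_dividef[symmetric] power_divide mult_ac)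
  also have "(\<Prod>j\<in>set lam. of_nat \<alpha> ^ count_list lam j) = (of_nat \<alpha> ^ length lam :: complex)"
    by (simp add: power_sum[symmetric] sum_count_set)
  finally show ?thesis by (simp add: z_part_def)
qed

definition crd :: "V0 \<Rightarrow> nat list \<Rightarrow>\<^sub>0 complex" where
  "crd u = Abs_poly_mapping (\<lambda>lam. if is_partition lam then lookup u (h_exponent lam) else 0)"

lemma finite_partitions_keys: "finite {lam. is_partition lam \<and> h_exponent lam \<in> keys u}"
  using bij_betw_finite[OF h_exponent_bij, of "keys u"] by simp

lemma lookup_crd: "lookup (crd u) lam = (if is_partition lam then lookup u (h_exponent lam) else 0)"
proof -
  have "{lam. (if is_partition lam then lookup u (h_exponent lam) else 0) \<noteq> 0} =
      {lam. is_partition lam \<and> h_exponent lam \<in> keys u}"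
    by (auto simp: in_keys_iff)
  then show ?thesis
    unfolding crd_def by (subst lookup_Abs_poly_mapping) (simp_all add: finite_partitions_keys)
qed

lemma keys_crd: "keys (crd u) = {lam. is_partition lam \<and> h_exponent lam \<in> keys u}"
  by (auto simp: in_keys_iff lookup_crd split: if_splits)

text \<open>The definite description needs existence and uniqueness. Any other coordinates define an
  element of \<open>V0\<close> with the same image, and \<open>T0_inj\<close> identifies the
  two.\<close>

lemma p_coords_T0:
  assumes "\<alpha> > 0"
  shows "p_coords (T0 \<alpha> u) = crd u"
  unfolding p_coords_def
proof (rule the_equality, intro conjI ballI ext)
  fix e
  show "T0 \<alpha> u e = (\<Sum>lam\<in>keys (crd u). lookup (crd u) lam * p_sym lam e)"
  proof -
    have "T0 \<alpha> u e = T_map (single 0 u) e" using assms by (simp add: T_map_single)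
    also have "\<dots> = (\<Sum>lam\<in>{lam. is_partition lam \<and> h_exponent lam \<in> keys u}.
        lookup u (h_exponent lam) * p_sym lam e)"
      by (cases "u = 0") (simp_all add: T_map_def)
    finally show ?thesis by (simp add: keys_crd lookup_crd)
  qed
next
  fix a :: "nat list \<Rightarrow>\<^sub>0 complex"
  assume a: "(\<forall>lam\<in>keys a. is_partition lam) \<and>
    T0 \<alpha> u = (\<lambda>e. \<Sum>lam\<in>keys a. lookup a lam * p_sym lam e)"
  define u' where "u' = (\<Sum>lam\<in>keys a. single (h_exponent lam) (lookup a lam))"
  have "T0 \<alpha> u' e = T0 \<alpha> u e" for e
  proof -
    have "T0 \<alpha> u' e = (\<Sum>lam\<in>keys a. lookup a lam * p_sym lam e)"
      unfolding u'_def T0_def ip_sum_left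
      using a assms by (intro sum.cong refl) (auto simp: p_sym_eq[of \<alpha>] is_partition_def)
    then show ?thesis using a by simp
  qed
  then have "u - u' = 0"
    by (intro T0_inj[OF assms]) (simp add: T0_def ip_diff_left)
  then have u: "u = u'" by simp
  show "a = crd u"
  proof (rule poly_mapping_eqI)
    fix lam
    show "lookup a lam = lookup (crd u) lam"
    proof (cases "is_partition lam")
      case True
      have "lookup u (h_exponent lam) =
          (\<Sum>mu\<in>keys a. if mu = lam then lookup a mu else 0)"
        unfolding u u'_def lookup_sum lookup_single
        using a True h_exponent_inj by (intro sum.cong refl) (auto simp: when_def)
      then show ?thesis using True by (simp add: lookup_crd sum.delta in_keys_iff)
    next
      case False
      then show ?thesis using a by (auto simp: lookup_crd in_keys_iff)
    qed
  qed
qed (auto simp: keys_crd)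

lemma jack_inner_T0:
  assumes "\<alpha> > 0"
  shows "jack_inner \<alpha> (T0 \<alpha> u) (T0 \<alpha> v) = ip \<alpha> u v"
proof -
  have "jack_inner \<alpha> (T0 \<alpha> u) (T0 \<alpha> v) =
      (\<Sum>lam\<in>{lam. is_partition lam \<and> h_exponent lam \<in> keys u}.
        lookup u (h_exponent lam) * lookup v (h_exponent lam) * zz \<alpha> (h_exponent lam))"
    unfolding jack_inner_def p_coords_T0[OF assms] keys_crd
    by (intro sum.cong refl) (simp add: lookup_crd zz_h_exponent)
  also have "\<dots> = ip \<alpha> u v"
    unfolding ip_def
    by (rule sum.reindex_bij_betw[OF h_exponent_bij, of "\<lambda>a. lookup u a * lookup v a * zz \<alpha> a"])
  finally show ?thesis .
qed

section \<open>Monomial symmetric functions as a basis\<close>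

section \<open>Monomial symmetric functions and Jack functions\<close>

definition vals :: "mono \<Rightarrow> nat multiset" where
  "vals \<epsilon> = image_mset (lookup \<epsilon>) (mset_set (keys \<epsilon>))"

text \<open>Labels the orbit of a monomial under permutations of the variables.\<close>

definition shape :: "mono \<Rightarrow> nat list" where
  "shape \<epsilon> = psort (map (lookup \<epsilon>) (sorted_list_of_set (keys \<epsilon>)))"

lemma mset_shape: "mset (shape \<epsilon>) = vals \<epsilon>"
  by (simp add: shape_def vals_def mset_sorted_list_of_multiset flip: sorted_list_of_mset_set)

lemma set_shape: "set (shape \<epsilon>) = lookup \<epsilon> ` keys \<epsilon>"
  using arg_cong[OF mset_shape, of set_mset \<epsilon>] by (simp add: vals_def)

lemma shape_partition: "is_partition (shape \<epsilon>)"
  unfolding shape_def by (rule psort_partition) (auto simp: in_keys_iff)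

lemma m_sym_eq: "is_partition mu \<Longrightarrow> m_sym mu \<epsilon> = (if shape \<epsilon> = mu then 1 else 0)"
  using partition_eqI[OF shape_partition, of mu \<epsilon>]
  by (auto simp: m_sym_def mset_shape vals_def)

lemma length_shape: "length (shape \<epsilon>) = card (keys \<epsilon>)"
  using arg_cong[OF mset_shape, of size \<epsilon>] by (simp add: vals_def)

lemma sum_list_shape: "sum_list (shape \<epsilon>) = (\<Sum>i\<in>keys \<epsilon>. lookup \<epsilon> i)"
  using arg_cong[OF mset_shape, of sum_mset \<epsilon>] by (simp add: vals_def sum_mset_sum_list flip: sum_unfold_sum_mset)

lemma sum_keys_add_single:
  fixes \<epsilon> :: mono
  shows "(\<Sum>i\<in>keys (\<epsilon> + single j m). lookup (\<epsilon> + single j m) i) = (\<Sum>i\<in>keys \<epsilon>. lookup \<epsilon> i) + m"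
proof -
  have sub: "(\<Sum>i\<in>keys e. lookup e i) = (\<Sum>i\<in>insert j (keys \<epsilon>). lookup e i)"
    if "keys e \<subseteq> insert j (keys \<epsilon>)" for e :: mono
    using that by (intro sum.mono_neutral_left) (auto simp: in_keys_iff)
  show ?thesis
    using keys_add[of \<epsilon> "single j m"]
    by (subst (1 2) sub) (auto simp: lookup_add lookup_single when_def sum.distrib sum.delta split: if_splits)
qed

text \<open>The kernel is symmetric in the \<open>x_i\<close>; hence all values of \<open>T0\<close>
  depend only on the shape.\<close>

lemma Gx_cong_shape: "shape \<epsilon> = shape \<epsilon>' \<Longrightarrow> Gx \<alpha> \<epsilon> = Gx \<alpha> \<epsilon>'"
proof -
  have "Gx \<alpha> \<epsilon> = (\<Prod>x\<in>#mset (shape \<epsilon>). gfun \<alpha> (int x))" for \<epsilon>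
    by (simp add: Gx_def mset_shape vals_def image_mset.compositionality comp_def prod_unfold_prod_mset)
  then show "shape \<epsilon> = shape \<epsilon>' \<Longrightarrow> Gx \<alpha> \<epsilon> = Gx \<alpha> \<epsilon>'" by simp
qed

text \<open>A representative of the orbit labelled by \<open>lam\<close>; coefficients of monomial
  functions are read off here.\<close>

definition expo :: "nat list \<Rightarrow> mono" where
  "expo lam = (\<Sum>i<length lam. single i (lam ! i))"

lemma lookup_expo: "lookup (expo lam) i = (if i < length lam then lam ! i else 0)"
  by (simp add: expo_def lookup_sum lookup_single when_def sum.delta)

lemma shape_expo:
  assumes "is_partition lam"
  shows "shape (expo lam) = lam"
proof (rule partition_eqI[OF shape_partition assms])
  have keys: "keys (expo lam) = {..<length lam}"
  proof -
    have "lam ! i \<noteq> 0" if "i < length lam" for i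
      using assms nth_mem[OF that] by (metis is_partition_def)
    then show ?thesis by (auto simp: in_keys_iff lookup_expo split: if_splits)
  qed
  have "vals (expo lam) = image_mset ((!) lam) (mset_set {..<length lam})"
    unfolding vals_def keys by (rule image_mset_cong) (simp add: lookup_expo)
  also have "\<dots> = mset (map ((!) lam) [0..<length lam])"
    by (simp add: atLeast0LessThan)
  finally show "mset (shape (expo lam)) = mset lam" by (simp add: mset_shape map_nth)
qed

lemma p_sym_Cons:
  assumes "m > 0"
  shows "p_sym (m # lam) \<epsilon> = (\<Sum>i\<in>{i\<in>keys \<epsilon>. m \<le> lookup \<epsilon> i}. p_sym lam (\<epsilon> - single i m))"
  using sf_mult_power_sum[OF assms, of "p_sym lam"] by (simp add: p_sym_def)

lemma p_sym_Nil: "p_sym [] \<epsilon> = (if \<epsilon> = 0 then 1 else 0)"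
  by (simp add: p_sym_def sf_one_def)

lemma diff_single_add: "m \<le> lookup \<epsilon> i \<Longrightarrow> \<epsilon> - single i m + single i m = \<epsilon>"
  for \<epsilon> :: mono
  by (intro poly_mapping_eqI) (auto simp: lookup_add lookup_minus lookup_single when_def)

lemma vals_add_single:
  assumes "i \<notin> keys \<epsilon>" "m > 0"
  shows "vals (\<epsilon> + single i m) = add_mset m (vals \<epsilon>)" "keys (\<epsilon> + single i m) = insert i (keys \<epsilon>)"
proof -
  show keys: "keys (\<epsilon> + single i m) = insert i (keys \<epsilon>)"
    using assms by (auto simp: in_keys_iff lookup_add lookup_single when_def split: if_splits)
  have "image_mset (lookup (\<epsilon> + single i m)) (mset_set (keys \<epsilon>)) = vals \<epsilon>"
    unfolding vals_def using assms
    by (intro image_mset_cong) (auto simp: lookup_add lookup_single when_def)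
  then show "vals (\<epsilon> + single i m) = add_mset m (vals \<epsilon>)"
    using assms by (simp add: vals_def keys lookup_add in_keys_iff)
qed

text \<open>Triangularity with respect to length: each factor adds its part to one exponent and so
  creates at most one new variable. Equal lengths force all factors to use different
  variables.\<close>

lemma p_sym_nonzero:
  assumes "0 \<notin> set lam" "p_sym lam \<epsilon> \<noteq> 0"
  shows "(\<Sum>i\<in>keys \<epsilon>. lookup \<epsilon> i) = sum_list lam \<and> card (keys \<epsilon>) \<le> length lam \<and>
    (card (keys \<epsilon>) = length lam \<longrightarrow> vals \<epsilon> = mset lam)"
  using assms
proof (induction lam arbitrary: \<epsilon>)
  case Nil
  then show ?case by (auto simp: p_sym_Nil vals_def split: if_splits)
next
  case (Cons m lam)
  have m: "m > 0" using Cons.prems by auto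
  obtain i where i: "m \<le> lookup \<epsilon> i" "p_sym lam (\<epsilon> - single i m) \<noteq> 0"
    using Cons.prems(2) unfolding p_sym_Cons[OF m] by (auto dest: sum.not_neutral_contains_not_neutral)
  define \<epsilon>' where "\<epsilon>' = \<epsilon> - single i m"
  have eps: "\<epsilon> = \<epsilon>' + single i m" using i by (simp add: \<epsilon>'_def diff_single_add)
  have IH: "(\<Sum>i\<in>keys \<epsilon>'. lookup \<epsilon>' i) = sum_list lam" "card (keys \<epsilon>') \<le> length lam"
    "card (keys \<epsilon>') = length lam \<Longrightarrow> vals \<epsilon>' = mset lam"
    using Cons.IH[of \<epsilon>'] Cons.prems i by (auto simp: \<epsilon>'_def)
  have "(\<Sum>i\<in>keys \<epsilon>. lookup \<epsilon> i) = sum_list (m # lam)"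
    unfolding eps sum_keys_add_single using IH by simp
  moreover have "card (keys \<epsilon>) \<le> length (m # lam) \<and>
      (card (keys \<epsilon>) = length (m # lam) \<longrightarrow> vals \<epsilon> = mset (m # lam))"
  proof (cases "i \<in> keys \<epsilon>'")
    case True
    then have "keys \<epsilon> = keys \<epsilon>'"
      using m unfolding eps by (auto simp: in_keys_iff lookup_add lookup_single when_def split: if_splits)
    then show ?thesis using IH by simp
  next
    case False
    then show ?thesis using vals_add_single[OF False m] IH unfolding eps by simp
  qed
  ultimately show ?case by blast
qed

text \<open>The coefficients count choices of variables, so nothing cancels and the diagonal
  coefficient is nonzero.\<close>

lemma p_sym_of_nat:
  assumes "0 \<notin> set lam"
  shows "\<exists>k::nat. p_sym lam \<epsilon> = of_nat k \<and> (vals \<epsilon> = mset lam \<longrightarrow> k > 0)"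
  using assms
proof (induction lam arbitrary: \<epsilon>)
  case Nil
  then show ?case
    by (cases "\<epsilon> = 0") (auto simp: p_sym_Nil vals_def mset_set_empty_iff intro: exI[of _ "1::nat"] exI[of _ "0::nat"])
next
  case (Cons m lam)
  have m: "m > 0" using Cons.prems by auto
  from Cons obtain k where k: "\<And>\<epsilon>. p_sym lam \<epsilon> = of_nat (k \<epsilon>)" "\<And>\<epsilon>. vals \<epsilon> = mset lam \<Longrightarrow> k \<epsilon> > 0"
    by (metis list.set_intros(2))
  let ?I = "{i\<in>keys \<epsilon>. m \<le> lookup \<epsilon> i}"
  have "(\<Sum>i\<in>?I. k (\<epsilon> - single i m)) > 0" if v: "vals \<epsilon> = mset (m # lam)"
  proof -
    have "m \<in># vals \<epsilon>" using v by simp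
    then obtain i where i: "i \<in> keys \<epsilon>" "lookup \<epsilon> i = m" by (auto simp: vals_def)
    let ?e = "\<epsilon> - single i m"
    have eps: "?e + single i m = \<epsilon>" using i by (simp add: diff_single_add)
    have "i \<notin> keys ?e" using i by (simp add: in_keys_iff lookup_minus)
    then have "vals ?e = mset lam"
      using vals_add_single(1)[of i ?e m] m v unfolding eps by simp
    then have "k ?e > 0" by (rule k)
    then show ?thesis using i by (intro sum_pos2[of _ i]) auto
  qed
  then show ?case
    unfolding p_sym_Cons[OF m] by (intro exI[of _ "\<Sum>i\<in>?I. k (\<epsilon> - single i m)"]) (simp add: k)
qed

lemma finite_partitions: "finite {nu. is_partition nu \<and> sum_list nu \<le> N}"
proof -
  have len: "0 \<notin> set nu \<Longrightarrow> length nu \<le> sum_list nu" for nu :: "nat list"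
    by (induction nu) (auto simp: Suc_le_eq)
  have "{nu. is_partition nu \<and> sum_list nu \<le> N} \<subseteq> {nu. set nu \<subseteq> {..N} \<and> length nu \<le> N}"
    using len member_le_sum_list by (fastforce simp: is_partition_def)
  then show ?thesis by (rule finite_subset) (rule finite_lists_length_le, simp)
qed

lemma T0_add: "T0 \<alpha> (u + v) \<epsilon> = T0 \<alpha> u \<epsilon> + T0 \<alpha> v \<epsilon>"
  by (simp add: T0_def ip_add_left)

lemma T0_diff: "T0 \<alpha> (u - v) \<epsilon> = T0 \<alpha> u \<epsilon> - T0 \<alpha> v \<epsilon>"
  by (simp add: T0_def ip_diff_left)

lemma T0_sum: "T0 \<alpha> (sum f A) \<epsilon> = (\<Sum>x\<in>A. T0 \<alpha> (f x) \<epsilon>)"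
  by (simp add: T0_def ip_sum_left)

lemma T0_const_mult: "T0 \<alpha> (const c * u) \<epsilon> = c * T0 \<alpha> u \<epsilon>"
  by (simp add: T0_def ip_const_mult_left)

lemma T0_eqD: "\<alpha> > 0 \<Longrightarrow> T0 \<alpha> u = T0 \<alpha> v \<Longrightarrow> u = v"
  using T0_inj[of \<alpha> "u - v"] by (simp add: T0_diff)

text \<open>Inverts the triangular expansion of power sums into monomial functions, by induction on
  the length.\<close>

lemma m_sym_in_range_T0:
  assumes "\<alpha> > 0" "is_partition lam"
  shows "\<exists>u. T0 \<alpha> u = m_sym lam"
  using assms(2)
proof (induction "length lam" arbitrary: lam rule: less_induct)
  case less
  have 0: "0 \<notin> set lam" using less.prems by (simp add: is_partition_def)
  \<comment> \<open>Besides \<open>lam\<close> itself, only these shapes can occur in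
    \<open>p_sym lam\<close>, by \<open>p_sym_nonzero\<close>.\<close>
  define B where "B = {nu. is_partition nu \<and> sum_list nu = sum_list lam \<and> length nu < length lam}"
  have "finite B"
    by (rule finite_subset[OF _ finite_partitions[of "sum_list lam"]]) (auto simp: B_def)
  obtain U where U: "T0 \<alpha> (U nu) = m_sym nu" if "nu \<in> B" for nu
    using less.hyps unfolding B_def mem_Collect_eq by metis
  define c where "c = p_sym lam (expo lam)"
  have "c \<noteq> 0"
    using p_sym_of_nat[OF 0, of "expo lam"] shape_expo[OF less.prems]
    by (auto simp: c_def simp flip: mset_shape)
  define u0 where "u0 = (single (h_exponent lam) 1 :: V0)"
  have u0: "T0 \<alpha> u0 \<epsilon> = p_sym lam \<epsilon>" for \<epsilon>
    unfolding u0_def T0_def by (rule p_sym_eq[OF assms(1) 0, symmetric])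
  have cong: "p_sym lam (expo nu) = p_sym lam \<epsilon>" if "shape \<epsilon> = nu" for nu \<epsilon>
    using Gx_cong_shape[of "expo nu" \<epsilon> \<alpha>] that shape_expo shape_partition
    by (metis T0_def u0)
  define u where "u = const (1 / c) * (u0 - (\<Sum>nu\<in>B. const (p_sym lam (expo nu)) * U nu))"
  have "T0 \<alpha> u \<epsilon> = m_sym lam \<epsilon>" for \<epsilon>
  proof -
    have "T0 \<alpha> u \<epsilon> = 1 / c * (p_sym lam \<epsilon> - (\<Sum>nu\<in>B. p_sym lam (expo nu) * m_sym nu \<epsilon>))"
      by (simp add: u_def T0_const_mult T0_diff T0_sum u0 U)
    also have "(\<Sum>nu\<in>B. p_sym lam (expo nu) * m_sym nu \<epsilon>) =
        (\<Sum>nu\<in>B. if nu = shape \<epsilon> then p_sym lam \<epsilon> else 0)"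
      by (intro sum.cong refl) (auto simp: B_def m_sym_eq cong)
    also have "\<dots> = (if shape \<epsilon> \<in> B then p_sym lam \<epsilon> else 0)"
      using \<open>finite B\<close> by (simp add: sum.delta)
    also have "1 / c * (p_sym lam \<epsilon> - \<dots>) = m_sym lam \<epsilon>"
    proof (cases "p_sym lam \<epsilon> = 0")
      case True
      then have "shape \<epsilon> \<noteq> lam" using \<open>c \<noteq> 0\<close> cong c_def by metis
      then show ?thesis using True less.prems by (simp add: m_sym_eq)
    next
      case False
      note n = p_sym_nonzero[OF 0 False]
      show ?thesis
      proof (cases "shape \<epsilon> \<in> B")
        case True
        then have "shape \<epsilon> \<noteq> lam" by (auto simp: B_def)
        then show ?thesis using True less.prems by (simp add: m_sym_eq)
      next
        case False
        then have "card (keys \<epsilon>) = length lam"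
          using n by (auto simp: B_def shape_partition sum_list_shape length_shape)
        then have "shape \<epsilon> = lam"
          using n less.prems by (intro partition_eqI) (auto simp: shape_partition mset_shape)
        then show ?thesis using \<open>c \<noteq> 0\<close> False less.prems
          by (simp add: m_sym_eq) (metis c_def cong)
      qed
    qed
    finally show ?thesis .
  qed
  then show ?case by blast
qed

lemma T0_bounded_degree: "\<alpha> > 0 \<Longrightarrow> \<exists>N. \<forall>\<epsilon>. T0 \<alpha> u \<epsilon> \<noteq> 0 \<longrightarrow> sum_list (shape \<epsilon>) \<le> N"
proof (induction u rule: mpoly_induct)
  case (single a c)
  obtain lam where lam: "0 \<notin> set lam" "h_exponent lam = a" using h_exponent_surj by blast
  have "T0 \<alpha> (single a c) \<epsilon> = c * p_sym lam \<epsilon>" for \<epsilon>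
    using p_sym_eq[OF single lam(1)] T0_const_mult[of \<alpha> c "single a 1"]
    by (simp add: lam(2) T0_def mult_single)
  then show ?case using p_sym_nonzero[OF lam(1)] by (auto simp: sum_list_shape)
next
  case (add p q)
  then obtain M N where "\<forall>\<epsilon>. T0 \<alpha> p \<epsilon> \<noteq> 0 \<longrightarrow> sum_list (shape \<epsilon>) \<le> M"
    "\<forall>\<epsilon>. T0 \<alpha> q \<epsilon> \<noteq> 0 \<longrightarrow> sum_list (shape \<epsilon>) \<le> N" by blast
  then have "\<forall>\<epsilon>. T0 \<alpha> (p + q) \<epsilon> \<noteq> 0 \<longrightarrow> sum_list (shape \<epsilon>) \<le> max M N"
    by (metis T0_add add_0 max.coboundedI1 max.coboundedI2)
  then show ?case by blast
qed

text \<open>The image of \<open>u\<close> is symmetric and of bounded degree, so finitely many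
  monomial functions suffice.\<close>

lemma m_expansion:
  assumes "\<alpha> > 0" and mm: "\<And>nu. is_partition nu \<Longrightarrow> T0 \<alpha> (mm nu) = m_sym nu"
  shows "\<exists>N. u = (\<Sum>nu\<in>{nu. is_partition nu \<and> sum_list nu \<le> N}. const (T0 \<alpha> u (expo nu)) * mm nu)"
proof -
  obtain N where N: "T0 \<alpha> u \<epsilon> \<noteq> 0 \<Longrightarrow> sum_list (shape \<epsilon>) \<le> N" for \<epsilon>
    using T0_bounded_degree[OF assms(1)] by blast
  let ?B = "{nu. is_partition nu \<and> sum_list nu \<le> N}"
  have "T0 \<alpha> u \<epsilon> = T0 \<alpha> (\<Sum>nu\<in>?B. const (T0 \<alpha> u (expo nu)) * mm nu) \<epsilon>" for \<epsilon>
  proof -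
    have "T0 \<alpha> (\<Sum>nu\<in>?B. const (T0 \<alpha> u (expo nu)) * mm nu) \<epsilon> =
        (\<Sum>nu\<in>?B. if nu = shape \<epsilon> then T0 \<alpha> u (expo (shape \<epsilon>)) else 0)"
      unfolding T0_sum T0_const_mult by (intro sum.cong refl) (auto simp: mm m_sym_eq)
    also have "T0 \<alpha> u (expo (shape \<epsilon>)) = T0 \<alpha> u \<epsilon>"
      unfolding T0_def by (subst Gx_cong_shape[of _ \<epsilon>]) (simp_all add: shape_expo shape_partition)
    also have "(\<Sum>nu\<in>?B. if nu = shape \<epsilon> then T0 \<alpha> u \<epsilon> else 0) = T0 \<alpha> u \<epsilon>"
      using finite_partitions[of N] N[of \<epsilon>] by (auto simp: sum.delta shape_partition)
    finally show ?thesis by simp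
  qed
  then show ?thesis using T0_eqD[OF assms(1)] by blast
qed

section \<open>The dominance order and the characterization of the dual Jack function\<close>

lemma dominates_refl: "dominates lam lam"
  by (simp add: dominates_def)

lemma dominates_trans: "dominates a b \<Longrightarrow> dominates b c \<Longrightarrow> dominates a c"
  by (auto simp: dominates_def intro: order.trans)

lemma dominates_antisym:
  assumes "is_partition a" "is_partition b" "dominates a b" "dominates b a"
  shows "a = b"
proof -
  have eq: "sum_list (take i a) = sum_list (take i b)" for i
    using assms(3,4) by (auto simp: dominates_def intro: antisym)
  have len: "length b \<le> length a" if "is_partition b" "\<And>i. sum_list (take i a) = sum_list (take i b)"
    for a b :: "nat list"
  proof (rule ccontr)
    assume "\<not> length b \<le> length a"
    then have l: "length a < length b" by simp
    then have "sum_list (take (Suc (length a)) b) = sum_list (take (length a) b) + b ! length a"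
      by (simp add: take_Suc_conv_app_nth)
    moreover have "sum_list (take (Suc (length a)) b) = sum_list (take (length a) b)"
      using that(2)[of "Suc (length a)"] that(2)[of "length a"] by simp
    ultimately have "b ! length a = 0" by simp
    then show False using l that(1) nth_mem[OF l] by (metis is_partition_def)
  qed
  have l: "length a = length b" using len[of b a] len[of a b] assms(1,2) eq by (simp add: le_antisym)
  show ?thesis
  proof (rule nth_equalityI[OF l])
    fix i assume i: "i < length a"
    then have "sum_list (take (Suc i) a) = sum_list (take i a) + a ! i"
      by (simp add: take_Suc_conv_app_nth)
    moreover have "sum_list (take (Suc i) b) = sum_list (take i b) + b ! i"
      using i l by (simp add: take_Suc_conv_app_nth)
    ultimately show "a ! i = b ! i" using eq[of i] eq[of "Suc i"] by simp
  qed
qed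

lemma dominates_parts_le:
  assumes "dominates mu nu" "is_partition nu" "\<And>x. x \<in> set mu \<Longrightarrow> x \<le> K" "x \<in> set nu"
  shows "x \<le> K"
proof -
  obtain y ys where nu: "nu = y # ys" using assms(4) by (cases nu) auto
  have "x \<le> y" using assms(2,4) by (auto simp: nu is_partition_def)
  also have "y \<le> sum_list (take 1 mu)"
    using assms(1) unfolding dominates_def nu by (metis One_nat_def sum_list_simps(2) take0 take_Suc_Cons add.right_neutral sum_list.Nil)
  also have "\<dots> \<le> K" using assms(3) by (cases mu) (auto simp: One_nat_def)
  finally show ?thesis .
qed

text \<open>The first \<open>n\<close> parts of \<open>mu\<close> already exhaust its size, so the
  same holds for \<open>nu\<close>, and no positive part can follow.\<close>

lemma dominates_length_le:
  assumes "dominates nu mu" "is_partition nu" "length mu \<le> n"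
  shows "length nu \<le> n"
proof (rule ccontr)
  assume "\<not> length nu \<le> n"
  then have l: "n < length nu" by simp
  have "sum_list mu = sum_list (take n mu)" using assms(3) by simp
  also have "\<dots> \<le> sum_list (take n nu)" using assms(1) by (simp add: dominates_def)
  finally have "sum_list nu \<le> sum_list (take n nu)" using assms(1) by (simp add: dominates_def)
  moreover have "sum_list nu = sum_list (take n nu) + sum_list (drop n nu)"
    by (simp flip: sum_list_append)
  ultimately have "sum_list (drop n nu) = 0" by simp
  moreover have "nu ! n \<in> set (drop n nu)" using l by (metis Cons_nth_drop_Suc list.set_intros(1))
  ultimately have "nu ! n = 0" by (simp add: sum_list_eq_0_iff)
  then show False using nth_mem[OF l] assms(2) by (metis is_partition_def)
qed

lemma finite_dominated: "finite {mu. is_partition mu \<and> dominates lam mu}"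
  by (rule finite_subset[OF _ finite_partitions[of "sum_list lam"]]) (auto simp: dominates_def)

lemma dominance_induct [consumes 1, case_names less]:
  assumes "is_partition lam"
    and "\<And>lam. is_partition lam \<Longrightarrow>
      (\<And>mu. is_partition mu \<Longrightarrow> dominates lam mu \<Longrightarrow> mu \<noteq> lam \<Longrightarrow> Q mu) \<Longrightarrow> Q lam"
  shows "Q lam"
  using assms(1)
proof (induction "card {mu. is_partition mu \<and> dominates lam mu}" arbitrary: lam rule: less_induct)
  case less
  show ?case
  proof (rule assms(2)[OF less.prems])
    fix mu assume mu: "is_partition mu" "dominates lam mu" "mu \<noteq> lam"
    have "{nu. is_partition nu \<and> dominates mu nu} \<subset> {nu. is_partition nu \<and> dominates lam nu}"
      using mu less.prems dominates_trans dominates_antisym dominates_refl by blast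
    then show "Q mu"
      using less.hyps mu(1) psubset_card_mono[OF finite_dominated] by blast
  qed
qed

lemma P_value:
  assumes "c lam = 1" "is_partition lam"
    and "P = (\<lambda>e. \<Sum>mu\<in>{mu. is_partition mu \<and> dominates lam mu}. c mu * m_sym mu e)"
  shows "P \<epsilon> = (if dominates lam (shape \<epsilon>) then c (shape \<epsilon>) else (0 :: complex))"
proof -
  have "P \<epsilon> = (\<Sum>mu\<in>{mu. is_partition mu \<and> dominates lam mu}. if mu = shape \<epsilon> then c mu else 0)"
    unfolding assms(3) by (intro sum.cong refl) (auto simp: m_sym_eq)
  then show ?thesis by (simp add: sum.delta finite_dominated shape_partition)
qed

lemma jack_value:
  assumes "is_jack_family \<alpha> P" "is_partition lam"
  shows "P lam \<epsilon> \<noteq> 0 \<Longrightarrow> dominates lam (shape \<epsilon>)"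
    and "shape \<epsilon> = lam \<Longrightarrow> P lam \<epsilon> = 1"
proof -
  obtain c where "c lam = 1"
    "P lam = (\<lambda>e. \<Sum>mu\<in>{mu. is_partition mu \<and> dominates lam mu}. c mu * m_sym mu e)"
    using assms unfolding is_jack_family_def by blast
  from P_value[OF this(1) assms(2) this(2), of \<epsilon>] \<open>c lam = 1\<close>
  show "P lam \<epsilon> \<noteq> 0 \<Longrightarrow> dominates lam (shape \<epsilon>)" "shape \<epsilon> = lam \<Longrightarrow> P lam \<epsilon> = 1"
    by (auto simp: dominates_refl split: if_splits)
qed

text \<open>The Jack functions form an orthogonal basis, so \<open>F\<close> is determined by its
  products with them. Those with a part above \<open>K\<close> are orthogonal to \<open>F\<close> by
  \<open>parts\<close>: \<open>F\<close> is a combination of monomial functions with parts at most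
  \<open>K\<close>, and these involve only Jack functions lower in dominance, whose parts are at
  most \<open>K\<close> too.\<close>

theorem jack_Q_characterization:
  assumes "\<alpha> > 0" "is_jack_family \<alpha> P" "is_partition lam"
    and parts: "\<And>\<epsilon> i. T0 \<alpha> F \<epsilon> \<noteq> 0 \<Longrightarrow> lookup \<epsilon> i \<le> K"
    and orth: "\<And>nu u. is_partition nu \<Longrightarrow> nu \<noteq> lam \<Longrightarrow> (\<And>x. x \<in> set nu \<Longrightarrow> x \<le> K) \<Longrightarrow>
      T0 \<alpha> u = P nu \<Longrightarrow> ip \<alpha> F u = 0"
    and norm: "\<And>u. T0 \<alpha> u = P lam \<Longrightarrow> ip \<alpha> F u = c"
  shows "T0 \<alpha> F = (\<lambda>e. c * jack_Q \<alpha> P lam e)"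
proof -
  obtain mm where mm: "\<And>nu. is_partition nu \<Longrightarrow> T0 \<alpha> (mm nu) = m_sym nu"
    using m_sym_in_range_T0[OF assms(1)] by metis
  define Q where "Q nu c \<longleftrightarrow> c nu = 1 \<and>
    P nu = (\<lambda>e. \<Sum>mu\<in>{mu. is_partition mu \<and> dominates nu mu}. c mu * m_sym mu e)" for nu c
  have "\<forall>nu. \<exists>c. is_partition nu \<longrightarrow> Q nu c"
    using assms(2) unfolding is_jack_family_def Q_def by blast
  then obtain cc where "\<forall>nu. is_partition nu \<longrightarrow> Q nu (cc nu)"
    using choice[of "\<lambda>nu c. is_partition nu \<longrightarrow> Q nu c"] by blast
  then have cc: "\<And>nu. is_partition nu \<Longrightarrow> cc nu nu = 1"
    "\<And>nu. is_partition nu \<Longrightarrow>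
      P nu = (\<lambda>e. \<Sum>mu\<in>{mu. is_partition mu \<and> dominates nu mu}. cc nu mu * m_sym mu e)"
    by (simp_all add: Q_def)
  define PP where "PP nu = (\<Sum>mu\<in>{mu. is_partition mu \<and> dominates nu mu}. const (cc nu mu) * mm mu)" for nu
  have PP: "T0 \<alpha> (PP nu) = P nu" if "is_partition nu" for nu
  proof
    fix \<epsilon>
    have "T0 \<alpha> (PP nu) \<epsilon> = (\<Sum>mu\<in>{mu. is_partition mu \<and> dominates nu mu}. cc nu mu * m_sym mu \<epsilon>)"
      unfolding PP_def T0_sum T0_const_mult by (intro sum.cong refl) (simp add: mm)
    then show "T0 \<alpha> (PP nu) \<epsilon> = P nu \<epsilon>" by (simp only: cc(2)[OF that])
  qed
  have PP_orth: "ip \<alpha> (PP mu) (PP nu) = 0" if "is_partition mu" "is_partition nu" "mu \<noteq> nu" for mu nu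
    using assms(2) that jack_inner_T0[OF assms(1), of "PP mu" "PP nu"]
    unfolding is_jack_family_def by (auto simp: PP)
  have PP_rec: "PP nu = mm nu + (\<Sum>mu\<in>{mu. is_partition mu \<and> dominates nu mu} - {nu}. const (cc nu mu) * mm mu)"
    if "is_partition nu" for nu
    unfolding PP_def using that cc(1)[OF that]
    by (subst sum.remove[of _ nu]) (auto simp: finite_dominated dominates_refl)
  \<comment> \<open>Inverse unitriangularity, phrased through products: \<open>m_sym mu\<close> is a
    combination of the Jack functions below \<open>mu\<close>.\<close>
  have mm_orth: "ip \<alpha> (mm mu) w = 0"
    if "is_partition mu" "\<And>kappa. is_partition kappa \<Longrightarrow> dominates mu kappa \<Longrightarrow> ip \<alpha> (PP kappa) w = 0" for mu w
    using that
  proof (induction mu rule: dominance_induct)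
    case (less mu)
    have "ip \<alpha> (mm kappa) w = 0" if "kappa \<in> {mu'. is_partition mu' \<and> dominates mu mu'} - {mu}" for kappa
      using that less.IH[of kappa] less.prems by (auto intro: dominates_trans)
    then have "ip \<alpha> (PP mu) w = ip \<alpha> (mm mu) w"
      by (subst PP_rec[OF less.hyps]) (simp add: ip_add_left ip_sum_left ip_const_mult_left)
    then show ?case using less.prems less.hyps dominates_refl by simp
  qed
  have nondeg: "w = 0" if w: "\<And>kappa. is_partition kappa \<Longrightarrow> ip \<alpha> (PP kappa) w = 0" for w
  proof -
    have "ip \<alpha> u w = 0" for u
    proof -
      obtain N where "u = (\<Sum>nu\<in>{nu. is_partition nu \<and> sum_list nu \<le> N}. const (T0 \<alpha> u (expo nu)) * mm nu)"
        using m_expansion[OF assms(1) mm, of u] by blast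
      then have "ip \<alpha> u w = (\<Sum>nu\<in>{nu. is_partition nu \<and> sum_list nu \<le> N}. T0 \<alpha> u (expo nu) * ip \<alpha> (mm nu) w)"
        by (metis (no_types, lifting) ip_sum_left ip_const_mult_left sum.cong)
      also have "\<dots> = 0" using mm_orth w by (intro sum.neutral) auto
      finally show ?thesis .
    qed
    then have "T0 \<alpha> w \<epsilon> = 0" for \<epsilon> by (simp add: T0_def ip_commute[of _ w])
    then show ?thesis by (rule T0_inj[OF assms(1)])
  qed
  have F_orth: "ip \<alpha> F (PP nu) = 0" if nu: "is_partition nu" "nu \<noteq> lam" for nu
  proof (cases "\<forall>x\<in>set nu. x \<le> K")
    case True
    then show ?thesis using orth[OF nu _ PP] nu by blast
  next
    case False
    obtain N where N: "F = (\<Sum>mu\<in>{mu. is_partition mu \<and> sum_list mu \<le> N}. const (T0 \<alpha> F (expo mu)) * mm mu)"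
      using m_expansion[OF assms(1) mm, of F] by blast
    have "T0 \<alpha> F (expo mu) * ip \<alpha> (mm mu) (PP nu) = 0" if mu: "is_partition mu" for mu
    proof (cases "T0 \<alpha> F (expo mu) = 0")
      case nz: False
      have le: "x \<le> K" if "x \<in> set mu" for x
        using parts[OF nz] that by (auto simp: in_set_conv_nth lookup_expo) metis
      have "ip \<alpha> (mm mu) (PP nu) = 0"
      proof (rule mm_orth[OF mu])
        fix kappa assume "is_partition kappa" "dominates mu kappa"
        moreover from this have "\<forall>x\<in>set kappa. x \<le> K" using dominates_parts_le le by blast
        ultimately show "ip \<alpha> (PP kappa) (PP nu) = 0" using PP_orth nu False by blast
      qed
      then show ?thesis by simp
    qed simp
    then have "(\<Sum>mu\<in>{mu. is_partition mu \<and> sum_list mu \<le> N}. T0 \<alpha> F (expo mu) * ip \<alpha> (mm mu) (PP nu)) = 0"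
      by (intro sum.neutral) auto
    then show ?thesis
      by (subst N) (simp add: ip_sum_left ip_const_mult_left)
  qed
  define b where "b = ip \<alpha> (PP lam) (PP lam)"
  have "b \<noteq> 0"
  proof
    assume "b = 0"
    then have "PP lam = 0"
      using PP_orth assms(3) by (intro nondeg) (metis b_def)
    then have "P lam (expo lam) = 0" using PP[OF assms(3)] by (metis T0_def ip_0_left)
    then show False using jack_value(2)[OF assms(2,3) shape_expo[OF assms(3)]] by simp
  qed
  have "F - const (c / b) * PP lam = 0"
  proof (rule nondeg)
    fix kappa assume k: "is_partition kappa"
    have "ip \<alpha> (PP kappa) (F - const (c / b) * PP lam) =
        ip \<alpha> F (PP kappa) - c / b * ip \<alpha> (PP lam) (PP kappa)"
      by (simp add: ip_commute[of _ "PP kappa"] ip_diff_left ip_const_mult_left)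
    also have "\<dots> = 0"
      using F_orth[OF k] PP_orth[OF assms(3) k] norm[OF PP[OF assms(3)]] \<open>b \<noteq> 0\<close>
      by (cases "kappa = lam") (auto simp: b_def)
    finally show "ip \<alpha> (PP kappa) (F - const (c / b) * PP lam) = 0" .
  qed
  then have F: "F = const (c / b) * PP lam" by simp
  have "jack_inner \<alpha> (P lam) (P lam) = b"
    using jack_inner_T0[OF assms(1), of "PP lam" "PP lam"] PP[OF assms(3)] by (simp add: b_def)
  then show ?thesis
    unfolding F using PP[OF assms(3)] by (simp add: fun_eq_iff T0_const_mult jack_Q_def)
qed

section \<open>Dyson's constant term\<close>

section \<open>Constant terms\<close>

text \<open>Lagrange interpolation of the constant \<open>D\<close> at the nodes \<open>x i\<close>,
  evaluated at 0. To avoid division, \<open>E i\<close> plays the role of \<open>D\<close> divided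
  by the product of the \<open>x j - x i\<close>.\<close>

lemma lagrange_at_0:
  fixes x :: "'i \<Rightarrow> 'a::idom"
  assumes "finite A" "A \<noteq> {}" "inj_on x A"
    and E: "\<And>i. i \<in> A \<Longrightarrow> E i * (\<Prod>j\<in>A - {i}. x j - x i) = D"
  shows "(\<Sum>i\<in>A. E i * (\<Prod>j\<in>A - {i}. x j)) = D"
proof -
  define G where "G = (\<Sum>i\<in>A. smult (E i) (\<Prod>j\<in>A - {i}. [:x j, -1:]))"
  have poly_G: "poly G y = (\<Sum>i\<in>A. E i * (\<Prod>j\<in>A - {i}. x j - y))" for y
    by (simp add: G_def poly_sum poly_prod)
  have "degree (\<Prod>j\<in>A - {i}. [:x j, -1:]) \<le> card A - 1" if "i \<in> A" for i
  proof -
    have "degree (\<Prod>j\<in>A - {i}. [:x j, -1:]) \<le> (\<Sum>j\<in>A - {i}. degree [:x j, -1:])"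
      using assms(1) by (intro degree_prod_sum_le[unfolded o_def]) auto
    also have "\<dots> \<le> card (A - {i}) * 1"
      by (rule order.trans[OF sum_bounded_above[of _ _ 1]]) auto
    finally show ?thesis using that assms(1) by simp
  qed
  then have "degree G \<le> card A - 1"
    unfolding G_def by (intro degree_sum_le) (auto intro: order.trans[OF degree_smult_le] assms(1))
  moreover have "card A > 0" using assms(1,2) by (simp add: card_gt_0_iff)
  ultimately have deg: "degree G < card (x ` A)" using assms(3) by (simp add: card_image)
  have "poly G (x m) = poly [:D:] (x m)" if m: "m \<in> A" for m
  proof -
    have "E i * (\<Prod>j\<in>A - {i}. x j - x m) = (if i = m then D else 0)" if i: "i \<in> A" for i
    proof (cases "i = m")
      case False
      then have "(\<Prod>j\<in>A - {i}. x j - x m) = 0"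
        using m assms(1) by (intro prod_zero bexI[of _ m]) auto
      then show ?thesis using False by simp
    qed (use E m in auto)
    then show ?thesis using assms(1) m by (simp add: poly_G sum.delta)
  qed
  then have "G = [:D:]"
    using deg by (intro poly_eqI_degree[of "x ` A"]) auto
  then show ?thesis using poly_G[of 0] by simp
qed

text \<open>The Dyson product of the \<open>(1 - w_i / w_j)^(a i)\<close> with denominators cleared.
  The clearing monomial has exponent \<open>dyson_exp A a\<close>, so the constant term becomes the
  coefficient there.\<close>

definition dyson :: "nat set \<Rightarrow> (nat \<Rightarrow> nat) \<Rightarrow> mono \<Rightarrow>\<^sub>0 int" where
  "dyson A a = (\<Prod>i\<in>A. \<Prod>j\<in>A - {i}. (var j - var i) ^ a i)"

definition dyson_exp :: "nat set \<Rightarrow> (nat \<Rightarrow> nat) \<Rightarrow> mono" where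
  "dyson_exp A a = (\<Sum>j\<in>A. single j (sum a A - a j))"

lemma var_eq_iff: "var i = (var j :: mono \<Rightarrow>\<^sub>0 int) \<longleftrightarrow> i = j"
proof
  assume "var i = (var j :: mono \<Rightarrow>\<^sub>0 int)"
  then have "single i 1 = (single j 1 :: mono)"
    by (metis lookup_single_eq lookup_single_not_eq zero_neq_one)
  then show "i = j" by (metis lookup_single_eq lookup_single_not_eq zero_neq_one)
qed simp

text \<open>As a polynomial in \<open>w_i\<close> the product is monic of degree
  \<open>sum a B\<close>, and \<open>Q\<close> is free of \<open>w_i\<close>; so \<open>Q\<close> is
  the leading coefficient.\<close>

lemma lookup_leading:
  fixes Q :: "mono \<Rightarrow>\<^sub>0 int"
  assumes "finite B" "i \<notin> B" "\<And>f. f \<in> keys Q \<Longrightarrow> lookup f i = 0"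
  shows "lookup (Q * (\<Prod>j\<in>B. (var i - var j) ^ a j)) (single i (sum a B) + e) = lookup Q e"
proof -
  \<comment> \<open>\<open>Ld s P\<close> says that \<open>P\<close> is monic of degree
    \<open>s\<close> in the variable \<open>i\<close>.\<close>
  define Ld where "Ld s P \<longleftrightarrow> (\<exists>R. P = var i ^ s + R \<and> (\<forall>e\<in>keys R. lookup e i < s))"
    for s and P :: "mono \<Rightarrow>\<^sub>0 int"
  have var_pow: "var i ^ s = (single (single i s) 1 :: mono \<Rightarrow>\<^sub>0 int)" for s
    by (simp add: single_power of_nat_mult_single_mono)
  have Ld_mult: "Ld (s + s') (P * P')" if "Ld s P" "Ld s' P'" for s s' P P'
  proof -
    obtain R R' where R: "P = var i ^ s + R" "P' = var i ^ s' + R'"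
      "\<forall>e\<in>keys R. lookup e i < s" "\<forall>e\<in>keys R'. lookup e i < s'"
      using \<open>Ld s P\<close> \<open>Ld s' P'\<close> by (auto simp: Ld_def)
    define S where "S = var i ^ s * R' + R * var i ^ s' + R * R'"
    have "P * P' = var i ^ (s + s') + S"
      by (simp add: R S_def algebra_simps power_add)
    moreover have "\<forall>e\<in>keys S. lookup e i < s + s'"
    proof
      fix e assume "e \<in> keys S"
      then consider "e \<in> keys (var i ^ s * R')" | "e \<in> keys (R * var i ^ s')" | "e \<in> keys (R * R')"
        unfolding S_def
        using keys_add[of "var i ^ s * R' + R * var i ^ s'" "R * R'"]
          keys_add[of "var i ^ s * R'" "R * var i ^ s'"] by blast
      then show "lookup e i < s + s'"
      proof cases
        case 1
        then obtain f where "f \<in> keys R'" "e = single i s + f"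
          using keys_mult[of "var i ^ s" R'] by (auto simp: var_pow)
        then show ?thesis using R(4) by (simp add: lookup_add)
      next
        case 2
        then obtain f where "f \<in> keys R" "e = f + single i s'"
          using keys_mult[of R "var i ^ s'"] by (auto simp: var_pow)
        then show ?thesis using R(3) by (simp add: lookup_add)
      next
        case 3
        then obtain f f' where "f \<in> keys R" "f' \<in> keys R'" "e = f + f'"
          using keys_mult[of R R'] by auto
        then show ?thesis using R(3,4) by (simp add: lookup_add add_strict_mono)
      qed
    qed
    ultimately show ?thesis unfolding Ld_def by blast
  qed
  have Ld_0: "Ld 0 1" unfolding Ld_def by (intro exI[of _ 0]) auto
  have Ld_1: "Ld 1 (var i - var j)" if "j \<noteq> i" for j
    unfolding Ld_def using that by (intro exI[of _ "- var j"]) (auto simp: lookup_single)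
  have Ld_pow: "Ld m ((var i - var j) ^ m)" if "j \<noteq> i" for j m
  proof (induction m)
    case (Suc m)
    then show ?case using Ld_mult[OF Ld_1[OF that] Suc] by (simp add: plus_1_eq_Suc)
  qed (simp add: Ld_0)
  have "Ld (sum a B) (\<Prod>j\<in>B. (var i - var j) ^ a j)"
    using assms(1,2)
  proof (induction B rule: finite_induct)
    case (insert b B)
    then show ?case by (simp add: Ld_mult Ld_pow)
  qed (simp add: Ld_0)
  then obtain R :: "mono \<Rightarrow>\<^sub>0 int"
    where R: "(\<Prod>j\<in>B. (var i - var j) ^ a j) = var i ^ sum a B + R"
    "\<forall>e\<in>keys R. lookup e i < sum a B" by (auto simp: Ld_def)
  have "lookup (Q * R) (single i (sum a B) + e) = 0"
  proof (rule ccontr)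
    assume "lookup (Q * R) (single i (sum a B) + e) \<noteq> 0"
    then have "single i (sum a B) + e \<in> keys (Q * R)" by (simp add: in_keys_iff)
    then obtain f f' where "f \<in> keys Q" "f' \<in> keys R" "single i (sum a B) + e = f + f'"
      using keys_mult[of Q R] by blast
    moreover from this have "sum a B \<le> lookup f i + lookup f' i"
      by (metis le_add1 lookup_add lookup_single_eq)
    ultimately show False using R(2) assms(3) by fastforce
  qed
  moreover have "lookup (var i ^ sum a B * Q) (single i (sum a B) + e) = lookup Q e"
    by (simp only: var_pow lookup_single_mult mult_1)
  ultimately show ?thesis by (simp add: R(1) distrib_left lookup_add mult.commute)
qed

lemma keys_dyson: "f \<in> keys (dyson A a) \<Longrightarrow> i \<notin> A \<Longrightarrow> lookup f i = 0"
proof -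
  define Fr where "Fr P \<longleftrightarrow> (\<forall>f\<in>keys P. lookup f i = 0)" for P :: "mono \<Rightarrow>\<^sub>0 int"
  have one: "Fr 1" by (simp add: Fr_def)
  have mult: "Fr P \<Longrightarrow> Fr Q \<Longrightarrow> Fr (P * Q)" for P Q
    using keys_mult[of P Q] by (fastforce simp: Fr_def lookup_add)
  have pow: "Fr P \<Longrightarrow> Fr (P ^ m)" for P m by (induction m) (auto simp: one mult)
  have prod: "(\<And>x. x \<in> B \<Longrightarrow> Fr (h x)) \<Longrightarrow> Fr (prod h B)" for h and B :: "nat set"
    by (induction B rule: infinite_finite_induct) (auto simp: one mult)
  have diff: "Fr (var j - var l)" if "j \<noteq> i" "l \<noteq> i" for j l
    using keys_diff[of "var j :: mono \<Rightarrow>\<^sub>0 int" "var l"] that by (auto simp: Fr_def lookup_single)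
  assume "f \<in> keys (dyson A a)" "i \<notin> A"
  moreover from this have "Fr (dyson A a)"
    unfolding dyson_def by (intro prod pow diff) auto
  ultimately show ?thesis by (simp add: Fr_def)
qed

text \<open>Good's proof: Lagrange interpolation gives a recursion that lowers the exponents one at a
  time, and a variable with exponent \<open>0\<close> can be removed.\<close>

lemma dyson_constant_term:
  "finite A \<Longrightarrow> lookup (dyson A a) (dyson_exp A a) * (\<Prod>i\<in>A. fact (a i)) = fact (sum a A)"
proof (induction "\<Sum>i\<in>A. a i + 1" arbitrary: A a rule: less_induct)
  case less
  consider "A = {}" | i where "i \<in> A" "a i = 0" | "A \<noteq> {}" "\<forall>i\<in>A. a i > 0" by blast
  then show ?case
  proof cases
    case 1
    then show ?thesis by (simp add: dyson_def dyson_exp_def)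
  next
    case 2
    let ?B = "A - {i}"
    have A: "A = insert i ?B" "finite ?B" "i \<notin> ?B" using 2 less.prems by auto
    have sum: "sum a A = sum a ?B" using 2 less.prems by (simp add: sum.remove[of A i])
    have "dyson A a = (\<Prod>j\<in>?B. \<Prod>l\<in>A - {j}. (var l - var j) ^ a j)"
      unfolding dyson_def using 2 less.prems by (simp add: prod.remove[of A i])
    also have "\<dots> = (\<Prod>j\<in>?B. (var i - var j) ^ a j * (\<Prod>l\<in>?B - {j}. (var l - var j) ^ a j))"
    proof (intro prod.cong refl)
      fix j assume j: "j \<in> ?B"
      then have "A - {j} - {i} = ?B - {j}" by auto
      then show "(\<Prod>l\<in>A - {j}. (var l - var j) ^ a j) =
          (var i - var j :: mono \<Rightarrow>\<^sub>0 int) ^ a j * (\<Prod>l\<in>?B - {j}. (var l - var j) ^ a j)"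
        using prod.remove[of "A - {j}" i "\<lambda>l. (var l - var j :: mono \<Rightarrow>\<^sub>0 int) ^ a j"] j 2 less.prems
        by auto
    qed
    also have "\<dots> = dyson ?B a * (\<Prod>j\<in>?B. (var i - var j) ^ a j)"
      by (simp add: dyson_def prod.distrib mult.commute)
    finally have d: "dyson A a = dyson ?B a * (\<Prod>j\<in>?B. (var i - var j) ^ a j)" .
    have e: "dyson_exp A a = single i (sum a ?B) + dyson_exp ?B a"
      unfolding dyson_exp_def using 2 less.prems by (simp add: sum.remove[of A i] sum)
    have "lookup (dyson A a) (dyson_exp A a) = lookup (dyson ?B a) (dyson_exp ?B a)"
      unfolding d e by (rule lookup_leading) (use A keys_dyson in auto)
    moreover have "(\<Sum>j\<in>?B. a j + 1) < (\<Sum>j\<in>A. a j + 1)"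
      using 2 less.prems by (simp add: sum.remove[of A i])
    ultimately show ?thesis
      using less.hyps[of a ?B] A(2) 2 less.prems
      by (simp add: sum prod.remove[of A i "\<lambda>i. fact (a i)"])
  next
    case 3
    \<comment> \<open>Lowering \<open>a i\<close> by one divides the Dyson product by the product of
      the \<open>w_j - w_i\<close>, as \<open>lagrange_at_0\<close> requires of
      \<open>E i\<close>.\<close>
    define b where "b i = a(i := a i - 1)" for i
    let ?S = "sum a A"
    have dy: "dyson A (b i) * (\<Prod>j\<in>A - {i}. var j - var i) = dyson A a" if i: "i \<in> A" for i
    proof -
      have "dyson A a = (\<Prod>j\<in>A - {i}. (var j - var i) ^ a i) *
          (\<Prod>l\<in>A - {i}. \<Prod>j\<in>A - {l}. (var j - var l) ^ a l)"
        unfolding dyson_def using i less.prems by (simp add: prod.remove[of A i])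
      moreover have "dyson A (b i) = (\<Prod>j\<in>A - {i}. (var j - var i) ^ (a i - 1)) *
          (\<Prod>l\<in>A - {i}. \<Prod>j\<in>A - {l}. (var j - var l) ^ a l)"
        unfolding dyson_def using i less.prems by (simp add: prod.remove[of A i] b_def)
      moreover have "(\<Prod>j\<in>A - {i}. (var j - var i) ^ (a i - 1)) * (\<Prod>j\<in>A - {i}. var j - var i) =
          (\<Prod>j\<in>A - {i}. (var j - var i :: mono \<Rightarrow>\<^sub>0 int) ^ a i)"
        using 3 i by (simp add: prod.distrib[symmetric] power_minus_mult)
      ultimately show ?thesis by (simp add: mult_ac)
    qed
    have lagrange: "(\<Sum>i\<in>A. dyson A (b i) * (\<Prod>j\<in>A - {i}. var j)) = dyson A a"
      using 3 less.prems dy by (intro lagrange_at_0) (auto simp: inj_on_def var_eq_iff)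
    \<comment> \<open>The total drops by one together with \<open>a i\<close>. Hence the clearing
      exponent is unchanged at \<open>i\<close> and drops by one elsewhere, which matches the
      product of the other variables.\<close>
    have shift: "lookup (dyson A (b i) * (\<Prod>j\<in>A - {i}. var j)) (dyson_exp A a) =
        lookup (dyson A (b i)) (dyson_exp A (b i))" if i: "i \<in> A" for i
    proof -
      have ai: "a i > 0" using i 3 by auto
      then have S: "sum (b i) A = ?S - 1" "?S > 0"
        using i less.prems by (simp_all add: sum.remove[of A i] b_def)
      have le: "a j \<le> ?S - 1" if "j \<in> A - {i}" for j
      proof -
        have "a j + a i \<le> ?S"
          using that i less.prems sum_mono2[of A "{j, i}" a] by auto
        moreover have "a i > 0" using 3 i by auto
        ultimately show ?thesis by simp
      qed
      have "single j (?S - a j) = (single j 1 + single j (?S - 1 - a j) :: mono)"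
        if "j \<in> A - {i}" for j
        using le[OF that] S by (simp flip: single_add)
      then have "(\<Sum>j\<in>A - {i}. single j (?S - a j)) =
          ((\<Sum>j\<in>A - {i}. single j 1) + (\<Sum>j\<in>A - {i}. single j (?S - 1 - a j)) :: mono)"
        by (simp add: sum.distrib[symmetric])
      moreover have "dyson_exp A a = single i (?S - a i) + (\<Sum>j\<in>A - {i}. single j (?S - a j))"
        unfolding dyson_exp_def using i less.prems by (intro sum.remove)
      moreover have "dyson_exp A (b i) =
          single i (?S - 1 - b i i) + (\<Sum>j\<in>A - {i}. single j (?S - 1 - b i j))"
        unfolding dyson_exp_def S using i less.prems by (intro sum.remove)
      moreover have "?S - 1 - b i i = ?S - a i" using ai by (simp add: b_def)
      moreover have "(\<Sum>j\<in>A - {i}. single j (?S - 1 - b i j)) =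
          (\<Sum>j\<in>A - {i}. single j (?S - 1 - a j) :: mono)"
        by (intro sum.cong refl) (simp add: b_def)
      ultimately have "dyson_exp A a = (\<Sum>j\<in>A - {i}. single j 1) + dyson_exp A (b i)"
        by (simp only: add_ac)
      moreover have "(\<Prod>j\<in>A - {i}. var j) = (single (\<Sum>j\<in>A - {i}. single j 1) 1 :: mono \<Rightarrow>\<^sub>0 int)"
        by (simp add: prod_single)
      ultimately show ?thesis
        by (simp only: mult.commute[of "dyson A (b i)"] lookup_single_mult mult_1)
    qed
    have "lookup (dyson A a) (dyson_exp A a) =
        (\<Sum>i\<in>A. lookup (dyson A (b i)) (dyson_exp A (b i)))"
      unfolding lagrange[symmetric] lookup_sum by (intro sum.cong refl shift)
    \<comment> \<open>By induction each summand is \<open>a i * fact (S - 1)\<close> after clearing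
      factorials, with \<open>S = sum a A\<close>; these add up to \<open>fact S\<close>.\<close>
    moreover have "lookup (dyson A (b i)) (dyson_exp A (b i)) * (\<Prod>j\<in>A. fact (a j)) =
        fact (?S - 1) * int (a i)" if i: "i \<in> A" for i
    proof -
      have ai: "a i > 0" using i 3 by auto
      then have S: "sum (b i) A = ?S - 1"
        using i less.prems by (simp_all add: sum.remove[of A i] b_def)
      have "(\<Sum>j\<in>A. b i j + 1) < (\<Sum>j\<in>A. a j + 1)"
        using i ai less.prems by (simp add: sum.remove[of A i] b_def)
      from less.hyps[OF this less.prems] have IH:
        "lookup (dyson A (b i)) (dyson_exp A (b i)) * (\<Prod>j\<in>A. fact (b i j)) = fact (?S - 1)"
        by (simp add: S)
      have "(\<Prod>j\<in>A. fact (a j)) = (\<Prod>j\<in>A. fact (b i j)) * int (a i)"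
        using i ai less.prems by (simp add: prod.remove[of A i] b_def fact_reduce[of "a i"] mult_ac)
      then show ?thesis using IH by (simp add: mult.assoc[symmetric])
    qed
    ultimately have "lookup (dyson A a) (dyson_exp A a) * (\<Prod>j\<in>A. fact (a j)) =
        (\<Sum>i\<in>A. fact (?S - 1) * int (a i))"
      by (simp add: sum_distrib_right)
    also have "\<dots> = fact (?S - 1) * int ?S" by (simp add: sum_distrib_left)
    also have "\<dots> = fact ?S"
    proof -
      obtain i where "i \<in> A" using 3 by auto
      then have "?S > 0" using 3 less.prems by (auto simp: sum.remove[of A i])
      then show ?thesis by (simp add: fact_reduce[of ?S] mult.commute)
    qed
    finally show ?thesis .
  qed
qed

section \<open>The central coefficient of the Vandermonde power and its neighbours\<close>

definition flat :: "nat \<Rightarrow> nat \<Rightarrow> mono" where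
  "flat n m = (\<Sum>i<n. single i m)"

lemma lookup_flat: "lookup (flat n m) i = (if i < n then m else 0)"
  by (simp add: flat_def lookup_sum lookup_single when_def sum.delta)

text \<open>With equal exponents each pair contributes
  \<open>(w_j - w_i) (w_i - w_j) = - (w_i - w_j)^2\<close>, whence one sign \<open>(-1)^N\<close>
  per pair.\<close>

lemma dyson_eq_Vand: "dyson {..<n} (\<lambda>_. N) = (- 1) ^ (N * (n choose 2)) * Vand (2 * N) n"
proof (induction n)
  case 0
  then show ?case by (simp add: dyson_def Vand_def binomial_eq_0)
next
  case (Suc n)
  have sq: "(var n - var i) * (var i - var n) = - 1 * (var n - var i :: mono \<Rightarrow>\<^sub>0 int) ^ 2" for i
    by (simp add: power2_eq_square algebra_simps)
  have "dyson {..<Suc n} (\<lambda>_. N) =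
      (\<Prod>j\<in>{..<Suc n} - {n}. (var j - var n) ^ N) *
      (\<Prod>i<n. \<Prod>j\<in>{..<Suc n} - {i}. (var j - var i) ^ N)"
    by (simp add: dyson_def mult.commute)
  also have "{..<Suc n} - {n} = {..<n}" by auto
  also have "(\<Prod>i<n. \<Prod>j\<in>{..<Suc n} - {i}. (var j - var i :: mono \<Rightarrow>\<^sub>0 int) ^ N) =
      (\<Prod>i<n. (var n - var i) ^ N * (\<Prod>j\<in>{..<n} - {i}. (var j - var i) ^ N))"
  proof (intro prod.cong refl)
    fix i assume "i \<in> {..<n}"
    then have "{..<Suc n} - {i} = insert n ({..<n} - {i})" by auto
    then show "(\<Prod>j\<in>{..<Suc n} - {i}. (var j - var i :: mono \<Rightarrow>\<^sub>0 int) ^ N) =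
        (var n - var i) ^ N * (\<Prod>j\<in>{..<n} - {i}. (var j - var i) ^ N)" by simp
  qed
  also have "(\<Prod>j<n. (var j - var n :: mono \<Rightarrow>\<^sub>0 int) ^ N) * \<dots> =
      (\<Prod>i<n. ((var n - var i) * (var i - var n)) ^ N) * dyson {..<n} (\<lambda>_. N)"
    by (simp add: prod.distrib dyson_def power_mult_distrib mult_ac)
  also have "\<dots> = (\<Prod>i<n. (- 1) ^ N * (var n - var i) ^ (2 * N)) *
      ((- 1) ^ (N * (n choose 2)) * Vand (2 * N) n)"
    by (simp only: sq power_mult_distrib power_mult Suc)
  also have "\<dots> = (- 1) ^ (N * (n choose 2) + N * n) * Vand (2 * N) (Suc n)"
    by (simp add: prod.distrib Vand_Suc power_add power_mult mult_ac)
  also have "N * (n choose 2) + N * n = N * (Suc n choose 2)"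
    by (simp add: numeral_2_eq_2 algebra_simps)
  finally show ?case .
qed

lemma Vand_constant_term:
  "lookup (Vand (2 * N) n) (flat n (N * (n - 1))) * fact N ^ n =
    (- 1) ^ (N * (n choose 2)) * fact (N * n)"
proof -
  have e: "dyson_exp {..<n} (\<lambda>_. N) = flat n (N * (n - 1))"
    unfolding dyson_exp_def flat_def by (intro sum.cong refl) (simp add: algebra_simps)
  have sign: "(- 1) ^ m = (single 0 ((- 1) ^ m) :: mono \<Rightarrow>\<^sub>0 int)" for m
    by (cases "even m") (auto simp: single_uminus)
  have "(- 1) ^ (N * (n choose 2)) * lookup (Vand (2 * N) n) (flat n (N * (n - 1))) * fact N ^ n = fact (N * n)"
    using dyson_constant_term[of "{..<n}" "\<lambda>_. N"]
    unfolding e dyson_eq_Vand sign lookup_const_mult by (simp add: mult.commute)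
  then have "(- 1) ^ (N * (n choose 2)) * ((- 1) ^ (N * (n choose 2)) *
      lookup (Vand (2 * N) n) (flat n (N * (n - 1))) * fact N ^ n) =
      (- 1) ^ (N * (n choose 2)) * fact (N * n)" by simp
  then show ?thesis by (simp add: mult.assoc[symmetric] flip: power_mult_distrib)
qed

text \<open>The Vandermonde power is invariant under translating all variables together; the sum of
  the partial derivatives is a derivation that kills every difference.\<close>

lemma sum_pdiff_Vand: "(\<Sum>i<n. pdiff i (Vand N n)) = 0"
proof -
  define D where "D P = (\<Sum>i<n. pdiff i P)" for P :: "mono \<Rightarrow>\<^sub>0 int"
  have mult: "D (P * Q) = 0" if "D P = 0" "D Q = 0" for P Q
  proof -
    have "D (P * Q) = D P * Q + P * D Q"
      by (simp add: D_def pdiff_mult sum.distrib sum_distrib_left sum_distrib_right)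
    then show ?thesis using that by simp
  qed
  have one: "D 1 = 0" by (simp add: D_def)
  have pow: "D (P ^ m) = 0" if "D P = 0" for P m
    by (induction m) (auto simp: one mult that)
  have prod: "D (prod h B) = 0" if "\<And>x. x \<in> B \<Longrightarrow> D (h x) = 0" for h and B :: "nat set"
    using that by (induction B rule: infinite_finite_induct) (auto simp: one mult)
  have var: "D (var j) = 1" if "j < n" for j
  proof -
    have "pdiff i (var j) = (if i = j then 1 else 0 :: mono \<Rightarrow>\<^sub>0 int)" for i
      by (auto simp: pdiff_single lookup_single)
    then show ?thesis using that by (simp add: D_def sum.delta)
  qed
  have diff: "D (var j - var l) = 0" if "j < n" "l < n" for j l
  proof -
    have "D (var j) = D (var j - var l) + D (var l)"
      by (simp add: D_def sum.distrib[symmetric] flip: pdiff_add)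
    then show ?thesis using that by (simp add: var)
  qed
  have "D (Vand N n) = 0"
    unfolding Vand_def by (intro prod pow diff) auto
  then show ?thesis by (simp add: D_def)
qed

text \<open>Compare the coefficients at \<open>e\<close> in \<open>sum_pdiff_Vand\<close>. The
  derivative in variable \<open>i\<close> brings the factor \<open>M + 1\<close>, except for
  \<open>i = 0\<close>, where it is \<open>M\<close>; the difference is the central
  coefficient.\<close>

lemma Vand_neighbours:
  assumes "n > 0" "e + single 0 1 = flat n M"
  shows "int (M + 1) * (\<Sum>i<n. lookup (Vand N n) (e + single i 1)) = lookup (Vand N n) (flat n M)"
proof -
  let ?v = "\<lambda>i. lookup (Vand N n) (e + single i 1)"
  have e: "int (lookup e i + 1) = (if i = 0 then int M else int M + 1)" if "i < n" for i
    using arg_cong[OF assms(2), of "\<lambda>f. lookup f i"] that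
    by (auto simp: lookup_add lookup_single lookup_one lookup_flat when_def split: if_splits)
  have "0 = lookup (\<Sum>i<n. pdiff i (Vand N n)) e" by (simp add: sum_pdiff_Vand)
  also have "\<dots> = (\<Sum>i<n. int (lookup e i + 1) * ?v i)"
    by (simp add: lookup_sum lookup_pdiff)
  also have "\<dots> = (\<Sum>i<n. int (M + 1) * ?v i - (if i = 0 then ?v 0 else 0))"
    by (intro sum.cong refl) (simp only: lessThan_iff e, simp add: algebra_simps)
  also have "\<dots> = int (M + 1) * (\<Sum>i<n. ?v i) - ?v 0"
    using assms(1) by (simp add: sum_subtractf sum_distrib_left sum.delta)
  finally show ?thesis using assms(2) by simp
qed

section \<open>Pairings with the vertex operator product as coefficients\<close>

section \<open>Rectangular and almost rectangular partitions\<close>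

text \<open>The adjoint of \<open>h_{-m}\<close> acts on the polynomial as a power sum, so the
  adjoint of multiplication by \<open>g(x)\<close> acts as the product of the
  \<open>(1 - w_i x)^(- \<alpha>)\<close>. Both sides satisfy the recursion
  \<open>geo_coeff_rec\<close>.\<close>

lemma ip_Psi_gfun_mult:
  assumes "\<alpha> > 0"
  shows "ip \<alpha> (Psi \<alpha> L n P) (gfun \<alpha> (int r) * v) = ip \<alpha> (Psi \<alpha> L n (geo_coeff \<alpha> n r * P)) v"
proof (induction r arbitrary: P rule: less_induct)
  case (less r)
  show ?case
  proof (cases "r = 0")
    case False
    have "of_nat r * ip \<alpha> (Psi \<alpha> L n P) (gfun \<alpha> (int r) * v) =
        ip \<alpha> (Psi \<alpha> L n P) ((of_nat r * gfun \<alpha> (int r)) * v)"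
      by (simp only: ip_of_nat_mult_right[symmetric] mult.assoc)
    also have "\<dots> = of_nat \<alpha> * (\<Sum>i=1..r. ip \<alpha> (Psi \<alpha> L n P) (var (i - 1) * (gfun \<alpha> (int r - int i) * v)))"
      unfolding gfun_rec ip_of_nat_mult_right[symmetric] ip_sum_right[symmetric]
      by (simp add: sum_distrib_left sum_distrib_right mult.assoc)
    also have "(\<Sum>i=1..r. ip \<alpha> (Psi \<alpha> L n P) (var (i - 1) * (gfun \<alpha> (int r - int i) * v))) =
        (\<Sum>i=1..r. ip \<alpha> (Psi \<alpha> L n (geo_coeff \<alpha> n (r - i) * (psum n i * P))) v)"
    proof (intro sum.cong refl)
      fix i assume i: "i \<in> {1..r}"
      have "ip \<alpha> (Psi \<alpha> L n P) (var (i - 1) * (gfun \<alpha> (int r - int i) * v)) =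
          ip \<alpha> (gfun \<alpha> (int r - int i) * v) (h_pos \<alpha> i (Psi \<alpha> L n P))"
        using i by (subst ip_commute) (simp add: ip_adjoint)
      also have "\<dots> = ip \<alpha> (Psi \<alpha> L n (psum n i * P)) (gfun \<alpha> (int (r - i)) * v)"
        using i assms by (subst ip_commute) (simp add: h_pos_Psi of_nat_diff)
      also have "\<dots> = ip \<alpha> (Psi \<alpha> L n (geo_coeff \<alpha> n (r - i) * (psum n i * P))) v"
        using i False by (intro less) auto
      finally show "ip \<alpha> (Psi \<alpha> L n P) (var (i - 1) * (gfun \<alpha> (int r - int i) * v)) =
          ip \<alpha> (Psi \<alpha> L n (geo_coeff \<alpha> n (r - i) * (psum n i * P))) v" .
    qed
    also have "of_nat \<alpha> * \<dots> = ip \<alpha> (Psi \<alpha> L n ((of_nat \<alpha> * (\<Sum>i=1..r. psum n i * geo_coeff \<alpha> n (r - i))) * P)) v"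
      unfolding mult.assoc Psi_of_nat_mult ip_of_nat_mult_left sum_distrib_right Psi_sum ip_sum_left
      by (simp add: mult_ac)
    also have "\<dots> = of_nat r * ip \<alpha> (Psi \<alpha> L n (geo_coeff \<alpha> n r * P)) v"
      unfolding geo_coeff_rec[symmetric] mult.assoc Psi_of_nat_mult ip_of_nat_mult_left ..
    finally show ?thesis using False by simp
  qed simp
qed

text \<open>Split off the kernel factor with exponent \<open>r > K\<close>. By
  \<open>geo_coeff_Vand_eq_0\<close> each surviving monomial has some exponent at least
  \<open>r + \<alpha> (n - 1)\<close>, which exceeds \<open>L\<close>, so a \<open>gfun\<close> with
  negative index appears.\<close>

lemma T0_Psi_Vand_part_le:
  assumes "\<alpha> > 0" "n > 0"
    and L: "\<And>i. i < n \<Longrightarrow> L i \<le> int K + int (\<alpha> * (n - 1))"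
    and "T0 \<alpha> (Psi \<alpha> L n (Vand (2 * \<alpha>) n)) \<epsilon> \<noteq> 0"
  shows "lookup \<epsilon> i \<le> K"
proof (rule ccontr)
  let ?r = "lookup \<epsilon> i"
  assume r: "\<not> ?r \<le> K"
  have "Psi \<alpha> L n (geo_coeff \<alpha> n ?r * Vand (2 * \<alpha>) n) = 0"
    unfolding Psi_def lin_def
  proof (rule sum.neutral, rule ballI)
    fix e assume "e \<in> keys (geo_coeff \<alpha> n ?r * Vand (2 * \<alpha>) n)"
    then obtain j where j: "j < n" "?r + \<alpha> * (n - 1) \<le> lookup e j"
      using geo_coeff_Vand_eq_0[OF assms(1,2), of e ?r] by (force simp: in_keys_iff not_less)
    then have "int ?r + int (\<alpha> * (n - 1)) \<le> int (lookup e j)" by linarith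
    then have "L j - int (lookup e j) < 0" using L[OF j(1)] r by linarith
    then have "(\<Prod>i<n. gfun \<alpha> (L i - int (lookup e i))) = 0"
      using j by (intro prod_zero bexI[of _ j]) auto
    then show "of_int (lookup (geo_coeff \<alpha> n ?r * Vand (2 * \<alpha>) n) e) *
        (\<Prod>i<n. gfun \<alpha> (L i - int (lookup e i))) = 0" by (simp only: mult_zero_right)
  qed
  then show False
    using assms(4) unfolding T0_def Gx_remove[of \<alpha> \<epsilon> i] ip_Psi_gfun_mult[OF assms(1)] by simp
qed

text \<open>The exponent that completes \<open>w^e\<close> to \<open>w^L\<close>; with truncated
  subtraction it has this meaning only for \<open>e \<le> L\<close>.\<close>

definition co_exp :: "(nat \<Rightarrow> nat) \<Rightarrow> nat \<Rightarrow> mono \<Rightarrow> mono" where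
  "co_exp L n e = (\<Sum>i<n. single i (L i - lookup e i))"

lemma lookup_co_exp: "lookup (co_exp L n e) i = (if i < n then L i - lookup e i else 0)"
  by (simp add: co_exp_def lookup_sum lookup_single when_def sum.delta)

text \<open>The reproducing property: the pairing is the coefficient of \<open>w^L\<close> in
  \<open>P(w) f(w_0, ..., w_{n-1})\<close>, where \<open>f = T0 \<alpha> u\<close>.\<close>

lemma ip_Psi:
  "ip \<alpha> (Psi \<alpha> (\<lambda>i. int (L i)) n P) u =
    (\<Sum>e\<in>keys P. of_int (lookup P e) * (if \<forall>i<n. lookup e i \<le> L i then T0 \<alpha> u (co_exp L n e) else 0))"
proof -
  have "(\<Prod>i<n. gfun \<alpha> (int (L i) - int (lookup e i))) =
      (if \<forall>i<n. lookup e i \<le> L i then Gx \<alpha> (co_exp L n e) else 0)" for e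
  proof (cases "\<forall>i<n. lookup e i \<le> L i")
    case True
    have "keys (co_exp L n e) \<subseteq> {..<n}"
      by (auto simp: in_keys_iff lookup_co_exp split: if_splits)
    then have "Gx \<alpha> (co_exp L n e) = (\<Prod>i<n. gfun \<alpha> (int (lookup (co_exp L n e) i)))"
      by (intro Gx_superset) auto
    then show ?thesis using True by (simp add: lookup_co_exp of_nat_diff)
  next
    case False
    then obtain i where "i < n" "int (L i) - int (lookup e i) < 0" by force
    then have "(\<Prod>i<n. gfun \<alpha> (int (L i) - int (lookup e i))) = 0"
      by (intro prod_zero bexI[of _ i]) auto
    then show ?thesis using False by (simp only: if_False)
  qed
  then have "ip \<alpha> (\<Prod>i<n. gfun \<alpha> (int (L i) - int (lookup e i))) u =
      (if \<forall>i<n. lookup e i \<le> L i then T0 \<alpha> u (co_exp L n e) else 0)" for e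
    unfolding T0_def by (simp only: ip_commute[of \<alpha> u] ip_0_left split: if_split) blast
  then show ?thesis
    unfolding Psi_def lin_def ip_sum_left ip_of_int_mult_left by (simp only:)
qed

section \<open>Uniqueness of the almost rectangular partition, and the scalar\<close>

lemma eq_replicate_if_sum_list_ge:
  fixes xs :: "nat list"
  shows "(\<And>x. x \<in> set xs \<Longrightarrow> x \<le> K) \<Longrightarrow> sum_list xs \<ge> length xs * K \<Longrightarrow>
    xs = replicate (length xs) K"
proof (induction xs)
  case (Cons x xs)
  have "sum_list xs \<le> length xs * K"
    using Cons.prems(1) sum_list_mono[of xs "\<lambda>x. x" "\<lambda>_. K"] by (simp add: sum_list_triv)
  moreover have "x \<le> K" using Cons.prems(1) by simp
  ultimately have "x = K" "length xs * K \<le> sum_list xs" using Cons.prems(2) by auto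
  then show ?case using Cons by simp
qed simp

lemma sum_list_le_length_mult:
  fixes xs :: "nat list"
  shows "(\<And>x. x \<in> set xs \<Longrightarrow> x \<le> K) \<Longrightarrow> sum_list xs \<le> length xs * K"
  using sum_list_mono[of xs "\<lambda>x. x" "\<lambda>_. K"] by (simp add: sum_list_triv)

text \<open>For \<open>t = 0\<close> the size is the largest possible. For \<open>t = 1\<close> it
  is one less than \<open>(s + 1) * (k + 1)\<close>, and monotonicity puts the missing unit into the
  last part. The filter drops the part 0 that arises for \<open>k = 0\<close>.\<close>

lemma near_rectangle_unique:
  assumes "is_partition nu" "length nu \<le> s + t" "\<And>x. x \<in> set nu \<Longrightarrow> x \<le> k + 1"
    and "sum_list nu = s * (k + 1) + t * k" "t \<in> {0, 1}"
  shows "nu = filter (\<lambda>i. i \<noteq> 0) (replicate s (k + 1) @ replicate t k)"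
proof (cases "length nu \<le> s")
  case True
  have "sum_list nu \<le> length nu * (k + 1)" using assms(3) by (rule sum_list_le_length_mult)
  also have "\<dots> \<le> s * (k + 1)" using True by (intro mult_right_mono) auto
  finally have tk: "t * k = 0" "length nu * (k + 1) = s * (k + 1)"
    using assms(4) \<open>sum_list nu \<le> length nu * (k + 1)\<close> \<open>length nu * (k + 1) \<le> s * (k + 1)\<close> by linarith+
  then have l: "length nu = s" by simp
  then have "nu = replicate s (k + 1)"
    using eq_replicate_if_sum_list_ge[of nu "k + 1"] assms(3,4) by simp
  moreover have "filter (\<lambda>i. i \<noteq> 0) (replicate t k) = []" using tk(1) by (auto simp: filter_replicate)
  ultimately show ?thesis by (simp add: filter_replicate)
next
  case False
  then have t: "t = 1" and l: "length nu = Suc s" using assms(2,5) by auto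
  then obtain xs y where nu: "nu = xs @ [y]" "length xs = s"
    by (metis append_butlast_last_id length_butlast diff_Suc_1 length_0_conv nat.distinct(1))
  have xs: "x \<le> k + 1" if "x \<in> set xs" for x using assms(3) that nu by simp
  have "sum_list xs \<le> s * (k + 1)" using sum_list_le_length_mult[of xs "k + 1"] xs nu(2) by simp
  then have yk: "y \<ge> k" using assms(4) nu t by simp
  have "y \<noteq> k + 1"
  proof
    assume y: "y = k + 1"
    then have "x = k + 1" if "x \<in> set xs" for x
      using xs[OF that] assms(1) that nu by (auto simp: is_partition_def sorted_wrt_append le_antisym)
    then have "xs = replicate s (k + 1)" using nu(2) by (metis replicate_eqI)
    then show False using assms(4) nu t y by (simp add: sum_list_replicate)
  qed
  then have y: "y = k" using yk assms(3)[of y] nu by simp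
  then have "xs = replicate s (k + 1)"
    using eq_replicate_if_sum_list_ge[of xs "k + 1"] xs assms(4) nu t by simp
  moreover have "k \<noteq> 0" using assms(1) nu y by (auto simp: is_partition_def)
  ultimately show ?thesis using nu y t by (simp add: filter_replicate One_nat_def)
qed

text \<open>Dyson's constant term with its sign; for \<open>t = 1\<close> it is divided by the
  \<open>M + 1\<close> of \<open>Vand_neighbours\<close>, with
  \<open>M = \<alpha> (s + t - 1)\<close>.\<close>

definition scalar :: "nat \<Rightarrow> nat \<Rightarrow> nat \<Rightarrow> rat" where
  "scalar s t \<alpha> = (- 1) ^ (\<alpha> * (s + t choose 2)) * fact (\<alpha> * (s + t)) / fact \<alpha> ^ (s + t) /
    (if t = 0 then 1 else of_nat (\<alpha> * (s + t - 1) + 1))"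

lemma sum_singleton_deviation:
  fixes y :: "nat \<Rightarrow> int"
  assumes "\<And>i. i < n \<Longrightarrow> y i \<ge> 0" "(\<Sum>i<n. y i) = 1"
  obtains i0 where "i0 < n" "\<And>i. i < n \<Longrightarrow> y i = (if i = i0 then 1 else 0)"
proof -
  have "\<exists>i<n. y i \<noteq> 0"
  proof (rule ccontr)
    assume "\<not> ?thesis"
    then have "(\<Sum>i<n. y i) = 0" by (intro sum.neutral) auto
    then show False using assms(2) by simp
  qed
  then obtain i0 where i0: "i0 < n" "y i0 \<noteq> 0" by auto
  have sum: "y i0 + (\<Sum>i\<in>{..<n} - {i0}. y i) = 1"
    using i0 assms(2) by (simp add: sum.remove)
  have "(\<Sum>i\<in>{..<n} - {i0}. y i) \<ge> 0" using assms(1) by (intro sum_nonneg) auto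
  then have z: "y i0 = 1" "(\<Sum>i\<in>{..<n} - {i0}. y i) = 0" using i0 assms(1)[of i0] sum by auto
  then have "y i = 0" if "i < n" "i \<noteq> i0" for i
    using sum_nonneg_eq_0_iff[of "{..<n} - {i0}" y] assms(1) that by auto
  then show ?thesis using that z i0 by metis
qed

lemma sum_near_rectangle: "(\<Sum>i<s + t. if i < t then k else k + 1) = s * (k + 1) + t * (k::nat)"
  by (induction s) auto

lemma fact_add_prod: "fact (m + n) = fact m * (\<Prod>i<n. of_nat (m + i + 1) :: rat)"
  by (induction n) (auto simp: algebra_simps)

lemma rational_ratio_scalar:
  assumes "s > 0"
  shows "rational_ratio (scalar s t)"
proof -
  let ?n = "s + t"
  define m where "m = ?n - 1"
  define B where "B = ?n choose 2"
  \<comment> \<open>\<open>p\<close> collects the sign, the new factors of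
    \<open>fact ((\<alpha> + 1) * ?n)\<close> and the old divisor \<open>\<alpha> m + 1\<close>;
    \<open>q\<close> collects \<open>(\<alpha> + 1)^?n\<close> and the new divisor
    \<open>(\<alpha> + 1) m + 1\<close>. The divisors occur only for
    \<open>t \<noteq> 0\<close>.\<close>
  define p where "p = [:(- 1) ^ B:] * (\<Prod>i<?n. [:of_nat (i + 1), of_nat ?n:]) *
    (if t = 0 then 1 else [:1, of_nat m:] :: rat poly)"
  define q where "q = [:1, 1:] ^ ?n * (if t = 0 then 1 else [:of_nat m + 1, of_nat m:] :: rat poly)"
  have "p \<noteq> 0" "q \<noteq> 0" by (auto simp: p_def q_def simp flip: of_nat_Suc simp del: of_nat_add)
  moreover have "poly q (of_nat \<alpha>) * scalar s t (\<alpha> + 1) = poly p (of_nat \<alpha>) * scalar s t \<alpha>" for \<alpha>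
  proof -
    define d where "d \<alpha> = (if t = 0 then 1 else of_nat (\<alpha> * m + 1) :: rat)" for \<alpha>
    have d: "d a \<noteq> 0" for a by (simp add: d_def del: of_nat_add)
    have d0: "poly (if t = 0 then 1 else [:1, of_nat m:]) (of_nat \<alpha>) = d \<alpha>"
      by (simp add: d_def algebra_simps)
    have d1: "poly (if t = 0 then 1 else [:of_nat m + 1, of_nat m:]) (of_nat \<alpha>) = d (\<alpha> + 1)"
      by (simp add: d_def algebra_simps)
    have "fact ((\<alpha> + 1) * ?n) = fact (\<alpha> * ?n) * (\<Prod>i<?n. of_nat (\<alpha> * ?n + i + 1) :: rat)"
      using fact_add_prod[of "\<alpha> * ?n" ?n] by (simp add: algebra_simps)
    moreover have "(\<Prod>i<?n. of_nat (\<alpha> * ?n + i + 1) :: rat) = poly (\<Prod>i<?n. [:of_nat (i + 1), of_nat ?n:]) (of_nat \<alpha>)"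
      by (simp add: poly_prod algebra_simps)
    ultimately have f: "fact ((\<alpha> + 1) * ?n) =
        fact (\<alpha> * ?n) * poly (\<Prod>i<?n. [:of_nat (i + 1), of_nat ?n:]) (of_nat \<alpha> :: rat)"
      by simp
    have f1: "fact (\<alpha> + 1) ^ ?n = (fact \<alpha> * (of_nat \<alpha> + 1) :: rat) ^ ?n"
      unfolding Suc_eq_plus1[symmetric] fact_Suc by (simp add: mult.commute add.commute)
    have sign: "(- 1) ^ ((\<alpha> + 1) * B) = ((- 1) ^ (\<alpha> * B) * (- 1) ^ B :: rat)"
      by (simp add: power_add distrib_right)
    have pos: "(of_nat \<alpha> + 1 :: rat) \<noteq> 0" "(1 + of_nat \<alpha> :: rat) \<noteq> 0"
      by (metis of_nat_Suc of_nat_eq_0_iff nat.distinct(1) add.commute)+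
    have c: "scalar s t a = (- 1) ^ (a * B) * fact (a * ?n) / fact a ^ ?n / d a" for a
      by (simp add: scalar_def d_def B_def m_def)
    show ?thesis
      unfolding c p_def q_def poly_mult d0 d1 f f1 sign poly_power power_mult_distrib
      using pos d[of \<alpha>] d[of "\<alpha> + 1"] by (simp add: field_simps)
  qed
  ultimately show ?thesis unfolding rational_ratio_def by blast
qed

text \<open>For \<open>t = 1\<close> the divisor is \<open>s + 1\<close>, which reduces
  \<open>fact (s + 1)\<close> to \<open>fact s\<close>.\<close>

lemma scalar_1:
  assumes "s > 0" "t \<in> {0, 1}"
  shows "scalar s t 1 = (- 1) ^ (s * (s - 1 + 2 * t) div 2) * fact s"
proof (cases "t = 0")
  case True
  then show ?thesis by (simp add: scalar_def choose_two)
next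
  case False
  then have "t = 1" using assms by simp
  moreover have "fact (s + 1) = (fact s * of_nat (s + 1) :: rat)"
    unfolding Suc_eq_plus1[symmetric] fact_Suc by (rule mult.commute)
  moreover have "(s + 1 choose 2) = s * (s - 1 + 2 * 1) div 2"
    using assms by (simp add: choose_two algebra_simps)
  ultimately show ?thesis by (simp add: scalar_def del: of_nat_add)
qed

text \<open>\<open>jack_Q_characterization\<close> applies with \<open>K = k + 1\<close>. By
  \<open>ip_Psi\<close> all pairings are sums over exponents \<open>e\<close> whose complement in
  \<open>L\<close> has at most \<open>n\<close> parts and the size of \<open>lam\<close>; for
  \<open>P lam\<close> only complements of shape \<open>lam\<close> count.\<close>

lemma vertex_Psi_eq_jack_Q:
  fixes s t k \<alpha> :: nat
  defines "n \<equiv> s + t" and "lam \<equiv> filter (\<lambda>i. i \<noteq> 0) (replicate s (k + 1) @ replicate t k)"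
  defines "L \<equiv> (\<lambda>i. (if i < t then k else k + 1) + \<alpha> * (n - 1))"
  assumes "\<alpha> > 0" "s > 0" "t \<in> {0, 1}" "is_jack_family \<alpha> P"
  shows "T0 \<alpha> (Psi \<alpha> (\<lambda>i. int (L i)) n (Vand (2 * \<alpha>) n)) =
    (\<lambda>e. of_rat (scalar s t \<alpha>) * jack_Q \<alpha> P lam e)"
proof -
  let ?V = "Vand (2 * \<alpha>) n" and ?F = "Psi \<alpha> (\<lambda>i. int (L i)) n (Vand (2 * \<alpha>) n)"
  define M where "M = \<alpha> * (n - 1)"
  define N where "N = s * (k + 1) + t * k"
  define ok where "ok e \<longleftrightarrow> (\<forall>i<n. lookup e i \<le> L i)" for e :: mono
  have LM: "L i = (if i < t then k else k + 1) + M" for i by (simp add: L_def M_def)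
  have "n > 0" using assms(5) by (simp add: n_def)
  have part: "is_partition lam"
  proof -
    have "sorted_wrt (\<ge>) (replicate m x)" for m and x :: nat by (induction m) auto
    then show ?thesis
      by (auto simp: is_partition_def lam_def sorted_wrt_append intro!: sorted_wrt_filter)
  qed
  have lam_le: "x \<le> k + 1" if "x \<in> set lam" for x
    using that by (auto simp: lam_def split: if_splits)
  have V: "\<And>i. i \<ge> n \<Longrightarrow> lookup e i = 0" "(\<Sum>i<n. int (lookup e i)) = int n * int M"
    if "e \<in> keys ?V" for e
  proof -
    show "\<And>i. i \<ge> n \<Longrightarrow> lookup e i = 0"
      using that vars_below_Vand[of n "2 * \<alpha>"] by (auto simp: vars_below_def)
    have "(\<Sum>i<n. lookup e i) = \<alpha> * n * (n - 1)"
      using that homog_Vand[of n \<alpha>] by (simp add: homog_def)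
    then have "(\<Sum>i<n. lookup e i) = n * M" by (simp add: M_def mult_ac)
    then show "(\<Sum>i<n. int (lookup e i)) = int n * int M"
      unfolding of_nat_sum[symmetric] of_nat_mult[symmetric] of_nat_eq_iff .
  qed
  have keys_co: "keys (co_exp L n e) \<subseteq> {..<n}" for e
    by (auto simp: in_keys_iff lookup_co_exp split: if_splits)
  have len: "length (shape (co_exp L n e)) \<le> n" for e
    using card_mono[OF _ keys_co[of e]] by (simp add: length_shape)
  have size: "sum_list (shape (co_exp L n e)) = N" if "e \<in> keys ?V" "ok e" for e
  proof -
    have "sum_list (shape (co_exp L n e)) = (\<Sum>i<n. lookup (co_exp L n e) i)"
      unfolding sum_list_shape using keys_co[of e]
      by (intro sum.mono_neutral_left) (auto simp: in_keys_iff)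
    also have "\<dots> = (\<Sum>i<n. L i - lookup e i)" by (simp add: lookup_co_exp)
    also have "int \<dots> = (\<Sum>i<n. int (L i)) - (\<Sum>i<n. int (lookup e i))"
      using that(2) by (simp add: ok_def of_nat_diff sum_subtractf)
    also have "(\<Sum>i<n. int (L i)) = int (\<Sum>i<n. if i < t then k else k + 1) + int n * int M"
      by (simp add: LM sum.distrib)
    finally show ?thesis
      using V(2)[OF that(1)] sum_near_rectangle[where s = s and t = t and k = k]
      by (simp only: n_def N_def)
  qed
  have shape_lam: "shape (co_exp L n e) = lam \<longleftrightarrow> (\<forall>i<n. L i - lookup e i \<le> k + 1)"
    if e: "e \<in> keys ?V" "ok e" for e
  proof
    assume *: "shape (co_exp L n e) = lam"
    show "\<forall>i<n. L i - lookup e i \<le> k + 1"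
    proof (intro allI impI)
      fix i assume "i < n"
      then have v: "lookup (co_exp L n e) i = L i - lookup e i" by (simp add: lookup_co_exp)
      show "L i - lookup e i \<le> k + 1"
      proof (cases "i \<in> keys (co_exp L n e)")
        case True
        then have "lookup (co_exp L n e) i \<in> set lam" using * set_shape by blast
        then show ?thesis using lam_le v by metis
      next
        case False
        then show ?thesis using v by (simp add: in_keys_iff)
      qed
    qed
  next
    assume *: "\<forall>i<n. L i - lookup e i \<le> k + 1"
    have "x \<le> k + 1" if "x \<in> set (shape (co_exp L n e))" for x
      using that * by (auto simp: set_shape lookup_co_exp)
    then show "shape (co_exp L n e) = lam"
      unfolding lam_def using size[OF e] len[of e] assms(6)
      by (intro near_rectangle_unique) (simp_all only: N_def n_def shape_partition)
  qed
  \<comment> \<open>\<open>e0\<close> is \<open>L\<close> lowered by \<open>k + 1\<close> in every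
    variable. For \<open>t = 1\<close> the complement must contain one entry \<open>k\<close>, in
    any position, which gives the \<open>n\<close> exponents of \<open>Ex\<close>.\<close>
  define e0 where "e0 = flat n M - (if t = 0 then 0 else single 0 1)"
  define Ex where "Ex = (if t = 0 then {e0} else (\<lambda>i. e0 + single i 1) ` {..<n})"
  \<comment> \<open>Needed so that the subtraction in \<open>e0\<close> is not truncated.\<close>
  have M_pos: "M > 0" if "t = 1"
    using that assms(4,5) by (simp add: M_def n_def)
  have e0: "int (lookup e0 i) = (if i < n then int M - (if i < t then 1 else 0) else 0)" for i
    using assms(6) M_pos \<open>n > 0\<close>
    by (auto simp: e0_def lookup_minus lookup_flat lookup_single lookup_one when_def of_nat_diff)
  have L_int: "int (L i) = int (k + 1) - (if i < t then 1 else 0) + int M" for i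
    by (simp add: LM)
  have Ex_iff: "(ok e \<and> shape (co_exp L n e) = lam) \<longleftrightarrow> e \<in> Ex" if e: "e \<in> keys ?V" for e
  proof
    \<comment> \<open>The excess over \<open>e0\<close> is nonnegative because the complement is
      bounded by \<open>k + 1\<close>, and by homogeneity it sums to \<open>t\<close>.\<close>
    define y where "y i = int (lookup e i) - int (lookup e0 i)" for i
    assume a: "ok e \<and> shape (co_exp L n e) = lam"
    have y0: "y i \<ge> 0" if "i < n" for i
    proof -
      have "lookup e i \<le> L i" "L i - lookup e i \<le> k + 1"
        using a that shape_lam[OF e] by (auto simp: ok_def)
      then have "int (L i) - int (lookup e i) \<le> int (k + 1)" by linarith
      then show ?thesis using that by (simp add: y_def e0 L_int)
    qed
    have "(\<Sum>i<n. int (lookup e0 i)) = (\<Sum>i<n. int M - (if i < t then 1 else 0))"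
      by (intro sum.cong refl) (simp add: e0)
    also have "\<dots> = int n * int M - int t"
      using assms(6) \<open>n > 0\<close> by (auto simp: sum_subtractf sum.delta)
    finally have sum_y: "(\<Sum>i<n. y i) = int t"
      using V(2)[OF e] by (simp add: y_def sum_subtractf)
    have out: "lookup e i = lookup e0 i" if "i \<ge> n" for i
      using V(1)[OF e that] e0[of i] that by simp
    show "e \<in> Ex"
    proof (cases "t = 0")
      case True
      then have "y i = 0" if "i < n" for i
        using sum_y y0 that sum_nonneg_eq_0_iff[of "{..<n}" y] by auto
      then have "e = e0"
        using out by (intro poly_mapping_eqI) (metis y_def eq_iff_diff_eq_0 of_nat_eq_iff not_le)
      then show ?thesis using True by (simp add: Ex_def)
    next
      case False
      then have "(\<Sum>i<n. y i) = 1" using sum_y assms(6) by simp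
      then obtain i0 where i0: "i0 < n" "\<And>i. i < n \<Longrightarrow> y i = (if i = i0 then 1 else 0)"
        using sum_singleton_deviation[of n y, OF y0] by metis
      have "e = e0 + single i0 1"
      proof (rule poly_mapping_eqI)
        fix i
        show "lookup e i = lookup (e0 + single i0 1) i"
        proof (cases "i < n")
          case True
          then have "int (lookup e i) = int (lookup (e0 + single i0 1) i)"
            using i0(2)[of i] by (simp add: y_def lookup_add lookup_single when_def split: if_splits)
          then show ?thesis by simp
        next
          case False
          then show ?thesis using out[of i] i0(1) by (simp add: lookup_add lookup_single)
        qed
      qed
      then show ?thesis using False i0(1) by (simp add: Ex_def)
    qed
  next
    assume "e \<in> Ex"
    then obtain y where y: "\<And>i. int (lookup e i) = int (lookup e0 i) + y i" "\<And>i. y i \<in> {0, 1}"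
    proof (cases "t = 0")
      case True
      then show ?thesis using \<open>e \<in> Ex\<close> that[of "\<lambda>_. 0"] by (simp add: Ex_def)
    next
      case False
      then obtain i0 where "e = e0 + single i0 1" using \<open>e \<in> Ex\<close> by (auto simp: Ex_def)
      then show ?thesis
        using that[of "\<lambda>i. if i = i0 then 1 else 0"] by (simp add: lookup_add lookup_single when_def)
    qed
    have "int (L i) - int (lookup e i) = int (k + 1) - y i" if "i < n" for i
      using y(1)[of i] that by (simp add: e0 L_int)
    then have d: "0 \<le> int (L i) - int (lookup e i) \<and> int (L i) - int (lookup e i) \<le> int (k + 1)" if "i < n" for i
      using y(2)[of i] that by auto
    then have "ok e" by (force simp: ok_def)
    moreover have "L i - lookup e i \<le> k + 1" if "i < n" for i using d[OF that] by linarith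
    ultimately show "ok e \<and> shape (co_exp L n e) = lam" using shape_lam[OF e] by blast
  qed
  have "fact \<alpha> ^ n * of_int (lookup ?V (flat n M)) = ((- 1) ^ (\<alpha> * (n choose 2)) * fact (\<alpha> * n) :: rat)"
    using arg_cong[OF Vand_constant_term[of \<alpha> n], of "of_int :: int \<Rightarrow> rat"]
    by (simp add: M_def mult.commute)
  then have flat: "of_int (lookup ?V (flat n M)) = (- 1) ^ (\<alpha> * (n choose 2)) * fact (\<alpha> * n) / (fact \<alpha> ^ n :: rat)"
    by (simp add: field_simps)
  \<comment> \<open>For \<open>t = 0\<close> this is the central coefficient itself, for
    \<open>t = 1\<close> the sum over its neighbours.\<close>
  have Ex_sum: "of_int (\<Sum>e\<in>Ex. lookup ?V e) = scalar s t \<alpha>"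
  proof (cases "t = 0")
    case True
    then show ?thesis using flat by (simp add: Ex_def e0_def scalar_def n_def)
  next
    case False
    then have t: "t = 1" using assms(6) by simp
    have e: "e0 + single 0 1 = flat n M"
    proof (rule poly_mapping_eqI)
      fix i
      have "int (lookup (e0 + single 0 1) i) = int (lookup (flat n M) i)"
        using e0[of i] t \<open>n > 0\<close> by (auto simp: lookup_add lookup_one lookup_flat when_def)
      then show "lookup (e0 + single 0 1) i = lookup (flat n M) i" by simp
    qed
    have "(\<Sum>e\<in>Ex. lookup ?V e) = (\<Sum>i<n. lookup ?V (e0 + single i 1))"
      using False by (simp add: Ex_def sum.reindex inj_on_def single_index_eq_iff)
    then have "of_int (int (M + 1)) * of_int (\<Sum>e\<in>Ex. lookup ?V e) = (of_int (lookup ?V (flat n M)) :: rat)"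
      using Vand_neighbours[OF \<open>n > 0\<close> e, of "2 * \<alpha>"] by (simp only: of_int_mult[symmetric])
    then have "of_int (\<Sum>e\<in>Ex. lookup ?V e) = of_int (lookup ?V (flat n M)) / (of_nat (M + 1) :: rat)"
      by (simp add: field_simps del: of_nat_add)
    then show ?thesis using t flat by (simp add: scalar_def n_def M_def del: of_nat_add)
  qed
  show ?thesis
  proof (rule jack_Q_characterization[OF assms(4,7) part])
    fix \<epsilon> i assume "T0 \<alpha> ?F \<epsilon> \<noteq> 0"
    then show "lookup \<epsilon> i \<le> k + 1"
      by (rule T0_Psi_Vand_part_le[OF assms(4) \<open>n > 0\<close>, rotated]) (simp add: L_def)
  next
    fix nu u assume nu: "is_partition nu" "nu \<noteq> lam" "\<And>x. x \<in> set nu \<Longrightarrow> x \<le> k + 1" "T0 \<alpha> u = P nu"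
    \<comment> \<open>A shape dominated by \<open>nu\<close> with at most \<open>n\<close> parts
      bounds the length of \<open>nu\<close>; together with the bound on its parts this leaves only
      \<open>lam\<close>.\<close>
    have "P nu (co_exp L n e) = 0" if e: "e \<in> keys ?V" "ok e" for e
    proof (rule ccontr)
      assume "P nu (co_exp L n e) \<noteq> 0"
      then have dom: "dominates nu (shape (co_exp L n e))"
        using jack_value(1)[OF assms(7) nu(1)] by blast
      then have "length nu \<le> s + t" "sum_list nu = s * (k + 1) + t * k"
        using dominates_length_le[OF dom nu(1) len] size[OF e]
        by (auto simp: n_def dominates_def N_def)
      then have "nu = lam"
        unfolding lam_def using nu(1,3) assms(6) by (intro near_rectangle_unique)
      then show False using nu(2) by blast
    qed
    then show "ip \<alpha> ?F u = 0"
      unfolding ip_Psi nu(4) ok_def[symmetric] by (intro sum.neutral) auto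
  next
    fix u assume u: "T0 \<alpha> u = P lam"
    have P: "P lam (co_exp L n e) = (if shape (co_exp L n e) = lam then 1 else 0)"
      if e: "e \<in> keys ?V" "ok e" for e
    proof (cases "shape (co_exp L n e) = lam")
      case True
      then show ?thesis using jack_value(2)[OF assms(7) part] by simp
    next
      case False
      have "P lam (co_exp L n e) = 0"
      proof (rule ccontr)
        assume "P lam (co_exp L n e) \<noteq> 0"
        then have dom: "dominates lam (shape (co_exp L n e))"
          using jack_value(1)[OF assms(7) part] by blast
        then have "shape (co_exp L n e) = lam"
          unfolding lam_def using dominates_parts_le[OF dom shape_partition lam_le] size[OF e] len[of e] assms(6)
          by (intro near_rectangle_unique) (auto simp: N_def n_def shape_partition)
        then show False using False by blast
      qed
      then show ?thesis using False by simp
    qed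
    have "ip \<alpha> ?F u = (\<Sum>e\<in>keys ?V. if e \<in> Ex then of_int (lookup ?V e) else 0)"
      unfolding ip_Psi u ok_def[symmetric]
    proof (intro sum.cong refl)
      fix e assume "e \<in> keys ?V"
      then show "of_int (lookup ?V e) * (if ok e then P lam (co_exp L n e) else 0) =
          (if e \<in> Ex then of_int (lookup ?V e) else 0)"
        using P Ex_iff by auto
    qed
    also have "\<dots> = (\<Sum>e\<in>keys ?V \<inter> Ex. of_int (lookup ?V e))"
      by (simp add: sum.inter_restrict)
    also have "\<dots> = (\<Sum>e\<in>Ex. of_int (lookup ?V e))"
      by (rule sum.mono_neutral_left) (auto simp: Ex_def in_keys_iff split: if_splits)
    also have "\<dots> = of_rat (scalar s t \<alpha>)"
      unfolding Ex_sum[symmetric] of_rat_of_int_eq by simp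
    finally show "ip \<alpha> ?F u = of_rat (scalar s t \<alpha>)" .
  qed
qed

text \<open>The witness \<open>scalar s t\<close> is independent of \<open>k\<close>: the
  contributing exponents lie at or next to \<open>flat n M\<close>, which does not involve
  \<open>k\<close>.\<close>

theorem theorem3p10:
  fixes k s t :: nat
  assumes "s > 0" and "t \<in> {0, 1}"
  shows "\<exists>c :: nat \<Rightarrow> rat.
    rational_ratio c \<and>
    (\<forall>\<alpha> P. \<alpha> > 0 \<longrightarrow> is_jack_family \<alpha> P \<longrightarrow>
       T_map ((X_op \<alpha> (- int (k + 1)) ^^ s)
               ((X_op \<alpha> (- int k) ^^ t) (e_half (- int (s + t)))))
       = (\<lambda>e. of_rat (c \<alpha>) *
            jack_Q \<alpha> P (filter (\<lambda>i. i \<noteq> 0) (replicate s (k + 1) @ replicate t k)) e)) \<and>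
    c 1 = (- 1) ^ (s * (s - 1 + 2 * t) div 2) * fact s"
proof (intro exI[of _ "scalar s t"] conjI allI impI)
  show "rational_ratio (scalar s t)" by (rule rational_ratio_scalar[OF assms(1)])
  show "scalar s t 1 = (- 1) ^ (s * (s - 1 + 2 * t) div 2) * fact s"
    by (rule scalar_1[OF assms])
  fix \<alpha> P assume "\<alpha> > (0::nat)" "is_jack_family \<alpha> P"
  \<comment> \<open>Since \<open>s + t > 0\<close>, the integer shift in
    \<open>vertex_product\<close> is a natural number.\<close>
  define L where "L i = (if i < t then k else k + 1) + \<alpha> * (s + t - 1)" for i
  have L: "(\<lambda>i. int (L i)) = (\<lambda>i. int (if i < t then k else k + 1) + int \<alpha> * (int (s + t) - 1))"
    using assms(1) by (auto simp: L_def fun_eq_iff of_nat_diff)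
  show "T_map ((X_op \<alpha> (- int (k + 1)) ^^ s) ((X_op \<alpha> (- int k) ^^ t) (e_half (- int (s + t))))) =
      (\<lambda>e. of_rat (scalar s t \<alpha>) *
        jack_Q \<alpha> P (filter (\<lambda>i. i \<noteq> 0) (replicate s (k + 1) @ replicate t k)) e)"
    unfolding vertex_product[OF \<open>\<alpha> > 0\<close> refl L] T_map_single[OF \<open>\<alpha> > 0\<close>] L_def
    by (rule vertex_Psi_eq_jack_Q) (use assms \<open>\<alpha> > 0\<close> \<open>is_jack_family \<alpha> P\<close> in auto)
qed

end
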